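(* Let $M$ be a tame paving matroid of rank $n$ on $[d]$. Then the circuit variety of $M$ has the irredundant irreducible decomposition $$V_{\mathcal{C}(M)}=\bigcup_{\mathcal{Q}}V_{M(\mathcal{Q})},$$ where the union is over all nice partitions $\mathcal{Q}$ of the set of dependent hyperplanes of $M$; that is, the equality holds, each $V_{M(\mathcal{Q})}$ is irreducible, and $V_{M(\mathcal{Q}_1)}\not\subseteq V_{M(\mathcal{Q}_2)}$ for distinct nice partitions $\mathcal{Q}_1\ne\mathcal{Q}_2$.
   Context: A matroid of rank $n$ is paving ($n$-paving) if every circuit has size $n$ or $n+1$; a dependent hyperplane is a maximal subset of size at least $n$ all of whose $n$-subsets are circuits; a paving matroid is tame if any three distinct dependent hyperplanes have empty intersection. Varieties: for a matroid $N$ on $[d]$, a realization in $\mathbb{C}^n$ is a tuple $(\gamma_1,\ldots,\gamma_d)\in(\mathbb{C}^n)^d=\mathbb{C}^{nd}$ such that $S\subseteq[d]$ is dependent in $N$ iff $(\gamma_i)_{i\in S}$ is linearly dependent; the matroid variety $V_N\subseteq\mathbb{C}^{nd}$ is the Zariski closure of the set of realizations. The circuit variety $V_{\mathcal{C}(N)}$ is the set of tuples $(\gamma_i)$ in $(\mathbb{C}^n)^d$ such that $(\gamma_i)_{i\in S}$ is linearly dependent for every dependent set $S$ of $N$. Here $n=\operatorname{rank}M$ throughout. Quasi-paving construction: for a collection $\mathcal{H}$ of subsets of $[d]$ any three of which have empty intersection, the matroid on $[d]$ whose circuits are (Type 1) the $(n-1)$-subsets contained in the intersection of two distinct members of $\mathcal{H}$,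 (Type 2) the $n$-subsets of a member of $\mathcal{H}$ containing no Type 1 set, (Type 3) the $(n+1)$-subsets containing no Type 1 or Type 2 set. For a partition $\mathcal{Q}=\{Q_1,\ldots,Q_k\}$ of the dependent hyperplanes, $M(\mathcal{Q})$ is obtained by this construction with $\mathcal{H}=\{H_1,\ldots,H_k\}$, $H_i=\bigcup_{l\in Q_i}l$. For a set $L$ of at least two dependent hyperplanes, $M^L$ is the $n$-paving matroid on $\bigcup_{l\in L}l$ whose set of dependent hyperplanes is exactly $L$. An $n$-paving matroid $N$ on a set $E$ is liftable if for every tuple $(\gamma_e)_{e\in E}$ of vectors in $\mathbb{C}^n$ spanning a hyperplane $H$ and every $q\notin H$, there are scalars $z_e$ with $(\gamma_e+z_eq)_{e\in E}\in V_{\mathcal{C}(N)}$ and the vectors $\gamma_e+z_eq$ not all contained in a common hyperplane. A partition $\mathcal{Q}=\{Q_1,\ldots,Q_k\}$ of the dependent hyperplanes of $M$ is nice if (i) $M^{Q_i}$ is not liftable for every $i$ with $|Q_i|\ge2$, and (ii) there is no $i$ and dependent hyperplane $l\notin Q_i$ with $l\subseteq\bigcup_{l'\in Q_i}l'$. *)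

theory Defs
  imports Complex_Main "HOL-Library.Disjoint_Sets"
begin

definition lin_dep_fam :: "('d \<Rightarrow> 'n::finite \<Rightarrow> complex) \<Rightarrow> 'd set \<Rightarrow> bool" where
  "lin_dep_fam \<gamma> S \<longleftrightarrow> (\<exists>c. (\<exists>i\<in>S. c i \<noteq> 0) \<and> (\<forall>j. (\<Sum>i\<in>S. c i * \<gamma> i j) = 0))"

definition lin_hyperplane :: "('n::finite \<Rightarrow> complex) set \<Rightarrow> bool" where
  "lin_hyperplane H \<longleftrightarrow> (\<exists>a::'n \<Rightarrow> complex. (\<exists>j. a j \<noteq> 0) \<and> H = {x. (\<Sum>j\<in>UNIV. a j * x j) = 0})"

definition fam_span :: "'d set \<Rightarrow> ('d \<Rightarrow> 'n::finite \<Rightarrow> complex) \<Rightarrow> ('n \<Rightarrow> complex) set" where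
  "fam_span E \<gamma> = {x. \<exists>c. x = (\<lambda>j. \<Sum>e\<in>E. c e * \<gamma> e j)}"

inductive_set polyfun :: "(('d \<Rightarrow> 'n \<Rightarrow> complex) \<Rightarrow> complex) set" where
  pf_const: "(\<lambda>_. c) \<in> polyfun"
| pf_coord: "(\<lambda>\<gamma>. \<gamma> i j) \<in> polyfun"
| pf_add: "p \<in> polyfun \<Longrightarrow> q \<in> polyfun \<Longrightarrow> (\<lambda>\<gamma>. p \<gamma> + q \<gamma>) \<in> polyfun"
| pf_mult: "p \<in> polyfun \<Longrightarrow> q \<in> polyfun \<Longrightarrow> (\<lambda>\<gamma>. p \<gamma> * q \<gamma>) \<in> polyfun"

definition zariski_closed :: "('d \<Rightarrow> 'n \<Rightarrow> complex) set \<Rightarrow> bool" where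
  "zariski_closed X \<longleftrightarrow> (\<exists>P. P \<subseteq> polyfun \<and> X = {x. \<forall>p\<in>P. p x = 0})"

definition zariski_closure :: "('d \<Rightarrow> 'n \<Rightarrow> complex) set \<Rightarrow> ('d \<Rightarrow> 'n \<Rightarrow> complex) set" where
  "zariski_closure X = \<Inter>{Y. zariski_closed Y \<and> X \<subseteq> Y}"

definition zariski_irreducible :: "('d \<Rightarrow> 'n \<Rightarrow> complex) set \<Rightarrow> bool" where
  "zariski_irreducible X \<longleftrightarrow> X \<noteq> {} \<and>
     (\<forall>A B. zariski_closed A \<longrightarrow> zariski_closed B \<longrightarrow> X \<subseteq> A \<union> B \<longrightarrow> X \<subseteq> A \<or> X \<subseteq> B)"

definition matroid :: "'d::finite set set \<Rightarrow> bool" where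
  "matroid M \<longleftrightarrow> {} \<in> M \<and> (\<forall>A B. B \<in> M \<longrightarrow> A \<subseteq> B \<longrightarrow> A \<in> M) \<and>
     (\<forall>A B. A \<in> M \<longrightarrow> B \<in> M \<longrightarrow> card A < card B \<longrightarrow> (\<exists>x\<in>B - A. insert x A \<in> M))"

definition mrank :: "'d::finite set set \<Rightarrow> nat" where
  "mrank M = Max (card ` M)"

definition circuit :: "'d::finite set set \<Rightarrow> 'd set \<Rightarrow> bool" where
  "circuit M C \<longleftrightarrow> C \<notin> M \<and> (\<forall>C'. C' \<subset> C \<longrightarrow> C' \<in> M)"

definition paving :: "'d::finite set set \<Rightarrow> bool" where
  "paving M \<longleftrightarrow> (\<forall>C. circuit M C \<longrightarrow> card C = mrank M \<or> card C = mrank M + 1)"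

definition all_n_subsets_circuits :: "'d::finite set set \<Rightarrow> 'd set \<Rightarrow> bool" where
  "all_n_subsets_circuits M l \<longleftrightarrow> card l \<ge> mrank M \<and>
     (\<forall>S. S \<subseteq> l \<longrightarrow> card S = mrank M \<longrightarrow> circuit M S)"

definition dep_hyperplane :: "'d::finite set set \<Rightarrow> 'd set \<Rightarrow> bool" where
  "dep_hyperplane M l \<longleftrightarrow> all_n_subsets_circuits M l \<and>
     (\<forall>l'. l \<subset> l' \<longrightarrow> \<not> all_n_subsets_circuits M l')"

definition dep_hyperplanes :: "'d::finite set set \<Rightarrow> 'd set set" where
  "dep_hyperplanes M = {l. dep_hyperplane M l}"

definition tame :: "'d::finite set set \<Rightarrow> bool" where
  "tame M \<longleftrightarrow> (\<forall>a b c. dep_hyperplane M a \<longrightarrow> dep_hyperplane M b \<longrightarrow> dep_hyperplane M c \<longrightarrow>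
      a \<noteq> b \<longrightarrow> a \<noteq> c \<longrightarrow> b \<noteq> c \<longrightarrow> a \<inter> b \<inter> c = {})"

definition realization :: "('d set \<Rightarrow> bool) \<Rightarrow> ('d \<Rightarrow> 'n::finite \<Rightarrow> complex) \<Rightarrow> bool" where
  "realization Dep \<gamma> \<longleftrightarrow> (\<forall>S. Dep S \<longleftrightarrow> lin_dep_fam \<gamma> S)"

definition matroid_variety :: "('d set \<Rightarrow> bool) \<Rightarrow> ('d \<Rightarrow> 'n::finite \<Rightarrow> complex) set" where
  "matroid_variety Dep = zariski_closure {\<gamma>. realization Dep \<gamma>}"

definition circuit_variety :: "('d set \<Rightarrow> bool) \<Rightarrow> ('d \<Rightarrow> 'n::finite \<Rightarrow> complex) set" where
  "circuit_variety Dep = {\<gamma>. \<forall>S. Dep S \<longrightarrow> lin_dep_fam \<gamma> S}"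

definition qp_type1 :: "nat \<Rightarrow> 'd set set \<Rightarrow> 'd set \<Rightarrow> bool" where
  "qp_type1 n H S \<longleftrightarrow> card S = n - 1 \<and> (\<exists>h1\<in>H. \<exists>h2\<in>H. h1 \<noteq> h2 \<and> S \<subseteq> h1 \<inter> h2)"

definition qp_type2 :: "nat \<Rightarrow> 'd set set \<Rightarrow> 'd set \<Rightarrow> bool" where
  "qp_type2 n H S \<longleftrightarrow> card S = n \<and> (\<exists>h\<in>H. S \<subseteq> h) \<and> \<not> (\<exists>T. T \<subseteq> S \<and> qp_type1 n H T)"

definition qp_type3 :: "nat \<Rightarrow> 'd set set \<Rightarrow> 'd set \<Rightarrow> bool" where
  "qp_type3 n H S \<longleftrightarrow> card S = n + 1 \<and> \<not> (\<exists>T. T \<subseteq> S \<and> (qp_type1 n H T \<or> qp_type2 n H T))"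

definition qp_circuit :: "nat \<Rightarrow> 'd set set \<Rightarrow> 'd set \<Rightarrow> bool" where
  "qp_circuit n H S \<longleftrightarrow> qp_type1 n H S \<or> qp_type2 n H S \<or> qp_type3 n H S"

definition qp_dep :: "nat \<Rightarrow> 'd set set \<Rightarrow> 'd set \<Rightarrow> bool" where
  "qp_dep n H S \<longleftrightarrow> (\<exists>C. C \<subseteq> S \<and> qp_circuit n H C)"

definition MQ_dep :: "'d::finite set set \<Rightarrow> 'd set set set \<Rightarrow> 'd set \<Rightarrow> bool" where
  "MQ_dep M Q = qp_dep (mrank M) ((\<lambda>B. \<Union>B) ` Q)"

section \<open>M^L: the n-paving matroid on the union of L with dependent hyperplanes L\<close>

definition upper_paving_circuit :: "nat \<Rightarrow> 'd set set \<Rightarrow> 'd set \<Rightarrow> bool" where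
  "upper_paving_circuit n L C \<longleftrightarrow>
     (card C = n \<and> (\<exists>l\<in>L. C \<subseteq> l)) \<or>
     (card C = n + 1 \<and> C \<subseteq> \<Union>L \<and> \<not> (\<exists>T l. l \<in> L \<and> T \<subseteq> C \<and> T \<subseteq> l \<and> card T = n))"

definition upper_paving_dep :: "nat \<Rightarrow> 'd set set \<Rightarrow> 'd set \<Rightarrow> bool" where
  "upper_paving_dep n L S \<longleftrightarrow> (\<exists>C. C \<subseteq> S \<and> upper_paving_circuit n L C)"

definition liftable :: "'n::finite itself \<Rightarrow> 'd set \<Rightarrow> ('d set \<Rightarrow> bool) \<Rightarrow> bool" where
  "liftable _ E Dep \<longleftrightarrow>
    (\<forall>(\<gamma> :: 'd \<Rightarrow> 'n \<Rightarrow> complex) H q.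
       lin_hyperplane H \<longrightarrow> fam_span E \<gamma> = H \<longrightarrow> q \<notin> H \<longrightarrow>
       (\<exists>z. (\<forall>S. S \<subseteq> E \<longrightarrow> Dep S \<longrightarrow> lin_dep_fam (\<lambda>e j. \<gamma> e j + z e * q j) S) \<and>
            \<not> (\<exists>H'. lin_hyperplane H' \<and> (\<forall>e\<in>E. (\<lambda>j. \<gamma> e j + z e * q j) \<in> H'))))"

definition nice_partition :: "'n::finite itself \<Rightarrow> 'd::finite set set \<Rightarrow> 'd set set set \<Rightarrow> bool" where
  "nice_partition nt M Q \<longleftrightarrow>
     partition_on (dep_hyperplanes M) Q \<and>
     (\<forall>B\<in>Q. card B \<ge> 2 \<longrightarrow> \<not> liftable nt (\<Union>B) (upper_paving_dep (mrank M) B)) \<and>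
     \<not> (\<exists>B\<in>Q. \<exists>l. dep_hyperplane M l \<and> l \<notin> B \<and> l \<subseteq> \<Union>B)"

end

theory Submission
  imports Defs "HOL-Analysis.Analysis" "HOL-Computational_Algebra.Polynomial"
begin

text \<open>Let \<open>X Q\<close> be the set of families admitting a hyperplane through the points of each block of
  \<open>Q\<close>, with distinct hyperplanes for distinct blocks. Since every point lies on at most two
  dependent hyperplanes, \<open>X Q\<close> is connected by polynomial curves, hence irreducible. Choosing a
  hyperplane through each dependent hyperplane of \<open>M\<close> and grouping equal ones shows that
  the circuit variety is the union of all \<open>X Q\<close>. If a block contains a foreign line, that line
  can be moved into the block; if a block is liftable, a lifting scaled to zero splits it. So only
  nice \<open>Q\<close> matter, and for these the realizations are dense in \<open>X Q\<close>.

  If the closure of \<open>X Q1\<close> lies in that of \<open>X Q2\<close>, then \<open>Q2\<close> refines \<open>Q1\<close>. If the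
  refinement is strict in some block \<open>B\<close>, then on \<open>X Q2\<close> there are functionals, one for each
  line of \<open>B\<close>, that agree at the common points of the lines without all being equal. This is a
  closed condition, so it holds on \<open>X Q1\<close>. It only involves points on two lines of \<open>B\<close>, which
  are unconstrained by the other blocks, and so it makes \<open>B\<close> liftable.\<close>

section \<open>Linear algebra\<close>

text \<open>A point on at most two lines satisfies at most two linear conditions, and in
  \<open>X Q\<close> these are either equal or independent. Their rank therefore does not jump, and
  the point can follow the moving hyperplanes; with three hyperplanes one could become dependent on
  the other two.

  No dimension is computed. Irreducibility replaces it: finitely many closed degeneracies, each
  avoided somewhere in \<open>X Q\<close>, are avoided simultaneously, and of finitely many closed
  sets covering \<open>X Q\<close> one contains it.

  Liftability quantifies over all families in a hyperplane and is thus no condition on a single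
  point of the variety. It is replaced by \<open>rigid\<close>, a property of one family: a
  homogeneous linear system with coefficients polynomial in the family has only the zero solution.
  Being rigid is an open condition, so a single rigid family separates two varieties. The obstacle
  is to extract one from non-liftability, whose witness may be degenerate; this is done by
  perturbation and compactness.\<close>

definition dotp :: "('n::finite \<Rightarrow> complex) \<Rightarrow> ('n \<Rightarrow> complex) \<Rightarrow> complex" where
  "dotp a x = (\<Sum>j\<in>UNIV. a j * x j)"

text \<open>Proportionality through 2 by 2 minors: its negation is linear independence, and along a
  polynomial curve it is a polynomial condition. The zero vector is proportional to everything, so
  transitivity needs a nonzero middle term.\<close>

definition par :: "('n \<Rightarrow> complex) \<Rightarrow> ('n \<Rightarrow> complex) \<Rightarrow> bool" where
  "par a b \<longleftrightarrow> (\<forall>i j. a i * b j = a j * b i)"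

lemma dotp_linear [simp]:
  "dotp a (\<lambda>j. 0) = 0" "dotp (\<lambda>j. 0) a = 0"
  "dotp a (\<lambda>j. x j + y j) = dotp a x + dotp a y"
  "dotp a (\<lambda>j. x j - y j) = dotp a x - dotp a y"
  "dotp a (\<lambda>j. c * x j) = c * dotp a x"
  "dotp (\<lambda>j. x j + y j) a = dotp x a + dotp y a"
  "dotp (\<lambda>j. x j - y j) a = dotp x a - dotp y a"
  "dotp (\<lambda>j. c * x j) a = c * dotp x a"
  "dotp a (\<lambda>j. x j * c) = dotp a x * c"
  "dotp (\<lambda>j. x j * c) a = dotp x a * c"
  "dotp a (\<lambda>j. x j / c) = dotp a x / c"
  "dotp (\<lambda>j. x j / c) a = dotp x a / c"
  by (simp_all add: dotp_def algebra_simps sum.distrib sum_subtractf sum_distrib_left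
      sum_divide_distrib)

lemma dotp_sum [simp]: "dotp a (\<lambda>j. \<Sum>s\<in>S. f s j) = (\<Sum>s\<in>S. dotp a (f s))"
  unfolding dotp_def by (simp add: sum_distrib_left) (rule sum.swap)

lemma dotp_sum_left [simp]: "dotp (\<lambda>j. \<Sum>s\<in>S. f s j) a = (\<Sum>s\<in>S. dotp (f s) a)"
  unfolding dotp_def by (simp add: sum_distrib_right) (rule sum.swap)

lemma dotp_unit [simp]: "dotp a (\<lambda>j. if j = k then 1 else 0) = a k"
  "dotp (\<lambda>j. if j = k then 1 else 0) a = a k"
  by (simp_all add: dotp_def if_distrib if_distribR cong: if_cong)

lemma par_refl [simp]: "par a a"
  by (simp add: par_def)

lemma par_sym: "par a b \<Longrightarrow> par b a"
  unfolding par_def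
  by (subst (1 2) mult.commute) (rule allI, rule allI, drule spec, drule spec, assumption)

lemma par_scale:
  assumes "par a b" "a \<noteq> (\<lambda>_. 0)"
  obtains c where "b = (\<lambda>j. c * a j)"
proof -
  obtain i where i: "a i \<noteq> 0" using assms(2) by auto
  have "b j = (b i / a i) * a j" for j
  proof -
    have "a i * b j = a j * b i" using assms(1) by (simp add: par_def)
    then have "b j = a j * b i / a i" using i by (metis nonzero_mult_div_cancel_left)
    then show ?thesis by (simp add: mult.commute)
  qed
  then show thesis by (intro that[of "b i / a i"] ext)
qed

lemma par_dotp:
  assumes "par a b" "a \<noteq> (\<lambda>_. 0)" "dotp a x = 0"
  shows "dotp b x = 0"
proof -
  obtain c where c: "b = (\<lambda>j. c * a j)" using par_scale[OF assms(1,2)] .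
  show ?thesis unfolding c using assms(3) by simp
qed

lemma par_trans:
  assumes "par a b" "par b c" "b \<noteq> (\<lambda>_. 0)"
  shows "par a c"
proof -
  obtain x where x: "a = (\<lambda>j. x * b j)" using par_scale[OF par_sym[OF assms(1)] assms(3)] .
  obtain y where y: "c = (\<lambda>j. y * b j)" using par_scale[OF assms(2,3)] .
  show ?thesis by (simp add: x y par_def)
qed

text \<open>Fixing the value at \<open>q\<close> removes the scalar ambiguity of a normal; distinct
  normalised functionals then have distinct kernels.\<close>

lemma par_eq_of_dotp:
  assumes "par a b" "dotp a q = 1" "dotp b q = 1"
  shows "a = b"
proof -
  have "a \<noteq> (\<lambda>_. 0)" using assms(2) by auto
  then obtain c where "b = (\<lambda>j. c * a j)" using par_scale[OF assms(1)] by metis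
  with assms(2,3) show ?thesis by auto
qed

lemma not_par_dual:
  assumes "\<not> par a b"
  obtains v where "dotp a v = 0" "dotp b v = 1"
proof -
  obtain i j where ij: "a i * b j \<noteq> a j * b i" using assms by (auto simp: par_def)
  define D where "D = a i * b j - a j * b i"
  have D: "D \<noteq> 0" using ij by (simp add: D_def)
  \<comment> \<open>Cramer's rule on the two coordinates of the nonvanishing minor
    \<open>D\<close>.\<close>
  define v where "v = (\<lambda>k. (a i / D) * (if k = j then 1 else 0) - (a j / D) * (if k = i then 1 else 0))"
  have "dotp a v = 0" unfolding v_def dotp_linear dotp_unit by simp
  moreover have "dotp b v = 1" unfolding v_def dotp_linear dotp_unit
    using D by (simp add: field_simps) (simp add: D_def algebra_simps)
  ultimately show thesis by (rule that)
qed

lemma nonzero_dual: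
  assumes "a \<noteq> (\<lambda>_. 0)"
  obtains u where "dotp a u = 1"
proof -
  obtain i where i: "a i \<noteq> 0" using assms by auto
  show thesis
    by (rule that[of "\<lambda>k. (1 / a i) * (if k = i then 1 else 0)"], unfold dotp_linear dotp_unit)
      (use i in simp)
qed

text \<open>The minors of two members of the pencil are those of \<open>a\<close> and
  \<open>b\<close> times \<open>t - s\<close>. Such a pencil later supplies a different hyperplane
  for every block.\<close>

lemma not_par_add_scaled:
  assumes "\<not> par a b" "s \<noteq> t"
  shows "\<not> par (\<lambda>j. a j + s * b j) (\<lambda>j. a j + t * b j)"
proof -
  obtain i j where ij: "a i * b j \<noteq> a j * b i" using assms(1) by (auto simp: par_def)
  have "(a i + s * b i) * (a j + t * b j) - (a j + s * b j) * (a i + t * b i)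
    = (t - s) * (a i * b j - a j * b i)"
    by (simp add: algebra_simps)
  moreover have "\<dots> \<noteq> 0" using ij assms(2) by auto
  ultimately have "(a i + s * b i) * (a j + t * b j) \<noteq> (a j + s * b j) * (a i + t * b i)" by auto
  then show ?thesis by (auto simp: par_def)
qed

lemma homogeneous_solution:
  fixes A :: "'r \<Rightarrow> 'c \<Rightarrow> complex"
  assumes "finite R" "finite C" "card R < card C"
  shows "\<exists>c. (\<exists>i\<in>C. c i \<noteq> 0) \<and> (\<forall>r\<in>R. (\<Sum>i\<in>C. c i * A r i) = 0)"
  using assms
proof (induction R arbitrary: A C rule: finite_induct)
  case empty
  then obtain i where "i \<in> C" by fastforce
  then show ?case by (intro exI[of _ "\<lambda>_. 1"]) auto
next
  case (insert r R)
  show ?case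
  proof (cases "\<forall>i\<in>C. A r i = 0")
    case True
    then show ?thesis using insert.IH[of C A] insert.prems insert.hyps by auto
  next
    case False
    then obtain k where k: "k \<in> C" "A r k \<noteq> 0" by auto
    have "card R < card (C - {k})" using insert k by simp
    then obtain c where c: "\<exists>i\<in>C - {k}. c i \<noteq> 0"
      "\<forall>s\<in>R. (\<Sum>i\<in>C - {k}. c i * (A s i - A s k * A r i / A r k)) = 0"
      using insert.IH[of "C - {k}" "\<lambda>s i. A s i - A s k * A r i / A r k"] insert.prems by auto
    \<comment> \<open>Back substitution: this value solves row \<open>r\<close>, and the reduced
      rows then yield the others.\<close>
    define c' where "c' = c(k := - (\<Sum>i\<in>C - {k}. c i * A r i) / A r k)"
    have split: "(\<Sum>i\<in>C. c' i * A s i) = c' k * A s k + (\<Sum>i\<in>C - {k}. c i * A s i)" for s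
      using insert.prems(1) k(1) by (simp add: sum.remove c'_def)
    have "(\<Sum>i\<in>C. c' i * A r i) = 0" unfolding split using k(2) by (simp add: c'_def)
    moreover have "(\<Sum>i\<in>C. c' i * A s i) = 0" if "s \<in> R" for s
    proof -
      have "0 = (\<Sum>i\<in>C - {k}. c i * A s i) - (\<Sum>i\<in>C - {k}. c i * A r i) * A s k / A r k"
        using c(2) that
        by (simp add: sum_subtractf sum_distrib_left sum_distrib_right sum_divide_distrib algebra_simps)
      then show ?thesis unfolding split by (simp add: c'_def)
    qed
    moreover have "\<exists>i\<in>C. c' i \<noteq> 0" using c(1) by (auto simp: c'_def)
    ultimately show ?thesis by blast
  qed
qed

lemma span_or_separated:
  fixes x :: "'n::finite \<Rightarrow> complex"
  assumes "finite T"
  shows "(\<exists>c. x = (\<lambda>j. \<Sum>t\<in>T. c t * \<gamma> t j)) \<or> (\<exists>f. (\<forall>t\<in>T. dotp f (\<gamma> t) = 0) \<and> dotp f x \<noteq> 0)"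
  using assms
proof (induction T arbitrary: x rule: finite_induct)
  case empty
  show ?case
  proof (cases "x = (\<lambda>_. 0)")
    case False
    then obtain i where "x i \<noteq> 0" by auto
    then have "dotp (\<lambda>j. if j = i then 1 else 0) x \<noteq> 0" by simp
    then show ?thesis by blast
  qed simp
next
  case (insert s T)
  have ext: "(\<Sum>t\<in>insert s T. (c(s := d)) t * \<gamma> t j) = d * \<gamma> s j + (\<Sum>t\<in>T. c t * \<gamma> t j)" for c d j
  proof -
    have "(\<Sum>t\<in>T. (c(s := d)) t * \<gamma> t j) = (\<Sum>t\<in>T. c t * \<gamma> t j)"
      using insert.hyps by (intro sum.cong) auto
    then show ?thesis using insert.hyps by simp
  qed
  show ?case
  proof (cases "\<exists>c. x = (\<lambda>j. \<Sum>t\<in>T. c t * \<gamma> t j)")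
    case True
    then obtain c where "x = (\<lambda>j. \<Sum>t\<in>T. c t * \<gamma> t j)" by auto
    then have "x = (\<lambda>j. \<Sum>t\<in>insert s T. (c(s := 0)) t * \<gamma> t j)" unfolding ext by simp
    then show ?thesis by blast
  next
    case False
    then obtain f where f: "\<forall>t\<in>T. dotp f (\<gamma> t) = 0" "dotp f x \<noteq> 0" using insert.IH by blast
    show ?thesis
    proof (cases "dotp f (\<gamma> s) = 0")
      case True
      with f show ?thesis by auto
    next
      case fs: False
      define d where "d = dotp f x / dotp f (\<gamma> s)"
      from insert.IH[of "\<lambda>j. x j - d * \<gamma> s j"] show ?thesis
      proof (elim disjE exE conjE)
        fix c assume "(\<lambda>j. x j - d * \<gamma> s j) = (\<lambda>j. \<Sum>t\<in>T. c t * \<gamma> t j)"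
        then have "x j - d * \<gamma> s j = (\<Sum>t\<in>T. c t * \<gamma> t j)" for j by metis
        then have "x = (\<lambda>j. \<Sum>t\<in>insert s T. (c(s := d)) t * \<gamma> t j)"
          unfolding ext by (auto simp: algebra_simps)
        then show ?thesis by blast
      next
        fix g assume g: "\<forall>t\<in>T. dotp g (\<gamma> t) = 0" "dotp g (\<lambda>j. x j - d * \<gamma> s j) \<noteq> 0"
        \<comment> \<open>The correction by \<open>f\<close> annihilates \<open>\<gamma> s\<close>
          and, by the choice of \<open>d\<close>, leaves at \<open>x\<close> the value of
          \<open>g\<close> at the shifted vector.\<close>
        let ?h = "\<lambda>j. g j - (dotp g (\<gamma> s) / dotp f (\<gamma> s)) * f j"
        have "\<forall>t\<in>insert s T. dotp ?h (\<gamma> t) = 0" using f g fs by simp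
        moreover have "dotp ?h x \<noteq> 0" using g(2) by (simp add: d_def mult.commute)
        ultimately show ?thesis by blast
      qed
    qed
  qed
qed

section \<open>Dependent families and hyperplanes through them\<close>

lemma lin_dep_famI:
  "\<lbrakk>i \<in> S; c i \<noteq> 0; \<And>j. (\<Sum>i\<in>S. c i * \<gamma> i j) = 0\<rbrakk> \<Longrightarrow> lin_dep_fam \<gamma> S"
  by (auto simp: lin_dep_fam_def)

lemma lin_dep_fam_mono:
  fixes \<gamma> :: "'d::finite \<Rightarrow> 'n::finite \<Rightarrow> complex"
  assumes "lin_dep_fam \<gamma> S" "S \<subseteq> T"
  shows "lin_dep_fam \<gamma> T"
proof -
  obtain c i where c: "i \<in> S" "c i \<noteq> 0" "\<And>j. (\<Sum>i\<in>S. c i * \<gamma> i j) = 0"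
    using assms(1) by (auto simp: lin_dep_fam_def)
  have "(\<Sum>i\<in>T. (if i \<in> S then c i else 0) * \<gamma> i j) = (\<Sum>i\<in>S. c i * \<gamma> i j)" for j
    by (rule sum.mono_neutral_cong_right) (use assms(2) in auto)
  with c assms(2) show ?thesis
    by (intro lin_dep_famI[of i T "\<lambda>i. if i \<in> S then c i else 0"]) auto
qed

lemma independent_dual:
  fixes \<gamma> :: "'d::finite \<Rightarrow> 'n::finite \<Rightarrow> complex"
  assumes "\<not> lin_dep_fam \<gamma> S" "s \<in> S"
  obtains f where "\<forall>t\<in>S - {s}. dotp f (\<gamma> t) = 0" "dotp f (\<gamma> s) \<noteq> 0"
proof -
  have False if "\<gamma> s = (\<lambda>j. \<Sum>t\<in>S - {s}. c t * \<gamma> t j)" for c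
  proof -
    have "(\<Sum>t\<in>S. (c(s := -1)) t * \<gamma> t j) = - \<gamma> s j + (\<Sum>t\<in>S - {s}. c t * \<gamma> t j)" for j
      using assms(2) by (simp add: sum.remove)
    then have "(\<Sum>t\<in>S. (c(s := -1)) t * \<gamma> t j) = 0" for j using fun_cong[OF that, of j] by simp
    then show False using assms lin_dep_famI[of s S "c(s := -1)" \<gamma>] by simp
  qed
  then show thesis using that span_or_separated[of "S - {s}" "\<gamma> s" \<gamma>] by fastforce
qed

lemma independent_interpolation:
  fixes \<gamma> :: "'d::finite \<Rightarrow> 'n::finite \<Rightarrow> complex"
  assumes "\<not> lin_dep_fam \<gamma> S"
  obtains g where "\<forall>s\<in>S. dotp g (\<gamma> s) = z s"
proof -
  have "\<exists>f. (\<forall>t\<in>S - {s}. dotp f (\<gamma> t) = 0) \<and> dotp f (\<gamma> s) \<noteq> 0" if "s \<in> S" for s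
    using independent_dual[OF assms that] by blast
  then obtain f where f: "\<And>s t. s \<in> S \<Longrightarrow> t \<in> S \<Longrightarrow> t \<noteq> s \<Longrightarrow> dotp (f s) (\<gamma> t) = 0"
      "\<And>s. s \<in> S \<Longrightarrow> dotp (f s) (\<gamma> s) \<noteq> 0"
    by (metis Diff_iff singletonD)
  define g where "g = (\<lambda>j. \<Sum>s\<in>S. (z s / dotp (f s) (\<gamma> s)) * f s j)"
  have "dotp g (\<gamma> t) = z t" if "t \<in> S" for t
  proof -
    have "dotp g (\<gamma> t) = (\<Sum>s\<in>S. (z s / dotp (f s) (\<gamma> s)) * dotp (f s) (\<gamma> t))"
      by (simp add: g_def)
    also have "\<dots> = (\<Sum>s\<in>S. if s = t then z t else 0)"
      by (rule sum.cong) (use f that in auto)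
    finally show ?thesis using that by simp
  qed
  then show thesis using that by blast
qed

lemma lin_dep_fam_large:
  fixes \<gamma> :: "'d::finite \<Rightarrow> 'n::finite \<Rightarrow> complex"
  assumes "card S > CARD('n)"
  shows "lin_dep_fam \<gamma> S"
  using homogeneous_solution[of "UNIV :: 'n set" S "\<lambda>j s. \<gamma> s j"] assms
  by (auto simp: lin_dep_fam_def)

text \<open>Omitting a coordinate where \<open>a\<close> is nonzero leaves fewer equations than
  unknowns. The relation found this way also holds in the omitted coordinate, because
  \<open>a\<close> annihilates the combination.\<close>

lemma lin_dep_fam_in_hyperplane:
  fixes \<gamma> :: "'d::finite \<Rightarrow> 'n::finite \<Rightarrow> complex"
  assumes "a \<noteq> (\<lambda>_. 0)" "\<And>s. s \<in> S \<Longrightarrow> dotp a (\<gamma> s) = 0" "card S \<ge> CARD('n)"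
  shows "lin_dep_fam \<gamma> S"
proof -
  obtain k where k: "a k \<noteq> 0" using assms(1) by auto
  have "card (UNIV - {k}) < card S"
    using assms(3) zero_less_card_finite[where 'a='n]
    by (simp add: card_Diff_singleton del: zero_less_card_finite)
  then obtain c i where c: "i \<in> S" "c i \<noteq> 0" "\<And>j. j \<noteq> k \<Longrightarrow> (\<Sum>s\<in>S. c s * \<gamma> s j) = 0"
    using homogeneous_solution[of "UNIV - {k}" S "\<lambda>j s. \<gamma> s j"] by auto
  define x where "x = (\<lambda>j. \<Sum>s\<in>S. c s * \<gamma> s j)"
  have "dotp a x = 0" using assms(2) by (simp add: x_def)
  moreover have "dotp a x = a k * x k"
  proof -
    have "dotp a x = (\<Sum>j\<in>{k}. a j * x j)"
      unfolding dotp_def by (rule sum.mono_neutral_right) (use c in \<open>auto simp: x_def\<close>)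
    then show ?thesis by simp
  qed
  ultimately have "x k = 0" using k by simp
  then have "\<And>j. (\<Sum>s\<in>S. c s * \<gamma> s j) = 0" using c(3) by (metis x_def)
  with c show ?thesis by (intro lin_dep_famI)
qed

text \<open>Now the two coordinates of a nonzero minor of \<open>a\<close> and \<open>b\<close> are
  omitted, and the two functionals together recover both entries.\<close>

lemma lin_dep_fam_in_two_hyperplanes:
  fixes \<gamma> :: "'d::finite \<Rightarrow> 'n::finite \<Rightarrow> complex"
  assumes "\<not> par a b" "\<And>s. s \<in> S \<Longrightarrow> dotp a (\<gamma> s) = 0" "\<And>s. s \<in> S \<Longrightarrow> dotp b (\<gamma> s) = 0"
    "card S \<ge> CARD('n) - 1"
  shows "lin_dep_fam \<gamma> S"
proof -
  obtain k m where km: "a k * b m \<noteq> a m * b k" using assms(1) by (auto simp: par_def)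
  then have neq: "k \<noteq> m" by auto
  have "card {k, m} \<le> CARD('n)" by (rule card_mono) auto
  then have "card (UNIV - {k, m}) < card S"
    using assms(4) neq by (simp add: card_Diff_subset)
  then obtain c i where c: "i \<in> S" "c i \<noteq> 0" "\<And>j. j \<noteq> k \<Longrightarrow> j \<noteq> m \<Longrightarrow> (\<Sum>s\<in>S. c s * \<gamma> s j) = 0"
    using homogeneous_solution[of "UNIV - {k, m}" S "\<lambda>j s. \<gamma> s j"] by auto
  define x where "x = (\<lambda>j. \<Sum>s\<in>S. c s * \<gamma> s j)"
  have two: "dotp a' x = a' k * x k + a' m * x m" for a'
  proof -
    have "dotp a' x = (\<Sum>j\<in>{k, m}. a' j * x j)"
      unfolding dotp_def by (rule sum.mono_neutral_right) (use c in \<open>auto simp: x_def\<close>)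
    then show ?thesis using neq by simp
  qed
  have "dotp a x = 0" "dotp b x = 0" using assms(2,3) by (simp_all add: x_def)
  then have e: "a k * x k + a m * x m = 0" "b k * x k + b m * x m = 0" by (simp_all add: two)
  have "(a k * b m - a m * b k) * x k = b m * (a k * x k + a m * x m) - a m * (b k * x k + b m * x m)"
    by (simp add: algebra_simps)
  then have "x k = 0" using e km by simp
  have "(a k * b m - a m * b k) * x m = a k * (b k * x k + b m * x m) - b k * (a k * x k + a m * x m)"
    by (simp add: algebra_simps)
  then have "x m = 0" using e km by simp
  with \<open>x k = 0\<close> have "\<And>j. (\<Sum>s\<in>S. c s * \<gamma> s j) = 0" using c(3) by (metis x_def)
  with c show ?thesis by (intro lin_dep_famI)
qed

text \<open>Used to identify the hyperplane of a line at a generic point, once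
  \<open>CARD('n) - 1\<close> independent vectors have been found on that line.\<close>

lemma normal_unique:
  fixes \<gamma> :: "'d::finite \<Rightarrow> 'n::finite \<Rightarrow> complex"
  assumes "\<not> lin_dep_fam \<gamma> S" "card S = CARD('n) - 1"
    "\<And>s. s \<in> S \<Longrightarrow> dotp a (\<gamma> s) = 0" "\<And>s. s \<in> S \<Longrightarrow> dotp b (\<gamma> s) = 0"
  shows "par a b"
  using lin_dep_fam_in_two_hyperplanes[of a b S \<gamma>] assms by fastforce

lemma normal_nonzero_if_few:
  fixes \<gamma> :: "'d::finite \<Rightarrow> 'n::finite \<Rightarrow> complex"
  assumes "card S < CARD('n)"
  obtains a where "a \<noteq> (\<lambda>_. 0)" "\<And>s. s \<in> S \<Longrightarrow> dotp a (\<gamma> s) = 0"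
proof -
  obtain c i where "c i \<noteq> 0" "\<forall>r\<in>S. (\<Sum>i\<in>UNIV. c i * \<gamma> r i) = 0"
    using homogeneous_solution[of S "UNIV :: 'n set" \<gamma>] assms by auto
  then show thesis using that[of c] by (auto simp: dotp_def)
qed

text \<open>The last clause expresses through functionals that \<open>S\<close> spans the family; in
  this form it applies directly to normals.\<close>

lemma maximal_independent:
  fixes \<gamma> :: "'d::finite \<Rightarrow> 'n::finite \<Rightarrow> complex"
  obtains S where "S \<subseteq> E" "\<not> lin_dep_fam \<gamma> S"
    "\<And>b e. (\<And>s. s \<in> S \<Longrightarrow> dotp b (\<gamma> s) = 0) \<Longrightarrow> e \<in> E \<Longrightarrow> dotp b (\<gamma> e) = 0"
proof -
  let ?F = "{S. S \<subseteq> E \<and> \<not> lin_dep_fam \<gamma> S}"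
  have "{} \<in> ?F" by (simp add: lin_dep_fam_def)
  then obtain S where S: "S \<in> ?F" "\<And>T. T \<in> ?F \<Longrightarrow> S \<subseteq> T \<Longrightarrow> T = S"
    using finite_has_maximal[of ?F] by (metis (no_types, lifting) empty_iff finite_code)
  have "dotp b (\<gamma> e) = 0" if b: "\<And>s. s \<in> S \<Longrightarrow> dotp b (\<gamma> s) = 0" and e: "e \<in> E" for b e
  proof (cases "e \<in> S")
    case False
    then have "lin_dep_fam \<gamma> (insert e S)" using S(1) S(2)[of "insert e S"] e by auto
    then obtain c where c: "\<exists>i\<in>insert e S. c i \<noteq> 0" "\<And>j. (\<Sum>i\<in>insert e S. c i * \<gamma> i j) = 0"
      by (auto simp: lin_dep_fam_def)
    have eq: "c e * \<gamma> e j + (\<Sum>i\<in>S. c i * \<gamma> i j) = 0" for j using c(2)[of j] False by simp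
    have "c e \<noteq> 0"
    proof
      assume "c e = 0"
      then have "lin_dep_fam \<gamma> S" using c(1) eq by (auto simp: lin_dep_fam_def)
      then show False using S(1) by simp
    qed
    have "0 = dotp b (\<lambda>j. c e * \<gamma> e j + (\<Sum>i\<in>S. c i * \<gamma> i j))" unfolding eq by simp
    also have "\<dots> = c e * dotp b (\<gamma> e)" using b by simp
    finally show ?thesis using \<open>c e \<noteq> 0\<close> by simp
  qed (use b in simp)
  with S(1) that show thesis by blast
qed

text \<open>Turns a Zariski closed condition into a hyperplane: a maximal independent subfamily has
  fewer than \<open>CARD('n)\<close> members and hence a common nonzero normal.\<close>

lemma subsets_dependent_imp_normal:
  fixes \<gamma> :: "'d::finite \<Rightarrow> 'n::finite \<Rightarrow> complex"
  assumes "\<And>S. S \<subseteq> E \<Longrightarrow> card S = CARD('n) \<Longrightarrow> lin_dep_fam \<gamma> S"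
  obtains a where "a \<noteq> (\<lambda>_. 0)" "\<And>e. e \<in> E \<Longrightarrow> dotp a (\<gamma> e) = 0"
proof -
  obtain S where S: "S \<subseteq> E" "\<not> lin_dep_fam \<gamma> S"
    "\<And>b e. (\<And>s. s \<in> S \<Longrightarrow> dotp b (\<gamma> s) = 0) \<Longrightarrow> e \<in> E \<Longrightarrow> dotp b (\<gamma> e) = 0"
    using maximal_independent[of E \<gamma>] by blast
  have "card S < CARD('n)"
  proof (rule ccontr)
    assume "\<not> ?thesis"
    then obtain T where "T \<subseteq> S" "card T = CARD('n)" by (meson not_less obtain_subset_with_card_n)
    then show False using assms[of T] S(1,2) lin_dep_fam_mono by blast
  qed
  then show thesis using normal_nonzero_if_few[of S \<gamma>] S(3) that by metis
qed

section \<open>The Zariski topology\<close>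

lemma polyfun_diff: "p \<in> polyfun \<Longrightarrow> q \<in> polyfun \<Longrightarrow> (\<lambda>\<gamma>. p \<gamma> - q \<gamma>) \<in> polyfun"
  using pf_add[of p "\<lambda>\<gamma>. (-1) * q \<gamma>"] pf_mult[OF pf_const[of "-1"], of q] by simp

lemma zariski_closedI:
  assumes "\<And>x. x \<notin> X \<Longrightarrow> \<exists>p\<in>polyfun. p x \<noteq> 0 \<and> (\<forall>y\<in>X. p y = 0)"
  shows "zariski_closed X"
  unfolding zariski_closed_def
  by (rule exI[of _ "{p\<in>polyfun. \<forall>y\<in>X. p y = 0}"]) (use assms in fastforce)

lemma zariski_closedD:
  assumes "zariski_closed X" "x \<notin> X"
  obtains p where "p \<in> polyfun" "p x \<noteq> 0" "\<And>y. y \<in> X \<Longrightarrow> p y = 0"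
  using assms unfolding zariski_closed_def by blast

lemma zariski_closed_Un:
  assumes "zariski_closed A" "zariski_closed B"
  shows "zariski_closed (A \<union> B)"
proof (rule zariski_closedI)
  fix x assume x: "x \<notin> A \<union> B"
  obtain p where "p \<in> polyfun" "p x \<noteq> 0" "\<And>y. y \<in> A \<Longrightarrow> p y = 0"
    using zariski_closedD[OF assms(1)] x by blast
  moreover obtain q where "q \<in> polyfun" "q x \<noteq> 0" "\<And>y. y \<in> B \<Longrightarrow> q y = 0"
    using zariski_closedD[OF assms(2)] x by blast
  ultimately show "\<exists>p\<in>polyfun. p x \<noteq> 0 \<and> (\<forall>y\<in>A \<union> B. p y = 0)"
    by (intro bexI[of _ "\<lambda>x. p x * q x"]) (auto intro: pf_mult)
qed

lemma zariski_closed_empty: "zariski_closed {}"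
  by (rule zariski_closedI) (auto intro!: bexI[of _ "\<lambda>_. 1"] pf_const)

lemma zariski_closed_UN:
  "finite F \<Longrightarrow> (\<And>i. i \<in> F \<Longrightarrow> zariski_closed (A i)) \<Longrightarrow> zariski_closed (\<Union>i\<in>F. A i)"
  by (induction F rule: finite_induct) (auto intro: zariski_closed_Un zariski_closed_empty)

lemma zariski_closed_INT:
  assumes "\<And>i. i \<in> F \<Longrightarrow> zariski_closed (A i)"
  shows "zariski_closed (\<Inter>i\<in>F. A i)"
proof (rule zariski_closedI)
  fix x assume "x \<notin> (\<Inter>i\<in>F. A i)"
  then obtain i where i: "i \<in> F" "x \<notin> A i" by auto
  then obtain p where "p \<in> polyfun" "p x \<noteq> 0" "\<And>y. y \<in> A i \<Longrightarrow> p y = 0"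
    using zariski_closedD[OF assms] by blast
  with i show "\<exists>p\<in>polyfun. p x \<noteq> 0 \<and> (\<forall>y\<in>(\<Inter>i\<in>F. A i). p y = 0)" by blast
qed

lemma zariski_closure_closed: "zariski_closed (zariski_closure X)"
  using zariski_closed_INT[of "{Y. zariski_closed Y \<and> X \<subseteq> Y}" id]
  by (simp add: zariski_closure_def)

lemma zariski_closure_subset: "X \<subseteq> zariski_closure X"
  by (auto simp: zariski_closure_def)

lemma zariski_closure_minimal: "X \<subseteq> Y \<Longrightarrow> zariski_closed Y \<Longrightarrow> zariski_closure X \<subseteq> Y"
  by (auto simp: zariski_closure_def)

lemma zariski_irreducible_closure:
  assumes "zariski_irreducible X"
  shows "zariski_irreducible (zariski_closure X)"
  using assms zariski_closure_subset[of X] zariski_closure_minimal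
  unfolding zariski_irreducible_def by (metis subset_empty subset_trans)

lemma zariski_irreducible_UN:
  assumes "zariski_irreducible X" "finite F" "\<And>i. i \<in> F \<Longrightarrow> zariski_closed (A i)"
    "X \<subseteq> (\<Union>i\<in>F. A i)"
  shows "\<exists>i\<in>F. X \<subseteq> A i"
  using assms(2,3,4)
proof (induction F rule: finite_induct)
  case empty
  then show ?case using assms(1) by (auto simp: zariski_irreducible_def)
next
  case (insert i F)
  have "zariski_closed (A i)" "zariski_closed (\<Union>i\<in>F. A i)" "X \<subseteq> A i \<union> (\<Union>i\<in>F. A i)"
    using insert by (auto intro: zariski_closed_UN)
  then have "X \<subseteq> A i \<or> X \<subseteq> (\<Union>i\<in>F. A i)" using assms(1) unfolding zariski_irreducible_def by blast
  then show ?case using insert by auto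
qed

text \<open>The genericity principle of the whole proof: \<open>Z\<close> only has to contain the
  points that avoid finitely many proper closed conditions. Applied with \<open>Z\<close> empty, by
  contradiction, it produces a point avoiding all of them.\<close>

lemma irreducible_dense:
  assumes "zariski_irreducible X" "zariski_closed Z" "finite F" "\<And>i. i \<in> F \<Longrightarrow> zariski_closed (A i)"
    "\<And>i. i \<in> F \<Longrightarrow> \<not> X \<subseteq> A i" "\<And>x. x \<in> X \<Longrightarrow> (\<And>i. i \<in> F \<Longrightarrow> x \<notin> A i) \<Longrightarrow> x \<in> Z"
  shows "X \<subseteq> Z"
proof -
  have "zariski_closed (\<Union>i\<in>F. A i)" using assms(3,4) by (rule zariski_closed_UN)
  moreover have "X \<subseteq> Z \<union> (\<Union>i\<in>F. A i)"
  proof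
    fix x assume "x \<in> X"
    then show "x \<in> Z \<union> (\<Union>i\<in>F. A i)" using assms(6)[of x] by auto
  qed
  ultimately have "X \<subseteq> Z \<or> X \<subseteq> (\<Union>i\<in>F. A i)"
    using assms(1,2) by (simp add: zariski_irreducible_def)
  moreover have "\<not> X \<subseteq> (\<Union>i\<in>F. A i)"
  proof
    assume "X \<subseteq> (\<Union>i\<in>F. A i)"
    then have "\<exists>i\<in>F. X \<subseteq> A i"
      by (intro zariski_irreducible_UN[OF assms(1,3)] assms(4))
    then show False using assms(5) by fast
  qed
  ultimately show ?thesis by blast
qed

text \<open>Fraction-free elimination of one unknown: a row that does not vanish at the given
  point is used as pivot, and the pivot is multiplied into the witness polynomial.\<close>

lemma trivial_kernel_open:
  fixes R :: "('k \<Rightarrow> ('d \<Rightarrow> 'n \<Rightarrow> complex) \<Rightarrow> complex) set"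
  assumes "finite S" "\<And>\<rho> s. \<rho> \<in> R \<Longrightarrow> s \<in> S \<Longrightarrow> \<rho> s \<in> polyfun"
    "\<And>c. (\<forall>\<rho>\<in>R. (\<Sum>s\<in>S. c s * \<rho> s x) = 0) \<Longrightarrow> \<forall>s\<in>S. c s = 0"
  shows "\<exists>p\<in>polyfun. p x \<noteq> 0 \<and>
    (\<forall>y c. p y \<noteq> 0 \<longrightarrow> (\<forall>\<rho>\<in>R. (\<Sum>s\<in>S. c s * \<rho> s y) = 0) \<longrightarrow> (\<forall>s\<in>S. c s = 0))"
  using assms
proof (induction S arbitrary: R rule: finite_induct)
  case empty
  show ?case by (rule bexI[of _ "\<lambda>_. 1"]) (auto intro: pf_const)
next
  case (insert s S)
  have "\<exists>\<rho>\<in>R. \<rho> s x \<noteq> 0"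
  proof (rule ccontr)
    assume zero: "\<not> ?thesis"
    have "(\<Sum>r\<in>insert s S. (if r = s then 1 else 0) * \<rho> r x) = 0" if "\<rho> \<in> R" for \<rho>
    proof -
      have "(\<Sum>r\<in>S. (if r = s then 1 else 0) * \<rho> r x) = 0"
        using insert.hyps by (intro sum.neutral) auto
      then show ?thesis using that zero insert.hyps by simp
    qed
    then show False using insert.prems(2)[of "\<lambda>r. if r = s then 1 else 0"] by auto
  qed
  then obtain \<rho>0 where \<rho>0: "\<rho>0 \<in> R" "\<rho>0 s x \<noteq> 0" by blast
  let ?R = "(\<lambda>\<rho> r y. \<rho> r y * \<rho>0 s y - \<rho> s y * \<rho>0 r y) ` R"
  have elim: "(\<Sum>r\<in>S. c r * (\<rho> r y * \<rho>0 s y - \<rho> s y * \<rho>0 r y))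
      = \<rho>0 s y * (\<Sum>r\<in>S. c r * \<rho> r y) - \<rho> s y * (\<Sum>r\<in>S. c r * \<rho>0 r y)" for c \<rho> y
    by (simp add: sum_subtractf sum_distrib_left algebra_simps)
  have "\<exists>p\<in>polyfun. p x \<noteq> 0 \<and>
    (\<forall>y c. p y \<noteq> 0 \<longrightarrow> (\<forall>\<rho>\<in>?R. (\<Sum>s\<in>S. c s * \<rho> s y) = 0) \<longrightarrow> (\<forall>s\<in>S. c s = 0))"
  proof (rule insert.IH)
    fix \<rho> r assume "\<rho> \<in> ?R" "r \<in> S"
    then show "\<rho> r \<in> polyfun" using insert.prems(1) \<rho>0(1) by (auto intro!: polyfun_diff pf_mult)
  next
    fix c assume c: "\<forall>\<rho>\<in>?R. (\<Sum>s\<in>S. c s * \<rho> s x) = 0"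
    define d where "d = c(s := - (\<Sum>r\<in>S. c r * \<rho>0 r x) / \<rho>0 s x)"
    have split: "(\<Sum>r\<in>insert s S. d r * \<rho> r x) = d s * \<rho> s x + (\<Sum>r\<in>S. c r * \<rho> r x)" for \<rho>
    proof -
      have "(\<Sum>r\<in>S. d r * \<rho> r x) = (\<Sum>r\<in>S. c r * \<rho> r x)"
        using insert.hyps by (intro sum.cong) (auto simp: d_def)
      then show ?thesis using insert.hyps by simp
    qed
    have "(\<Sum>r\<in>insert s S. d r * \<rho> r x) = 0" if "\<rho> \<in> R" for \<rho>
    proof -
      have "\<rho>0 s x * (\<Sum>r\<in>S. c r * \<rho> r x) = \<rho> s x * (\<Sum>r\<in>S. c r * \<rho>0 r x)"
        using c that elim[where y=x] by simp
      then show ?thesis unfolding split using \<rho>0(2) by (simp add: d_def field_simps)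
    qed
    then have "\<forall>r\<in>insert s S. d r = 0" using insert.prems(2) by blast
    then show "\<forall>r\<in>S. c r = 0" using insert.hyps by (auto simp: d_def split: if_splits)
  qed
  then obtain p where p: "p \<in> polyfun" "p x \<noteq> 0"
    "\<And>y c. p y \<noteq> 0 \<Longrightarrow> (\<forall>\<rho>\<in>?R. (\<Sum>s\<in>S. c s * \<rho> s y) = 0) \<Longrightarrow> (\<forall>s\<in>S. c s = 0)" by blast
  have "\<forall>r\<in>insert s S. c r = 0"
    if y: "p y * \<rho>0 s y \<noteq> 0" and c: "\<forall>\<rho>\<in>R. (\<Sum>s\<in>insert s S. c s * \<rho> s y) = 0" for y c
  proof -
    have k: "(\<Sum>r\<in>S. c r * \<rho> r y) = - c s * \<rho> s y" if "\<rho> \<in> R" for \<rho>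
      using c that insert.hyps by (simp add: eq_neg_iff_add_eq_0 add.commute)
    have "\<forall>\<rho>\<in>?R. (\<Sum>s\<in>S. c s * \<rho> s y) = 0"
      using k \<rho>0(1) elim[where y=y and c=c] by (auto simp: algebra_simps)
    then have z: "\<forall>r\<in>S. c r = 0" using p(3) y by auto
    then have "c s * \<rho>0 s y = 0" using k[OF \<rho>0(1)] by simp
    with y z show ?thesis by simp
  qed
  moreover have "(\<lambda>y. p y * \<rho>0 s y) \<in> polyfun" using p(1) insert.prems(1) \<rho>0(1) by (auto intro: pf_mult)
  moreover have "p x * \<rho>0 s x \<noteq> 0" using p \<rho>0 by simp
  ultimately show ?case by (intro bexI[of _ "\<lambda>y. p y * \<rho>0 s y"]) auto
qed

text \<open>The quantifier over \<open>c\<close> does not spoil closedness because the system is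
  linear and homogeneous in \<open>c\<close>: the set is a locus where a rank drops.\<close>

lemma zariski_closed_nontrivial_kernel:
  assumes "finite S" "\<And>\<rho> s. \<rho> \<in> R \<Longrightarrow> s \<in> S \<Longrightarrow> \<rho> s \<in> polyfun"
  shows "zariski_closed {y. \<exists>c. (\<exists>s\<in>S. c s \<noteq> 0) \<and> (\<forall>\<rho>\<in>R. (\<Sum>s\<in>S. c s * \<rho> s y) = 0)}"
    (is "zariski_closed ?X")
proof (rule zariski_closedI)
  fix x assume "x \<notin> ?X"
  then have "\<exists>p\<in>polyfun. p x \<noteq> 0 \<and>
    (\<forall>y c. p y \<noteq> 0 \<longrightarrow> (\<forall>\<rho>\<in>R. (\<Sum>s\<in>S. c s * \<rho> s y) = 0) \<longrightarrow> (\<forall>s\<in>S. c s = 0))"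
    by (intro trivial_kernel_open) (use assms in blast)+
  then show "\<exists>p\<in>polyfun. p x \<noteq> 0 \<and> (\<forall>y\<in>?X. p y = 0)" by blast
qed

lemma zariski_closed_lin_dep:
  "zariski_closed {\<gamma> :: 'd::finite \<Rightarrow> 'n::finite \<Rightarrow> complex. lin_dep_fam \<gamma> S}"
proof -
  have "zariski_closed {\<gamma> :: 'd \<Rightarrow> 'n \<Rightarrow> complex. \<exists>c. (\<exists>s\<in>S. c s \<noteq> 0) \<and>
      (\<forall>\<rho>\<in>range (\<lambda>j s \<gamma>. \<gamma> s j). (\<Sum>s\<in>S. c s * \<rho> s \<gamma>) = 0)}"
    by (rule zariski_closed_nontrivial_kernel) (auto intro: pf_coord)
  then show ?thesis by (simp add: lin_dep_fam_def)
qed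

lemma zariski_closed_circuit_variety:
  "zariski_closed (circuit_variety D :: ('d::finite \<Rightarrow> 'n::finite \<Rightarrow> complex) set)"
proof -
  have "circuit_variety D = (\<Inter>S\<in>Collect D. {\<gamma> :: 'd \<Rightarrow> 'n \<Rightarrow> complex. lin_dep_fam \<gamma> S})"
    by (auto simp: circuit_variety_def)
  then show ?thesis by (metis zariski_closed_INT zariski_closed_lin_dep)
qed

lemma polyfun_tendsto:
  assumes "p \<in> polyfun" "\<And>i j. (\<lambda>k. x k i j) \<longlonglongrightarrow> y i j"
  shows "(\<lambda>k. p (x k)) \<longlonglongrightarrow> p y"
  using assms(1) by induction (use assms(2) in \<open>auto intro: tendsto_intros\<close>)

text \<open>The bridge to the compactness argument for liftings: polynomials are continuous.\<close>

lemma zariski_closed_limit: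
  assumes "zariski_closed Z" "\<And>k. x k \<in> Z" "\<And>i j. (\<lambda>k. x k i j) \<longlonglongrightarrow> y i j"
  shows "y \<in> Z"
proof (rule ccontr)
  assume "y \<notin> Z"
  then obtain p where p: "p \<in> polyfun" "p y \<noteq> 0" "\<And>y. y \<in> Z \<Longrightarrow> p y = 0"
    using zariski_closedD[OF assms(1)] by blast
  have "(\<lambda>k. p (x k)) \<longlonglongrightarrow> p y" using polyfun_tendsto[OF p(1) assms(3)] .
  then have "(\<lambda>k. 0) \<longlonglongrightarrow> p y" using p(3) assms(2) by simp
  then show False using p(2) by (simp add: LIMSEQ_const_iff)
qed

section \<open>Polynomial curves\<close>

definition polynomial :: "(complex \<Rightarrow> complex) \<Rightarrow> bool" where
  "polynomial f \<longleftrightarrow> (\<exists>p. f = poly p)"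

definition vcurve :: "(complex \<Rightarrow> 'n \<Rightarrow> complex) \<Rightarrow> bool" where
  "vcurve c \<longleftrightarrow> (\<forall>j. polynomial (\<lambda>t. c t j))"

lemma polynomial_intros:
  "polynomial (\<lambda>_. k)" "polynomial (\<lambda>t. t)"
  "polynomial f \<Longrightarrow> polynomial g \<Longrightarrow> polynomial (\<lambda>t. f t + g t)"
  "polynomial f \<Longrightarrow> polynomial g \<Longrightarrow> polynomial (\<lambda>t. f t * g t)"
  "polynomial f \<Longrightarrow> polynomial g \<Longrightarrow> polynomial (\<lambda>t. f t - g t)"
proof -
  show "polynomial (\<lambda>_. k)" unfolding polynomial_def by (rule exI[of _ "[:k:]"]) auto
  show "polynomial (\<lambda>t. t)" unfolding polynomial_def by (rule exI[of _ "[:0, 1:]"]) auto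
  assume "polynomial f" "polynomial g"
  then obtain p q where "f = poly p" "g = poly q" by (auto simp: polynomial_def)
  then show "polynomial (\<lambda>t. f t + g t)" "polynomial (\<lambda>t. f t * g t)" "polynomial (\<lambda>t. f t - g t)"
    unfolding polynomial_def
    by (force intro: exI[of _ "p + q"], force intro: exI[of _ "p * q"], force intro: exI[of _ "p - q"])
qed

lemma polynomial_sum:
  "finite S \<Longrightarrow> (\<And>s. s \<in> S \<Longrightarrow> polynomial (f s)) \<Longrightarrow> polynomial (\<lambda>t. \<Sum>s\<in>S. f s t)"
  by (induction S rule: finite_induct) (auto intro: polynomial_intros)

lemma polynomial_dotp: "vcurve a \<Longrightarrow> vcurve b \<Longrightarrow> polynomial (\<lambda>t. dotp (a t) (b t))"
  unfolding dotp_def vcurve_def by (intro polynomial_sum polynomial_intros) auto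

lemma vcurve_intros:
  "vcurve (\<lambda>_. v)"
  "vcurve a \<Longrightarrow> vcurve b \<Longrightarrow> vcurve (\<lambda>t j. a t j + b t j)"
  "vcurve a \<Longrightarrow> vcurve b \<Longrightarrow> vcurve (\<lambda>t j. a t j - b t j)"
  "polynomial f \<Longrightarrow> vcurve a \<Longrightarrow> vcurve (\<lambda>t j. f t * a t j)"
  by (auto simp: vcurve_def intro: polynomial_intros)

lemma polynomial_finite_zeros:
  assumes "polynomial f" "f t \<noteq> 0"
  shows "finite {t. f t = 0}"
proof -
  obtain p where p: "f = poly p" using assms(1) by (auto simp: polynomial_def)
  then have "p \<noteq> 0" using assms(2) by auto
  then show ?thesis using poly_roots_finite p by auto
qed

lemma polynomial_polyfun:
  assumes "p \<in> polyfun" "\<And>e. vcurve (\<lambda>t. c t e)"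
  shows "polynomial (\<lambda>t. p (c t))"
  using assms(1)
  by induction (use assms(2) in \<open>auto simp: vcurve_def intro: polynomial_intros\<close>)

lemma curve_finite_in_closed:
  assumes "zariski_closed Z" "\<And>e. vcurve (\<lambda>t. c t e)" "c s \<notin> Z"
  shows "finite {t. c t \<in> Z}"
proof -
  obtain p where p: "p \<in> polyfun" "p (c s) \<noteq> 0" "\<And>y. y \<in> Z \<Longrightarrow> p y = 0"
    using zariski_closedD[OF assms(1,3)] by blast
  have "finite {t. p (c t) = 0}"
    by (rule polynomial_finite_zeros[OF polynomial_polyfun]) (use p assms(2) in auto)
  then show ?thesis by (rule rev_finite_subset) (use p in auto)
qed

lemma curve_limit_in_closed:
  assumes "zariski_closed Z" "\<And>e. vcurve (\<lambda>t. c t e)" "finite {t. c t \<notin> Z}"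
  shows "c s \<in> Z"
proof (rule ccontr)
  assume "c s \<notin> Z"
  then have "finite {t. c t \<in> Z}" using curve_finite_in_closed assms by blast
  then have "finite ({t. c t \<in> Z} \<union> {t. c t \<notin> Z})" using assms(3) by blast
  moreover have "{t. c t \<in> Z} \<union> {t. c t \<notin> Z} = UNIV" by auto
  ultimately show False using infinite_UNIV_char_0[where 'a=complex] by simp
qed

lemma curve_not_par_finite:
  assumes "vcurve a" "vcurve b" "\<not> par (a s) (b s)"
  shows "finite {t. par (a t) (b t)}"
proof -
  obtain i j where ij: "a s i * b s j - a s j * b s i \<noteq> 0" using assms(3) by (auto simp: par_def)
  have "finite {t. a t i * b t j - a t j * b t i = 0}"
    by (rule polynomial_finite_zeros[where t=s])
      (use assms ij in \<open>auto simp: vcurve_def intro!: polynomial_intros(4,5)\<close>)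
  then show ?thesis by (rule rev_finite_subset) (auto simp: par_def)
qed

lemma curve_zero_finite:
  assumes "vcurve a" "a s \<noteq> (\<lambda>_. 0)"
  shows "finite {t. a t = (\<lambda>_. 0)}"
proof -
  obtain i where i: "a s i \<noteq> 0" using assms(2) by auto
  have "finite {t. a t i = 0}"
    by (rule polynomial_finite_zeros[where t=s]) (use assms i in \<open>auto simp: vcurve_def\<close>)
  then show ?thesis by (rule rev_finite_subset) auto
qed

text \<open>A cover by two closed sets, neither containing \<open>X\<close>, would write the
  infinite parameter line as a union of three finite sets. Finitely many exceptional parameters are
  allowed because the curves constructed below, with denominators cleared, may degenerate.\<close>

lemma curve_connected_irreducible:
  assumes "X \<noteq> {}"
    "\<And>x y. x \<in> X \<Longrightarrow> y \<in> X \<Longrightarrow> \<exists>c. (\<forall>e. vcurve (\<lambda>t. c t e)) \<and> c 0 = x \<and> c 1 = y \<and> finite {t. c t \<notin> X}"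
  shows "zariski_irreducible X"
  unfolding zariski_irreducible_def
proof (intro conjI allI impI)
  fix A B assume AB: "zariski_closed A" "zariski_closed B" "X \<subseteq> A \<union> B"
  show "X \<subseteq> A \<or> X \<subseteq> B"
  proof (rule ccontr)
    assume "\<not> ?thesis"
    then obtain x y where xy: "x \<in> X" "x \<notin> A" "y \<in> X" "y \<notin> B" by blast
    then obtain c where c: "\<And>e. vcurve (\<lambda>t. c t e)" "c 0 = x" "c 1 = y" "finite {t. c t \<notin> X}"
      using assms(2) by blast
    have "finite {t. c t \<in> A}" "finite {t. c t \<in> B}"
      using curve_finite_in_closed[OF AB(1) c(1), of 0] curve_finite_in_closed[OF AB(2) c(1), of 1]
        xy c by auto
    then have "finite ({t. c t \<in> A} \<union> {t. c t \<in> B} \<union> {t. c t \<notin> X})" using c(4) by blast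
    moreover have "{t. c t \<in> A} \<union> {t. c t \<in> B} \<union> {t. c t \<notin> X} = UNIV" using AB(3) by auto
    ultimately show False using infinite_UNIV_char_0[where 'a=complex] by simp
  qed
qed (use assms(1) in simp)

lemma orthogonal_curve_one:
  assumes "vcurve a" "a s \<noteq> (\<lambda>_. 0)" "dotp (a s) g = 0"
  obtains c where "vcurve c" "c s = g" "\<And>t. dotp (a t) (c t) = 0"
proof -
  obtain u where u: "dotp (a s) u = 1" using nonzero_dual[OF assms(2)] .
  \<comment> \<open>Projection along \<open>u\<close> with the denominator
    \<open>dotp (a t) u\<close> multiplied out; this factor is 1 at \<open>t = s\<close>, so
    \<open>g\<close> is kept there.\<close>
  let ?c = "\<lambda>t j. dotp (a t) u * g j - dotp (a t) g * u j"
  have "vcurve ?c" by (intro vcurve_intros polynomial_dotp assms)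
  then show thesis by (rule that) (use u assms(3) in auto)
qed

text \<open>Project first along \<open>u\<close> onto the orthogonal space of \<open>a\<close>, then inside it along
  (the projection of) \<open>v\<close> onto that of \<open>b\<close>; clearing denominators keeps this polynomial.\<close>

lemma orthogonal_curve_two:
  assumes "vcurve a" "vcurve b" "\<not> par (a s) (b s)" "dotp (a s) g = 0" "dotp (b s) g = 0"
  obtains c where "vcurve c" "c s = g" "\<And>t. dotp (a t) (c t) = 0" "\<And>t. dotp (b t) (c t) = 0"
proof -
  have "a s \<noteq> (\<lambda>_. 0)" using assms(3) by (auto simp: par_def)
  then obtain u where u: "dotp (a s) u = 1" using nonzero_dual by metis
  obtain v where v: "dotp (a s) v = 0" "dotp (b s) v = 1" using not_par_dual[OF assms(3)] .
  define P where "P = (\<lambda>w t j. dotp (a t) u * w j - dotp (a t) w * u j)"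
  have P: "vcurve (P w)" "dotp (a t) (P w t) = 0" for w t
    unfolding P_def by (intro vcurve_intros polynomial_dotp assms) simp
  have Ps: "P g s = g" "P v s = v" using u v assms(4) by (auto simp: P_def)
  let ?c = "\<lambda>t j. dotp (b t) (P v t) * P g t j - dotp (b t) (P g t) * P v t j"
  have "vcurve ?c" by (intro vcurve_intros polynomial_dotp assms P)
  then show thesis by (rule that) (use v assms(5) Ps P(2) in auto)
qed

section \<open>Tame paving matroids\<close>

text \<open>The exclusions in types 2 and 3 only make circuits minimal: a set that is too large, by
  itself, inside a member of \<open>H\<close> or inside the intersection of two, always contains
  some circuit. Dependence thus becomes three cardinality conditions.\<close>

lemma qp_dep_iff:
  fixes S :: "'d::finite set"
  shows "qp_dep n H S \<longleftrightarrow> card S > n \<or> (\<exists>h\<in>H. card (S \<inter> h) \<ge> n) \<or>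
    (\<exists>h1\<in>H. \<exists>h2\<in>H. h1 \<noteq> h2 \<and> card (S \<inter> (h1 \<inter> h2)) \<ge> n - 1)" (is "_ \<longleftrightarrow> ?big \<or> ?one \<or> ?two")
proof
  have sub: "card C \<le> card (S \<inter> h)" if "C \<subseteq> S" "C \<subseteq> h" for C h :: "'d set"
    using that by (intro card_mono) auto
  assume "qp_dep n H S"
  then obtain C where C: "C \<subseteq> S" "qp_circuit n H C" by (auto simp: qp_dep_def)
  then consider "qp_type1 n H C" | "qp_type2 n H C" | "qp_type3 n H C" by (auto simp: qp_circuit_def)
  then show "?big \<or> ?one \<or> ?two"
  proof cases
    case 1
    then obtain h1 h2 where "h1 \<in> H" "h2 \<in> H" "h1 \<noteq> h2" "C \<subseteq> h1 \<inter> h2" "card C = n - 1"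
      by (auto simp: qp_type1_def)
    with sub[OF C(1)] show ?thesis by metis
  next
    case 2
    then obtain h where "h \<in> H" "C \<subseteq> h" "card C = n" by (auto simp: qp_type2_def)
    with sub[OF C(1)] show ?thesis by metis
  next
    case 3
    then have "card C = n + 1" by (simp add: qp_type3_def)
    with card_mono[OF _ C(1)] show ?thesis by auto
  qed
next
  have one: "qp_dep n H S" if "T \<subseteq> S" "qp_type1 n H T" for T
    using that by (auto simp: qp_dep_def qp_circuit_def)
  have two: "qp_dep n H S" if "T \<subseteq> S" "card T = n" "h \<in> H" "T \<subseteq> h" for T h
  proof (cases "\<exists>T'. T' \<subseteq> T \<and> qp_type1 n H T'")
    case False
    then have "qp_type2 n H T" using that by (auto simp: qp_type2_def)
    then show ?thesis using that(1) by (auto simp: qp_dep_def qp_circuit_def)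
  qed (use one that(1) in blast)
  assume "?big \<or> ?one \<or> ?two"
  then consider "?big" | h where "h \<in> H" "card (S \<inter> h) \<ge> n"
    | h1 h2 where "h1 \<in> H" "h2 \<in> H" "h1 \<noteq> h2" "card (S \<inter> (h1 \<inter> h2)) \<ge> n - 1" by blast
  then show "qp_dep n H S"
  proof cases
    case 1
    then have "n + 1 \<le> card S" by simp
    then obtain T where T: "T \<subseteq> S" "card T = n + 1" by (meson obtain_subset_with_card_n)
    show ?thesis
    proof (cases "\<exists>T'. T' \<subseteq> T \<and> (qp_type1 n H T' \<or> qp_type2 n H T')")
      case True
      then show ?thesis using T(1) by (auto simp: qp_dep_def qp_circuit_def)
    next
      case False
      then have "qp_type3 n H T" using T by (auto simp: qp_type3_def)
      then show ?thesis using T(1) by (auto simp: qp_dep_def qp_circuit_def)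
    qed
  next
    case 2
    then obtain T where "T \<subseteq> S \<inter> h" "card T = n" by (meson obtain_subset_with_card_n)
    then show ?thesis using two 2(1) by blast
  next
    case 3
    then obtain T where "T \<subseteq> S \<inter> (h1 \<inter> h2)" "card T = n - 1" by (meson obtain_subset_with_card_n)
    then show ?thesis using one[of T] 3 by (auto simp: qp_type1_def)
  qed
qed

locale tame_paving =
  fixes M :: "'d::finite set set" and type_n :: "'n::finite itself"
  assumes matroid: "matroid M" and paving: "paving M" and tame: "tame M"
    and rank: "mrank M = CARD('n)"
begin

text \<open>Called lines below, after the rank three case.\<close>

abbreviation L :: "'d set set" where "L \<equiv> dep_hyperplanes M"

lemma line_card: "l \<in> L \<Longrightarrow> CARD('n) \<le> card l"
  by (simp add: dep_hyperplanes_def dep_hyperplane_def all_n_subsets_circuits_def rank)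

lemma line_nonempty: "l \<in> L \<Longrightarrow> l \<noteq> {}"
  using line_card[of l] by auto

lemma line_dependent: "l \<in> L \<Longrightarrow> S \<subseteq> l \<Longrightarrow> card S = CARD('n) \<Longrightarrow> S \<notin> M"
  by (auto simp: dep_hyperplanes_def dep_hyperplane_def all_n_subsets_circuits_def rank circuit_def)

lemma line_tame:
  "l1 \<in> L \<Longrightarrow> l2 \<in> L \<Longrightarrow> l3 \<in> L \<Longrightarrow> e \<in> l1 \<Longrightarrow> e \<in> l2 \<Longrightarrow> e \<in> l3 \<Longrightarrow> l1 = l2 \<or> l1 = l3 \<or> l2 = l3"
  using tame unfolding tame_def dep_hyperplanes_def by blast

lemma circuit_exists:
  assumes "S \<notin> M"
  obtains C where "C \<subseteq> S" "circuit M C" "card C = CARD('n) \<or> card C = CARD('n) + 1"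
proof -
  obtain C where C: "C \<in> {C. C \<subseteq> S \<and> C \<notin> M}" "\<And>D. D \<in> {C. C \<subseteq> S \<and> C \<notin> M} \<Longrightarrow> D \<subseteq> C \<Longrightarrow> C = D"
    using finite_has_minimal2[of "{C. C \<subseteq> S \<and> C \<notin> M}" S] assms by auto
  then have "circuit M C" unfolding circuit_def by blast
  with C(1) paving that show thesis by (auto simp: paving_def rank)
qed

lemma small_independent: "card S < CARD('n) \<Longrightarrow> S \<in> M"
proof (rule ccontr)
  assume S: "card S < CARD('n)" "S \<notin> M"
  obtain C where "C \<subseteq> S" "card C = CARD('n) \<or> card C = CARD('n) + 1"
    using circuit_exists[OF S(2)] by blast
  with S(1) show False using card_mono[of S C] by auto
qed

lemma circuit_in_line:
  assumes "circuit M C" "card C = CARD('n)"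
  obtains l where "l \<in> L" "C \<subseteq> l"
proof -
  let ?F = "{l. all_n_subsets_circuits M l}"
  have "all_n_subsets_circuits M C"
    using assms by (auto simp: all_n_subsets_circuits_def rank dest: card_subset_eq[OF finite])
  then obtain l where "l \<in> ?F" "C \<subseteq> l" "\<And>l'. l' \<in> ?F \<Longrightarrow> l \<subseteq> l' \<Longrightarrow> l = l'"
    using finite_has_maximal2[of ?F C] by auto
  then show thesis by (intro that[of l]) (auto simp: dep_hyperplanes_def dep_hyperplane_def)
qed

text \<open>Suppose the intersection contains \<open>S\<close> with \<open>CARD('n) - 1\<close>
  elements. An independent \<open>CARD('n)\<close>-subset of the union would enlarge
  \<open>S\<close> by exchange to an independent set inside one of the lines. So all these subsets
  are circuits, against maximality of the lines.\<close>

lemma line_inter: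
  assumes "l \<in> L" "l' \<in> L" "l \<noteq> l'"
  shows "card (l \<inter> l') < CARD('n) - 1"
proof (rule ccontr)
  assume "\<not> ?thesis"
  then obtain S where S: "S \<subseteq> l \<inter> l'" "card S = CARD('n) - 1"
    by (metis not_less obtain_subset_with_card_n)
  have pos: "CARD('n) > 0" by simp
  then have SM: "S \<in> M" using S(2) by (intro small_independent) linarith
  have dep: "T \<notin> M" if T: "T \<subseteq> l \<union> l'" "card T = CARD('n)" for T
  proof
    assume "T \<in> M"
    then obtain x where x: "x \<in> T - S" "insert x S \<in> M"
      using matroid SM S(2) T(2) pos unfolding matroid_def by (metis diff_less zero_less_one)
    have "card (insert x S) = CARD('n)" using x S(2) pos by (simp del: zero_less_card_finite)
    moreover have "insert x S \<subseteq> l \<or> insert x S \<subseteq> l'" using S(1) T(1) x(1) by blast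
    ultimately show False using line_dependent assms(1,2) x(2) by blast
  qed
  have "circuit M T" if T: "T \<subseteq> l \<union> l'" "card T = CARD('n)" for T
  proof -
    have "T' \<in> M" if "T' \<subset> T" for T'
      using psubset_card_mono[OF _ that] T(2) by (intro small_independent) auto
    then show ?thesis using dep[OF T] by (simp add: circuit_def)
  qed
  moreover have "CARD('n) \<le> card (l \<union> l')"
    using line_card[OF assms(1)] card_mono[of "l \<union> l'" l] by auto
  ultimately have all: "all_n_subsets_circuits M (l \<union> l')"
    by (simp add: all_n_subsets_circuits_def rank)
  then have "\<not> l \<subset> l \<union> l'" "\<not> l' \<subset> l \<union> l'"
    using assms(1,2) by (auto simp: dep_hyperplanes_def dep_hyperplane_def)
  then show False using assms(3) by blast
qed

text \<open>In rank one the truncated bound of \<open>line_inter\<close> would read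
  \<open>card (l \<inter> l') < 0\<close>. This keeps \<open>CARD('n) - 1\<close> positive wherever
  two lines occur.\<close>

lemma two_lines_rank: "l \<in> L \<Longrightarrow> l' \<in> L \<Longrightarrow> l \<noteq> l' \<Longrightarrow> CARD('n) \<ge> 2"
  using line_inter[of l l'] by linarith

section \<open>Partitions of the lines and their strata\<close>

definition blk :: "'d set set set \<Rightarrow> 'd set \<Rightarrow> 'd set set" where
  "blk Q l = \<Union>{B \<in> Q. l \<in> B}"

lemma blk_eq:
  assumes "partition_on L Q" "B \<in> Q" "l \<in> B"
  shows "blk Q l = B"
proof -
  have "{B \<in> Q. l \<in> B} = {B}"
    using assms partition_onD2[OF assms(1)] by (auto simp: disjoint_def)
  then show ?thesis by (simp add: blk_def)
qed

lemma blk_in: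
  assumes "partition_on L Q" "l \<in> L"
  shows "blk Q l \<in> Q" "l \<in> blk Q l"
proof -
  obtain B where "B \<in> Q" "l \<in> B" using assms partition_onD1 by blast
  then show "blk Q l \<in> Q" "l \<in> blk Q l" using blk_eq[OF assms(1)] by auto
qed

lemma block_lines: "partition_on L Q \<Longrightarrow> B \<in> Q \<Longrightarrow> l \<in> B \<Longrightarrow> l \<in> L"
  using partition_onD1 by blast

lemma block_nonempty: "partition_on L Q \<Longrightarrow> B \<in> Q \<Longrightarrow> \<exists>l. l \<in> B"
  using partition_onD3 by (metis ex_in_conv)

text \<open>Normals are indexed by lines and not by blocks; the partition is then their equality
  pattern, which makes it easy to pass from one partition to another. The open conditions concern
  the hyperplanes only, so points may coincide or vanish.\<close>

definition normals :: "'d set set set \<Rightarrow> ('d set \<Rightarrow> 'n \<Rightarrow> complex) \<Rightarrow> ('d \<Rightarrow> 'n \<Rightarrow> complex) \<Rightarrow> bool" where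
  "normals Q a \<gamma> \<longleftrightarrow>
    (\<forall>l\<in>L. a l \<noteq> (\<lambda>_. 0) \<and> (\<forall>e\<in>l. dotp (a l) (\<gamma> e) = 0)) \<and>
    (\<forall>l\<in>L. \<forall>l'\<in>L. if blk Q l = blk Q l' then a l = a l' else \<not> par (a l) (a l'))"

definition X :: "'d set set set \<Rightarrow> ('d \<Rightarrow> 'n \<Rightarrow> complex) set" where
  "X Q = {\<gamma>. \<exists>a. normals Q a \<gamma>}"

text \<open>Condition (ii) of niceness. \<open>MQ_dep\<close> sees a block only through its union,
  and this condition makes the block recoverable from the union.\<close>

definition separated :: "'d set set set \<Rightarrow> bool" where
  "separated Q \<longleftrightarrow> (\<forall>B\<in>Q. \<forall>l\<in>L. l \<subseteq> \<Union>B \<longrightarrow> l \<in> B)"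

lemma normalsD:
  assumes "normals Q a \<gamma>" "l \<in> L"
  shows "a l \<noteq> (\<lambda>_. 0)" "e \<in> l \<Longrightarrow> dotp (a l) (\<gamma> e) = 0"
    "l' \<in> L \<Longrightarrow> blk Q l = blk Q l' \<Longrightarrow> a l = a l'"
    "l' \<in> L \<Longrightarrow> blk Q l \<noteq> blk Q l' \<Longrightarrow> \<not> par (a l) (a l')"
proof -
  show "a l \<noteq> (\<lambda>_. 0)" "e \<in> l \<Longrightarrow> dotp (a l) (\<gamma> e) = 0"
    using assms unfolding normals_def by blast+
  assume "l' \<in> L"
  then have "if blk Q l = blk Q l' then a l = a l' else \<not> par (a l) (a l')"
    using assms unfolding normals_def by blast
  then show "blk Q l = blk Q l' \<Longrightarrow> a l = a l'" "blk Q l \<noteq> blk Q l' \<Longrightarrow> \<not> par (a l) (a l')" by auto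
qed

lemma normals_block:
  assumes "partition_on L Q" "normals Q a \<gamma>" "B \<in> Q" "l \<in> B" "e \<in> \<Union>B"
  shows "dotp (a l) (\<gamma> e) = 0"
proof -
  obtain l' where l': "l' \<in> B" "e \<in> l'" using assms(5) by auto
  have "a l = a l'"
    using assms l' by (intro normalsD(3)[OF assms(2)]) (auto simp: blk_eq block_lines)
  then show ?thesis using normalsD(2)[OF assms(2)] l' assms by (metis block_lines)
qed

text \<open>Incidences and equalities must hold identically in the parameter. Each open condition
  needs only a witness \<open>s\<close> of its own, because it then fails at finitely many
  parameters.\<close>

lemma curve_in_X:
  assumes "\<And>l. l \<in> L \<Longrightarrow> vcurve (\<lambda>t. A t l)"
    "\<And>t l e. l \<in> L \<Longrightarrow> e \<in> l \<Longrightarrow> dotp (A t l) (c t e) = 0"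
    "\<And>l. l \<in> L \<Longrightarrow> \<exists>s. A s l \<noteq> (\<lambda>_. 0)"
    "\<And>l l' t. l \<in> L \<Longrightarrow> l' \<in> L \<Longrightarrow> blk Q l = blk Q l' \<Longrightarrow> A t l = A t l'"
    "\<And>l l'. l \<in> L \<Longrightarrow> l' \<in> L \<Longrightarrow> blk Q l \<noteq> blk Q l' \<Longrightarrow> \<exists>s. \<not> par (A s l) (A s l')"
  shows "finite {t. c t \<notin> X Q}"
proof (rule finite_subset)
  let ?Z = "\<Union>l\<in>L. {t. A t l = (\<lambda>_. 0)}"
  let ?P = "\<Union>(l, l')\<in>{(l, l'). l \<in> L \<and> l' \<in> L \<and> blk Q l \<noteq> blk Q l'}. {t. par (A t l) (A t l')}"
  show "finite (?Z \<union> ?P)"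
  proof (intro finite_UnI finite_UN_I)
    show "finite {t. A t l = (\<lambda>_. 0)}" if "l \<in> L" for l
      using assms(3)[OF that] curve_zero_finite[OF assms(1)[OF that]] by blast
    show "finite (case p of (l, l') \<Rightarrow> {t. par (A t l) (A t l')})"
      if pin: "p \<in> {(l, l'). l \<in> L \<and> l' \<in> L \<and> blk Q l \<noteq> blk Q l'}" for p
    proof -
      obtain l l' where p: "p = (l, l')" "l \<in> L" "l' \<in> L" "blk Q l \<noteq> blk Q l'"
        using pin by auto
      then show ?thesis
        using assms(5)[OF p(2-4)] curve_not_par_finite[OF assms(1)[OF p(2)] assms(1)[OF p(3)]] by auto
    qed
  qed auto
  show "{t. c t \<notin> X Q} \<subseteq> ?Z \<union> ?P"
  proof
    fix t assume "t \<in> {t. c t \<notin> X Q}"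
    then have "\<not> normals Q (A t) (c t)" by (auto simp: X_def)
    then consider l e where "l \<in> L" "e \<in> l" "dotp (A t l) (c t e) \<noteq> 0"
      | l where "l \<in> L" "A t l = (\<lambda>_. 0)"
      | l l' where "l \<in> L" "l' \<in> L"
        "\<not> (if blk Q l = blk Q l' then A t l = A t l' else \<not> par (A t l) (A t l'))"
      unfolding normals_def by blast
    then show "t \<in> ?Z \<union> ?P"
    proof cases
      case 1
      then show ?thesis using assms(2) by simp
    next
      case 2
      then show ?thesis by blast
    next
      case 3
      then have "blk Q l \<noteq> blk Q l'" "par (A t l) (A t l')"
        using assms(4)[of l l' t] by (auto split: if_splits)
      with 3 show ?thesis by blast
    qed
  qed
qed

text \<open>Tameness leaves at most two lines through \<open>e\<close>. The third hypothesis rules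
  out different moving hyperplanes that coincide at \<open>s\<close>, where a point of the common
  hyperplane need not extend to the nearby intersections.\<close>

lemma orthogonal_curve:
  assumes "\<And>l. l \<in> L \<Longrightarrow> e \<in> l \<Longrightarrow> vcurve (\<lambda>t. A t l)"
    "\<And>l. l \<in> L \<Longrightarrow> e \<in> l \<Longrightarrow> A s l \<noteq> (\<lambda>_. 0)"
    "\<And>l l'. l \<in> L \<Longrightarrow> e \<in> l \<Longrightarrow> l' \<in> L \<Longrightarrow> e \<in> l' \<Longrightarrow> (\<forall>t. A t l = A t l') \<or> \<not> par (A s l) (A s l')"
    "\<And>l. l \<in> L \<Longrightarrow> e \<in> l \<Longrightarrow> dotp (A s l) g = 0"
  obtains c where "vcurve c" "c s = g" "\<And>t l. l \<in> L \<Longrightarrow> e \<in> l \<Longrightarrow> dotp (A t l) (c t) = 0"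
proof (cases "\<exists>l\<in>L. e \<in> l")
  case False
  show ?thesis by (rule that[of "\<lambda>_. g"]) (use False in \<open>auto intro: vcurve_intros\<close>)
next
  case True
  then obtain l where l: "l \<in> L" "e \<in> l" by auto
  show ?thesis
  proof (cases "\<exists>l'\<in>L. e \<in> l' \<and> \<not> par (A s l) (A s l')")
    case False
    then have eq: "A t l' = A t l" if "l' \<in> L" "e \<in> l'" for l' t
      using assms(3)[of l l'] that l by metis
    obtain c where "vcurve c" "c s = g" "\<And>t. dotp (A t l) (c t) = 0"
      using orthogonal_curve_one[of "\<lambda>t. A t l" s g] assms l by blast
    then show ?thesis by (intro that[of c]) (auto simp: eq)
  next
    case True
    then obtain l' where l': "l' \<in> L" "e \<in> l'" "\<not> par (A s l) (A s l')" by auto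
    then have cases: "m = l \<or> m = l'" if "m \<in> L" "e \<in> m" for m
      using line_tame[of l l' m e] l that by auto
    obtain c where "vcurve c" "c s = g" "\<And>t. dotp (A t l) (c t) = 0" "\<And>t. dotp (A t l') (c t) = 0"
      using orthogonal_curve_two[of "\<lambda>t. A t l" "\<lambda>t. A t l'" s g] assms l l' by blast
    then show ?thesis by (intro that[of c]) (use cases in auto)
  qed
qed

lemma X_irreducible:
  assumes "X Q \<noteq> {}"
  shows "zariski_irreducible (X Q)"
proof (rule curve_connected_irreducible[OF assms])
  fix \<gamma> \<delta> assume "\<gamma> \<in> X Q" "\<delta> \<in> X Q"
  then obtain a b where a: "normals Q a \<gamma>" and b: "normals Q b \<delta>" by (auto simp: X_def)
  \<comment> \<open>On the segment, normals within a block stay equal, and normals of different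
    blocks stay independent except at finitely many parameters.\<close>
  define A where "A = (\<lambda>t l j. (1 - t) * a l j + t * b l j)"
  have A: "vcurve (\<lambda>t. A t l)" for l
    unfolding A_def by (intro vcurve_intros polynomial_intros)
  have A01: "A 0 l = a l" "A 1 l = b l" for l by (auto simp: A_def)
  have Asame: "A t l = A t l'" if "l \<in> L" "l' \<in> L" "blk Q l = blk Q l'" for t l l'
    using normalsD(3)[OF a that] normalsD(3)[OF b that] by (simp add: A_def)
  have curve: "\<exists>c. vcurve c \<and> c s = g e \<and> (\<forall>t. \<forall>l\<in>L. e \<in> l \<longrightarrow> dotp (A t l) (c t) = 0)"
    if n: "normals Q n g" and As: "\<And>l. A s l = n l" for s n g e
  proof -
    have dichotomy: "(\<forall>t. A t l = A t l') \<or> \<not> par (A s l) (A s l')" if "l \<in> L" "l' \<in> L" for l l'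
    proof (cases "blk Q l = blk Q l'")
      case True
      then show ?thesis using Asame[OF that] by blast
    next
      case False
      then show ?thesis using normalsD(4)[OF n that] As by simp
    qed
    obtain c where "vcurve c" "c s = g e" "\<And>t l. l \<in> L \<Longrightarrow> e \<in> l \<Longrightarrow> dotp (A t l) (c t) = 0"
    proof (rule orthogonal_curve[of e A s "g e"])
      show "A s l \<noteq> (\<lambda>_. 0)" "e \<in> l \<Longrightarrow> dotp (A s l) (g e) = 0" if "l \<in> L" for l
        using normalsD(1,2)[OF n that] As by simp_all
    qed (use A dichotomy in blast)+
    then show ?thesis by blast
  qed
  \<comment> \<open>Orthogonality to \<open>A t l\<close> is linear in the point, so a curve
    starting at \<open>\<gamma> e\<close> and another ending at \<open>\<delta> e\<close> can be
    blended.\<close>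
  have "\<exists>c. vcurve c \<and> c 0 = \<gamma> e \<and> c 1 = \<delta> e \<and> (\<forall>t. \<forall>l\<in>L. e \<in> l \<longrightarrow> dotp (A t l) (c t) = 0)" for e
  proof -
    obtain c where c: "vcurve c" "c 0 = \<gamma> e" "\<forall>t. \<forall>l\<in>L. e \<in> l \<longrightarrow> dotp (A t l) (c t) = 0"
      using curve[OF a, of 0 e] A01 by blast
    obtain d where d: "vcurve d" "d 1 = \<delta> e" "\<forall>t. \<forall>l\<in>L. e \<in> l \<longrightarrow> dotp (A t l) (d t) = 0"
      using curve[OF b, of 1 e] A01 by blast
    have "vcurve (\<lambda>t j. (1 - t) * c t j + t * d t j)"
      by (intro vcurve_intros polynomial_intros c(1) d(1))
    then show ?thesis
      by (intro exI[of _ "\<lambda>t j. (1 - t) * c t j + t * d t j"]) (use c d in auto)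
  qed
  then obtain c where c: "\<And>e. vcurve (c e)" "\<And>e. c e 0 = \<gamma> e" "\<And>e. c e 1 = \<delta> e"
    "\<And>e t l. l \<in> L \<Longrightarrow> e \<in> l \<Longrightarrow> dotp (A t l) (c e t) = 0" by metis
  have "finite {t. (\<lambda>e. c e t) \<notin> X Q}"
  proof (rule curve_in_X)
    show "\<exists>s. A s l \<noteq> (\<lambda>_. 0)" if "l \<in> L" for l
      using normalsD(1)[OF a that] A01 by metis
    show "\<exists>s. \<not> par (A s l) (A s l')" if "l \<in> L" "l' \<in> L" "blk Q l \<noteq> blk Q l'" for l l'
      using normalsD(4)[OF a that] A01 by metis
  qed (use A c(4) Asame in blast)+
  then show "\<exists>c. (\<forall>e. vcurve (\<lambda>t. c t e)) \<and> c 0 = \<gamma> \<and> c 1 = \<delta> \<and> finite {t. c t \<notin> X Q}"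
    using c(1-3) by (intro exI[of _ "\<lambda>t e. c e t"]) auto
qed

lemma MQ_dep_iff:
  "MQ_dep M Q S \<longleftrightarrow> card S > CARD('n) \<or> (\<exists>B\<in>Q. card (S \<inter> \<Union>B) \<ge> CARD('n)) \<or>
    (\<exists>B\<in>Q. \<exists>B'\<in>Q. \<Union>B \<noteq> \<Union>B' \<and> card (S \<inter> (\<Union>B \<inter> \<Union>B')) \<ge> CARD('n) - 1)"
  by (simp add: MQ_dep_def qp_dep_iff rank)

lemma X_dependent:
  assumes "partition_on L Q" "\<gamma> \<in> X Q" "MQ_dep M Q S"
  shows "lin_dep_fam \<gamma> S"
proof -
  obtain a where a: "normals Q a \<gamma>" using assms(2) by (auto simp: X_def)
  consider "card S > CARD('n)" | B where "B \<in> Q" "card (S \<inter> \<Union>B) \<ge> CARD('n)"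
    | B B' where "B \<in> Q" "B' \<in> Q" "B \<noteq> B'" "card (S \<inter> (\<Union>B \<inter> \<Union>B')) \<ge> CARD('n) - 1"
    using assms(3) unfolding MQ_dep_iff by blast
  then show ?thesis
  proof cases
    case 1
    then show ?thesis by (rule lin_dep_fam_large)
  next
    case 2
    obtain l where l: "l \<in> B" using block_nonempty[OF assms(1) 2(1)] by blast
    have "lin_dep_fam \<gamma> (S \<inter> \<Union>B)"
      using normals_block[OF assms(1) a 2(1) l] normalsD(1)[OF a] block_lines[OF assms(1) 2(1) l] 2(2)
      by (intro lin_dep_fam_in_hyperplane[of "a l"]) auto
    then show ?thesis by (rule lin_dep_fam_mono) auto
  next
    case 3
    obtain l l' where l: "l \<in> B" "l' \<in> B'"
      using block_nonempty[OF assms(1) 3(1)] block_nonempty[OF assms(1) 3(2)] by blast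
    have "\<not> par (a l) (a l')"
      using l 3 assms(1) by (intro normalsD(4)[OF a]) (auto simp: blk_eq block_lines)
    then have "lin_dep_fam \<gamma> (S \<inter> (\<Union>B \<inter> \<Union>B'))"
      using normals_block[OF assms(1) a 3(1) l(1)] normals_block[OF assms(1) a 3(2) l(2)] 3(4)
      by (intro lin_dep_fam_in_two_hyperplanes[of "a l" "a l'"]) auto
    then show ?thesis by (rule lin_dep_fam_mono) auto
  qed
qed

section \<open>Realizations are dense in a stratum\<close>

lemma separated_Union_inj:
  assumes "partition_on L Q" "separated Q" "B \<in> Q" "B' \<in> Q" "\<Union>B = \<Union>B'"
  shows "B = B'"
proof -
  obtain l where l: "l \<in> B" using block_nonempty[OF assms(1,3)] by blast
  then have "l \<in> L" "l \<subseteq> \<Union>B'" using assms(5) block_lines[OF assms(1,3)] by auto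
  then have "l \<in> B'" using assms(2,4) unfolding separated_def by blast
  then have "blk Q l = B'" by (rule blk_eq[OF assms(1,4)])
  then show ?thesis using blk_eq[OF assms(1,3) l] by simp
qed

text \<open>A point \<open>x\<close> of \<open>l\<close> lies on at most one further line, hence in
  at most one other block, and separation gives a point of \<open>l\<close> outside that block.
  These two points already defeat every other block.\<close>

lemma transversal_subset:
  assumes Q: "partition_on L Q" "separated Q" and B: "B \<in> Q" "l \<in> B"
  obtains S where "S \<subseteq> l" "card S = CARD('n) - 1" "\<And>B'. B' \<in> Q \<Longrightarrow> B' \<noteq> B \<Longrightarrow> \<not> S \<subseteq> \<Union>B'"
proof (cases "\<exists>B'\<in>Q. B' \<noteq> B")
  case False
  have l: "l \<in> L" using block_lines[OF Q(1) B] .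
  have "CARD('n) - 1 \<le> card l" using line_card[OF l] by linarith
  then obtain S where S: "S \<subseteq> l" "card S = CARD('n) - 1" by (meson obtain_subset_with_card_n)
  show thesis by (rule that[OF S]) (use False in auto)
next
  case True
  then obtain B0 l0 where B0: "B0 \<in> Q" "B0 \<noteq> B" "l0 \<in> B0" using block_nonempty[OF Q(1)] by blast
  have l: "l \<in> L" using block_lines[OF Q(1) B] .
  have disj: "l' \<noteq> l" "l' \<in> L" if "B' \<in> Q" "B' \<noteq> B" "l' \<in> B'" for B' l'
    using that(2) blk_eq[OF Q(1) B] blk_eq[OF Q(1) that(1,3)] block_lines[OF Q(1) that(1,3)] by auto
  have n2: "CARD('n) \<ge> 2" using two_lines_rank[of l l0] disj[OF B0] l by auto
  obtain x where x: "x \<in> l" using line_nonempty[OF l] by auto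
  have ext: "\<exists>S\<subseteq>l. card S = CARD('n) - 1 \<and> T \<subseteq> S" if "T \<subseteq> l" "card T \<le> CARD('n) - 1" for T
  proof -
    have "CARD('n) - 1 \<le> card l" using line_card[OF l] by linarith
    then show ?thesis using exists_subset_between[of T "CARD('n) - 1" l] that by auto
  qed
  show thesis
  proof (cases "\<exists>B'\<in>Q. B' \<noteq> B \<and> x \<in> \<Union>B'")
    case False
    have "card {x} \<le> CARD('n) - 1" using n2 by simp
    then obtain S where S: "S \<subseteq> l" "card S = CARD('n) - 1" "{x} \<subseteq> S" using ext[of "{x}"] x by auto
    have "\<not> S \<subseteq> \<Union>B'" if "B' \<in> Q" "B' \<noteq> B" for B'
      using False S(3) that by (meson insert_subset subsetD)
    then show thesis by (rule that[OF S(1,2)])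
  next
    case True
    then obtain B1 l1 where B1: "B1 \<in> Q" "B1 \<noteq> B" "l1 \<in> B1" "x \<in> l1" by auto
    have "\<not> l \<subseteq> \<Union>B1" using Q(2) B1(1) l disj[OF B1(1,2)] unfolding separated_def by blast
    then obtain y where y: "y \<in> l" "y \<notin> \<Union>B1" by auto
    \<comment> \<open>The common point \<open>x\<close> and \<open>line_inter\<close> force rank at
      least 3, which leaves room for both \<open>x\<close> and \<open>y\<close> among
      \<open>CARD('n) - 1\<close> elements.\<close>
    have "card (l \<inter> l1) > 0" using x B1(4) by (auto simp: card_gt_0_iff)
    moreover have "card (l \<inter> l1) < CARD('n) - 1"
      using line_inter[of l l1] l disj[OF B1(1-3)] by blast
    ultimately have "CARD('n) \<ge> 3" by linarith
    moreover have "card {x, y} \<le> 2" by (simp add: card_insert_if)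
    ultimately have "card {x, y} \<le> CARD('n) - 1" by linarith
    then obtain S where S: "S \<subseteq> l" "card S = CARD('n) - 1" "{x, y} \<subseteq> S"
      using ext[of "{x, y}"] x y(1) by auto
    have "\<not> S \<subseteq> \<Union>B'" if "B' \<in> Q" "B' \<noteq> B" for B'
    proof
      assume sub: "S \<subseteq> \<Union>B'"
      then obtain l' where l': "l' \<in> B'" "x \<in> l'" using S(3) by auto
      have "B' \<noteq> B1" using sub S(3) y(2) by auto
      then have "l' \<noteq> l1" using blk_eq[OF Q(1) that(1) l'(1)] blk_eq[OF Q(1) B1(1,3)] by auto
      then show False
        using line_tame[of l l1 l' x] l x disj[OF that l'(1)] disj[OF B1(1-3)] l'(2) B1(4) by auto
    qed
    then show thesis by (rule that[OF S(1,2)])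
  qed
qed

text \<open>The set is so small that only type 1 could apply, and of the two blocks containing
  \<open>S\<close> one would differ from \<open>B\<close>.\<close>

lemma transversal_independent:
  assumes "B \<in> Q" "card S = CARD('n) - 1" "\<And>B'. B' \<in> Q \<Longrightarrow> B' \<noteq> B \<Longrightarrow> \<not> S \<subseteq> \<Union>B'"
  shows "\<not> MQ_dep M Q S"
proof
  have less: "card S < CARD('n)" using assms(2) zero_less_card_finite[where 'a='n] by linarith
  have le: "card (S \<inter> T) \<le> card S" for T by (intro card_mono) auto
  have no1: "\<not> CARD('n) \<le> card (S \<inter> T)" for T using less le[of T] by linarith
  assume "MQ_dep M Q S"
  then obtain B1 B2 where B12: "B1 \<in> Q" "B2 \<in> Q" "B1 \<noteq> B2" "card (S \<inter> (\<Union>B1 \<inter> \<Union>B2)) \<ge> card S"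
    unfolding MQ_dep_iff using less no1 assms(2) by auto
  then have "S \<inter> (\<Union>B1 \<inter> \<Union>B2) = S" by (intro card_seteq) auto
  then show False using assms(3)[OF B12(1)] assms(3)[OF B12(2)] B12(3) by blast
qed

text \<open>Serves to show that in a realization different blocks have different
  hyperplanes.\<close>

lemma transversal_insert_independent:
  assumes Q: "partition_on L Q" and B: "B \<in> Q" "l \<in> B"
    and S: "S \<subseteq> l" "card S = CARD('n) - 1" "\<And>B'. B' \<in> Q \<Longrightarrow> B' \<noteq> B \<Longrightarrow> \<not> S \<subseteq> \<Union>B'"
    and x: "x \<notin> \<Union>B"
  shows "\<not> MQ_dep M Q (insert x S)"
proof
  let ?U = "insert x S"
  have l: "l \<in> L" using block_lines[OF Q B] .
  have xS: "x \<notin> S" using x S(1) B(2) by auto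
  have cU: "card ?U = CARD('n)"
    using xS S(2) zero_less_card_finite[where 'a='n] by (simp del: zero_less_card_finite)
  assume "MQ_dep M Q ?U"
  then consider B1 where "B1 \<in> Q" "card (?U \<inter> \<Union>B1) \<ge> CARD('n)"
    | B1 B2 where "B1 \<in> Q" "B2 \<in> Q" "B1 \<noteq> B2" "card (?U \<inter> (\<Union>B1 \<inter> \<Union>B2)) \<ge> CARD('n) - 1"
    unfolding MQ_dep_iff using cU by auto
  then show False
  proof cases
    case 1
    then have "?U \<inter> \<Union>B1 = ?U" using cU by (intro card_seteq) auto
    then show False using x S(3)[OF 1(1)] by blast
  next
    case 2
    let ?W = "?U \<inter> (\<Union>B1 \<inter> \<Union>B2)"
    show False
    proof (cases "B1 = B \<or> B2 = B")
      case True
      then have "?W \<subseteq> S" using x by auto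
      then have "?W = S" using 2(4) S(2) by (intro card_seteq) auto
      then show False using S(3) 2 True by blast
    next
      case False
      \<comment> \<open>Points of \<open>S\<close> lie on \<open>l\<close> and by tameness on at
        most one further line, so only \<open>x\<close> can be in both blocks. Then
        \<open>CARD('n) - 1 \<le> 1\<close>, and two lines meeting in \<open>x\<close> contradict
        \<open>line_inter\<close>.\<close>
      have disj: "l' \<noteq> l''" "l' \<in> L"
        if "B' \<in> Q" "B'' \<in> Q" "B' \<noteq> B''" "l' \<in> B'" "l'' \<in> B''" for B' B'' l' l''
        using that(3) blk_eq[OF Q that(1,4)] blk_eq[OF Q that(2,5)] block_lines[OF Q that(1,4)] by auto
      have "y = x" if yW: "y \<in> ?W" for y
      proof (rule ccontr)
        assume "y \<noteq> x"
        then have "y \<in> l" using yW S(1) by auto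
        moreover obtain l1 l2 where "l1 \<in> B1" "y \<in> l1" "l2 \<in> B2" "y \<in> l2" using yW by auto
        moreover from this have "l1 \<noteq> l" "l1 \<in> L" "l2 \<noteq> l" "l2 \<in> L" "l1 \<noteq> l2"
          using disj[OF 2(1) B(1) _ _ B(2), of l1] disj[OF 2(2) B(1) _ _ B(2), of l2]
            disj[OF 2(1-3), of l1 l2] False by auto
        ultimately show False using line_tame[of l l1 l2 y] l by auto
      qed
      then have sub: "?W \<subseteq> {x}" by blast
      obtain m1 m2 where m: "m1 \<in> B1" "m2 \<in> B2"
        using block_nonempty[OF Q 2(1)] block_nonempty[OF Q 2(2)] by blast
      have n2: "CARD('n) \<ge> 2"
        using two_lines_rank[of m1 m2] disj(1)[OF 2(1-3) m] block_lines[OF Q 2(1) m(1)]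
          block_lines[OF Q 2(2) m(2)] by blast
      then have "card ?W \<noteq> 0" using 2(4) by linarith
      then have "?W \<noteq> {}" by (metis card.empty)
      then obtain l1 l2 where l12: "l1 \<in> B1" "x \<in> l1" "l2 \<in> B2" "x \<in> l2" using sub by auto
      have "card ?W \<le> 1" using card_mono[OF _ sub] by simp
      then have "CARD('n) - 1 \<le> 1" using 2(4) by linarith
      moreover have "l1 \<in> L" "l2 \<in> L" "l1 \<noteq> l2"
        using disj[OF 2(1-3) l12(1,3)] block_lines[OF Q 2(2) l12(3)] by auto
      then have "card (l1 \<inter> l2) < CARD('n) - 1" by (rule line_inter)
      moreover have "card (l1 \<inter> l2) > 0" using l12 by (auto simp: card_gt_0_iff)
      ultimately show False by linarith
    qed
  qed
qed

lemma independent_realized_in_X: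
  assumes Q: "partition_on L Q" "separated Q" and S: "\<not> MQ_dep M Q S"
  shows "\<exists>\<gamma>\<in>X Q. \<not> lin_dep_fam \<gamma> S"
proof -
  have cS: "card S \<le> CARD('n)" using S by (auto simp: MQ_dep_iff)
  then obtain \<sigma> :: "'d \<Rightarrow> 'n" where \<sigma>: "inj_on \<sigma> S"
    using card_le_inj[of S "UNIV :: 'n set"] by auto
  obtain f :: "'d set set \<Rightarrow> nat" where f: "inj f"
    using finite_imp_inj_to_nat_seg[of "UNIV :: 'd set set set"] by auto
  obtain g :: "'n \<Rightarrow> nat" where g: "inj g" using finite_imp_inj_to_nat_seg[of "UNIV :: 'n set"] by auto
  define C where "C = (\<lambda>B :: 'd set set. - \<sigma> ` (S \<inter> \<Union>B))"
  define \<gamma> :: "'d \<Rightarrow> 'n \<Rightarrow> complex"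
    where "\<gamma> = (\<lambda>e. if e \<in> S then (\<lambda>j. if j = \<sigma> e then 1 else 0) else (\<lambda>_. 0))"
  \<comment> \<open>On a common support the 2 by 2 minors factor into a difference of
    \<open>f\<close>-values and a difference of \<open>g\<close>-values, hence are nonzero. The
    summand 1 keeps the entries themselves nonzero.\<close>
  define h where "h = (\<lambda>B j. if j \<in> C B then of_nat (f B + g j + 1) else (0 :: complex))"
  define a where "a = (\<lambda>l. h (blk Q l))"
  have nz: "h B j \<noteq> 0" if "j \<in> C B" for B j
    using that unfolding h_def by (simp del: of_nat_add of_nat_Suc add: of_nat_eq_0_iff[symmetric])
  have cardC: "card (- \<sigma> ` (S \<inter> T)) = CARD('n) - card (S \<inter> T)" for T
    using \<sigma> by (simp add: Compl_eq_Diff_UNIV card_Diff_subset card_image inj_on_subset)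
  have C1: "C B \<noteq> {}" if "B \<in> Q" for B
  proof -
    have "card (S \<inter> \<Union>B) < CARD('n)" using S that by (auto simp: MQ_dep_iff not_le)
    then have "card (C B) > 0" unfolding C_def cardC by simp
    then show ?thesis by auto
  qed
  have np: "\<not> par (h B) (h B')" if B: "B \<in> Q" "B' \<in> Q" "B \<noteq> B'" for B B'
  proof (cases "C B = C B'")
    case False
    then obtain j B1 B2 where j: "j \<in> C B1" "j \<notin> C B2" and B12: "{B1, B2} = {B, B'}" by blast
    then have "B2 \<in> Q" using B by auto
    then obtain k where k: "k \<in> C B2" using C1 by blast
    have "h B1 j * h B2 k \<noteq> h B1 k * h B2 j" using nz[OF j(1)] nz[OF k] j(2) by (simp add: h_def)
    then have "\<not> par (h B1) (h B2)" unfolding par_def by blast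
    then show ?thesis using B12 par_sym by (metis doubleton_eq_iff)
  next
    case True
    have "\<Union>B \<noteq> \<Union>B'" using separated_Union_inj Q B by blast
    then have small: "card (S \<inter> (\<Union>B \<inter> \<Union>B')) < CARD('n) - 1"
      using S B(1,2) unfolding MQ_dep_iff by (meson not_le)
    \<comment> \<open>By injectivity of \<open>\<sigma>\<close>, a coordinate missing from both
      supports comes from a point of \<open>S\<close> in both unions.\<close>
    have "- \<sigma> ` (S \<inter> (\<Union>B \<inter> \<Union>B')) \<subseteq> C B \<union> C B'"
    proof
      fix j assume j: "j \<in> - \<sigma> ` (S \<inter> (\<Union>B \<inter> \<Union>B'))"
      show "j \<in> C B \<union> C B'"
      proof (rule ccontr)
        assume "j \<notin> C B \<union> C B'"
        then obtain s s' where s: "j = \<sigma> s" "s \<in> S" "s \<in> \<Union>B" "j = \<sigma> s'" "s' \<in> S" "s' \<in> \<Union>B'"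
          unfolding C_def by blast
        then have "s = s'" using \<sigma> by (auto dest: inj_onD)
        with s j show False by blast
      qed
    qed
    then have "card (- \<sigma> ` (S \<inter> (\<Union>B \<inter> \<Union>B'))) \<le> card (C B)" using True by (intro card_mono) auto
    then have "card (C B) \<ge> 2" using small unfolding cardC by linarith
    then obtain j k where jk: "j \<in> C B" "k \<in> C B" "j \<noteq> k"
      by (metis One_nat_def card_le_Suc0_iff_eq finite not_less_eq_eq numeral_2_eq_2)
    define p q u v where "p = (of_nat (f B) :: complex)" "q = (of_nat (f B') :: complex)"
      "u = (of_nat (g j + 1) :: complex)" "v = (of_nat (g k + 1) :: complex)"
    have "p \<noteq> q" "u \<noteq> v" using f g B(3) jk(3) by (auto simp: p_q_u_v_def inj_eq simp del: of_nat_add)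
    moreover have "h B j * h B' k - h B k * h B' j = (p - q) * (v - u)"
      using jk True by (simp add: h_def p_q_u_v_def algebra_simps)
    ultimately have "h B j * h B' k \<noteq> h B k * h B' j" by auto
    then show ?thesis unfolding par_def by blast
  qed
  have "normals Q a \<gamma>"
    unfolding normals_def
  proof (intro conjI ballI)
    fix l assume l: "l \<in> L"
    obtain j where "j \<in> C (blk Q l)" using C1 blk_in Q(1) l by blast
    then show "a l \<noteq> (\<lambda>_. 0)" using nz unfolding a_def by metis
    fix e assume e: "e \<in> l"
    show "dotp (a l) (\<gamma> e) = 0"
    proof (cases "e \<in> S")
      case True
      have "e \<in> \<Union>(blk Q l)" using blk_in[OF Q(1) l] e by blast
      then have "\<sigma> e \<notin> C (blk Q l)" using True by (auto simp: C_def)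
      then show ?thesis using True by (simp add: \<gamma>_def a_def h_def)
    qed (simp add: \<gamma>_def)
  next
    fix l l' assume l: "l \<in> L" "l' \<in> L"
    show "if blk Q l = blk Q l' then a l = a l' else \<not> par (a l) (a l')"
      using np[of "blk Q l" "blk Q l'"] blk_in Q(1) l by (auto simp: a_def)
  qed
  moreover have "\<not> lin_dep_fam \<gamma> S"
  proof
    assume "lin_dep_fam \<gamma> S"
    then obtain c i where c: "i \<in> S" "c i \<noteq> 0" "\<And>j. (\<Sum>s\<in>S. c s * \<gamma> s j) = 0"
      by (auto simp: lin_dep_fam_def)
    have "(\<Sum>s\<in>S. c s * \<gamma> s (\<sigma> i)) = (\<Sum>s\<in>S. if s = i then c i else 0)"
      by (rule sum.cong) (use c(1) \<sigma> in \<open>auto simp: \<gamma>_def dest: inj_onD\<close>)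
    then show False using c by simp
  qed
  ultimately show ?thesis by (auto simp: X_def)
qed

lemma X_nonempty:
  assumes "partition_on L Q" "separated Q"
  shows "X Q \<noteq> {}"
proof -
  \<comment> \<open>Only type 1 with \<open>CARD('n) - 1 = 0\<close> could make the empty set
    dependent, and in rank one there are no two lines.\<close>
  have "\<not> MQ_dep M Q {}"
  proof
    assume "MQ_dep M Q {}"
    then obtain B B' where B: "B \<in> Q" "B' \<in> Q" "B \<noteq> B'" "CARD('n) - 1 \<le> 0"
      by (auto simp: MQ_dep_iff)
    then obtain l l' where l: "l \<in> B" "l' \<in> B'" using block_nonempty[OF assms(1)] by meson
    then have "l \<in> L" "l' \<in> L" "l \<noteq> l'"
      using blk_eq[OF assms(1) B(1) l(1)] blk_eq[OF assms(1) B(2) l(2)] B(3)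
        block_lines[OF assms(1) B(1) l(1)] block_lines[OF assms(1) B(2) l(2)] by auto
    then show False using two_lines_rank[of l l'] B(4) by linarith
  qed
  then show ?thesis using independent_realized_in_X[OF assms] by blast
qed

text \<open>Two blocks cannot share a hyperplane: a transversal subset of one, together with a point
  of the other outside its union, is an independent set of \<open>CARD('n)\<close> points.\<close>

lemma realization_in_X:
  assumes Q: "partition_on L Q" "separated Q" and \<gamma>: "realization (MQ_dep M Q) \<gamma>"
  shows "\<gamma> \<in> X Q"
proof -
  have dep: "lin_dep_fam \<gamma> S \<longleftrightarrow> MQ_dep M Q S" for S using \<gamma> by (simp add: realization_def)
  have "\<exists>a. a \<noteq> (\<lambda>_. 0) \<and> (\<forall>e\<in>\<Union>B. dotp a (\<gamma> e) = 0)" if "B \<in> Q" for B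
  proof -
    have "lin_dep_fam \<gamma> S" if "S \<subseteq> \<Union>B" "card S = CARD('n)" for S
    proof -
      have "S \<inter> \<Union>B = S" using that by auto
      then show ?thesis unfolding dep MQ_dep_iff using that \<open>B \<in> Q\<close> by (metis order_refl)
    qed
    then show ?thesis using subsets_dependent_imp_normal[of "\<Union>B" \<gamma>] by metis
  qed
  then obtain h where h: "\<And>B. B \<in> Q \<Longrightarrow> h B \<noteq> (\<lambda>_. 0)" "\<And>B e. B \<in> Q \<Longrightarrow> e \<in> \<Union>B \<Longrightarrow> dotp (h B) (\<gamma> e) = 0"
    by metis
  have np: "\<not> par (h B) (h B')" if B: "B \<in> Q" "B' \<in> Q" "B \<noteq> B'" for B B'
  proof
    assume p: "par (h B) (h B')"
    obtain l l' where l: "l \<in> B" "l' \<in> B'"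
      using block_nonempty[OF Q(1) B(1)] block_nonempty[OF Q(1) B(2)] by blast
    obtain S where S: "S \<subseteq> l" "card S = CARD('n) - 1" "\<And>B'. B' \<in> Q \<Longrightarrow> B' \<noteq> B \<Longrightarrow> \<not> S \<subseteq> \<Union>B'"
      using transversal_subset[OF Q B(1) l(1)] by blast
    have "l' \<notin> B" "l' \<in> L"
      using blk_eq[OF Q(1) B(1)] blk_eq[OF Q(1) B(2) l(2)] B(3) block_lines[OF Q(1) B(2) l(2)] by auto
    then have "\<not> l' \<subseteq> \<Union>B" using Q(2) B(1) unfolding separated_def by blast
    then obtain x where x: "x \<in> l'" "x \<notin> \<Union>B" by auto
    have "\<not> lin_dep_fam \<gamma> (insert x S)"
      unfolding dep by (rule transversal_insert_independent[OF Q(1) B(1) l(1) S x(2)])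
    moreover have "dotp (h B) (\<gamma> s) = 0" if "s \<in> insert x S" for s
    proof (cases "s = x")
      case True
      then have "dotp (h B') (\<gamma> s) = 0" using h(2) B(2) l(2) x(1) by blast
      then show ?thesis using par_dotp[OF par_sym[OF p] h(1)[OF B(2)]] by blast
    qed (use that h(2) B(1) l(1) S(1) in blast)
    moreover have "x \<notin> S" using x(2) S(1) l(1) by auto
    then have "card (insert x S) \<ge> CARD('n)" using S(2) by simp
    ultimately show False using lin_dep_fam_in_hyperplane[OF h(1)[OF B(1)], of "insert x S" \<gamma>] by blast
  qed
  have "normals Q (\<lambda>l. h (blk Q l)) \<gamma>"
    unfolding normals_def
  proof (intro conjI ballI)
    fix l assume l: "l \<in> L"
    note blk = blk_in[OF Q(1) l]
    show "h (blk Q l) \<noteq> (\<lambda>_. 0)" using h(1)[OF blk(1)] .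
    show "dotp (h (blk Q l)) (\<gamma> e) = 0" if "e \<in> l" for e
      using h(2)[OF blk(1)] blk(2) that by blast
    fix l' assume l': "l' \<in> L"
    show "if blk Q l = blk Q l' then h (blk Q l) = h (blk Q l') else \<not> par (h (blk Q l)) (h (blk Q l'))"
      using np[OF blk(1) blk_in(1)[OF Q(1) l']] by simp
  qed
  then show ?thesis by (auto simp: X_def)
qed

text \<open>Outside finitely many closed sets a point of \<open>X Q\<close> has no dependent sets
  beyond those of M(Q), and by \<open>X_dependent\<close> it has all of these, so it is a
  realization.\<close>

lemma X_subset_variety:
  assumes Q: "partition_on L Q" "separated Q"
  shows "X Q \<subseteq> matroid_variety (MQ_dep M Q)"
proof (rule irreducible_dense[of _ _ "{S. \<not> MQ_dep M Q S}" "\<lambda>S. {\<gamma>. lin_dep_fam \<gamma> S}"])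
  show "zariski_irreducible (X Q)" using X_irreducible X_nonempty Q by blast
  show "\<gamma> \<in> matroid_variety (MQ_dep M Q)"
    if "\<gamma> \<in> X Q" "\<And>S. S \<in> {S. \<not> MQ_dep M Q S} \<Longrightarrow> \<gamma> \<notin> {\<gamma>. lin_dep_fam \<gamma> S}" for \<gamma>
  proof -
    have "realization (MQ_dep M Q) \<gamma>"
      using that X_dependent[OF Q(1) that(1)] by (auto simp: realization_def)
    then show ?thesis unfolding matroid_variety_def using zariski_closure_subset by blast
  qed
  show "\<not> X Q \<subseteq> {\<gamma>. lin_dep_fam \<gamma> S}" if "S \<in> {S. \<not> MQ_dep M Q S}" for S
    using independent_realized_in_X[OF Q] that by blast
qed (auto simp: matroid_variety_def zariski_closure_closed zariski_closed_lin_dep)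

lemma variety_eq_closure:
  assumes "partition_on L Q" "separated Q"
  shows "matroid_variety (MQ_dep M Q) = zariski_closure (X Q)"
proof
  show "matroid_variety (MQ_dep M Q) \<subseteq> zariski_closure (X Q)"
    unfolding matroid_variety_def
    using realization_in_X[OF assms] zariski_closure_subset[of "X Q"]
    by (intro zariski_closure_minimal zariski_closure_closed) auto
  show "zariski_closure (X Q) \<subseteq> matroid_variety (MQ_dep M Q)"
    using X_subset_variety[OF assms]
    by (intro zariski_closure_minimal) (auto simp: matroid_variety_def zariski_closure_closed)
qed

section \<open>Nice partitions cover the circuit variety\<close>

text \<open>Also used for partitions that are not separated, to which
  \<open>variety_eq_closure\<close> does not apply; the covering argument passes through
  them.\<close>

definition Y :: "'d set set set \<Rightarrow> ('d \<Rightarrow> 'n \<Rightarrow> complex) set" where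
  "Y Q = zariski_closure (X Q)"

lemma Y_closed: "zariski_closed (Y Q)"
  by (simp add: Y_def zariski_closure_closed)

lemma X_subset_Y: "X Q \<subseteq> Y Q"
  by (simp add: Y_def zariski_closure_subset)

lemma Y_subset: "X Q \<subseteq> Z \<Longrightarrow> zariski_closed Z \<Longrightarrow> Y Q \<subseteq> Z"
  by (simp add: Y_def zariski_closure_minimal)

lemma variety_subset_circuit_variety:
  assumes "partition_on L Q"
  shows "matroid_variety (MQ_dep M Q) \<subseteq> (circuit_variety (\<lambda>S. S \<notin> M) :: ('d \<Rightarrow> 'n \<Rightarrow> complex) set)"
  unfolding matroid_variety_def
proof (rule zariski_closure_minimal[OF _ zariski_closed_circuit_variety])
  have "MQ_dep M Q S" if "S \<notin> M" for S
  proof -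
    obtain C where C: "C \<subseteq> S" "circuit M C" "card C = CARD('n) \<or> card C = CARD('n) + 1"
      using circuit_exists[OF \<open>S \<notin> M\<close>] .
    from C(3) show ?thesis
    proof
      assume n: "card C = CARD('n)"
      obtain l where l: "l \<in> L" "C \<subseteq> l" using circuit_in_line[OF C(2) n] .
      have "C \<subseteq> S \<inter> \<Union>(blk Q l)" using C(1) l(2) blk_in(2)[OF assms l(1)] by blast
      then have "card (S \<inter> \<Union>(blk Q l)) \<ge> CARD('n)" using n card_mono[of "S \<inter> \<Union>(blk Q l)" C] by simp
      then show ?thesis using blk_in(1)[OF assms l(1)] unfolding MQ_dep_iff by blast
    next
      assume "card C = CARD('n) + 1"
      then show ?thesis using card_mono[OF finite C(1)] unfolding MQ_dep_iff by simp
    qed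
  qed
  then show "{\<gamma> :: 'd \<Rightarrow> 'n \<Rightarrow> complex. realization (MQ_dep M Q) \<gamma>} \<subseteq> circuit_variety (\<lambda>S. S \<notin> M)"
    by (auto simp: realization_def circuit_variety_def)
qed

text \<open>New partitions arise as fibres of a function on the lines: the hyperplane chosen for a
  line, its block after a move, or its block together with a lifted functional.\<close>

lemma kernel_partition:
  obtains Q where "partition_on L Q"
    "\<And>l l'. l \<in> L \<Longrightarrow> l' \<in> L \<Longrightarrow> blk Q l = blk Q l' \<longleftrightarrow> \<kappa> l = \<kappa> l'"
proof -
  define c where "c = (\<lambda>l. {l' \<in> L. \<kappa> l' = \<kappa> l})"
  have p: "partition_on L (c ` L)"
  proof (rule partition_onI)
    show "disjnt p q" if "p \<in> c ` L" "q \<in> c ` L" "p \<noteq> q" for p q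
      using that by (auto simp: c_def disjnt_def)
  qed (auto simp: c_def)
  have "blk (c ` L) l = c l" if "l \<in> L" for l
    using that by (intro blk_eq[OF p]) (auto simp: c_def)
  then have "blk (c ` L) l = blk (c ` L) l' \<longleftrightarrow> \<kappa> l = \<kappa> l'" if "l \<in> L" "l' \<in> L" for l l'
    using that by (auto simp: c_def set_eq_iff)
  with p show thesis by (rule that)
qed

lemma line_normal:
  assumes "\<gamma> \<in> (circuit_variety (\<lambda>S. S \<notin> M) :: ('d \<Rightarrow> 'n \<Rightarrow> complex) set)" "l \<in> L"
  shows "\<exists>a. a \<noteq> (\<lambda>_. 0) \<and> (\<forall>e\<in>l. dotp a (\<gamma> e) = 0)"
proof -
  have "lin_dep_fam \<gamma> S" if "S \<subseteq> l" "card S = CARD('n)" for S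
    using line_dependent[OF assms(2) that] assms(1) by (simp add: circuit_variety_def)
  then obtain a where "a \<noteq> (\<lambda>_. 0)" "\<And>e. e \<in> l \<Longrightarrow> dotp a (\<gamma> e) = 0"
    using subsets_dependent_imp_normal[of l \<gamma>] by blast
  then show ?thesis by blast
qed

text \<open>The blocks are the classes of lines whose chosen hyperplanes coincide.\<close>

lemma circuit_variety_covered:
  assumes "\<gamma> \<in> (circuit_variety (\<lambda>S. S \<notin> M) :: ('d \<Rightarrow> 'n \<Rightarrow> complex) set)"
  shows "\<exists>Q. partition_on L Q \<and> \<gamma> \<in> X Q"
proof -
  obtain a where a: "\<And>l. l \<in> L \<Longrightarrow> a l \<noteq> (\<lambda>_. 0) \<and> (\<forall>e\<in>l. dotp (a l) (\<gamma> e) = 0)"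
    using line_normal[OF assms] by metis
  define \<kappa> where "\<kappa> = (\<lambda>l. {l' \<in> L. par (a l) (a l')})"
  have \<kappa>: "\<kappa> l = \<kappa> l' \<longleftrightarrow> par (a l) (a l')" if "l \<in> L" "l' \<in> L" for l l'
  proof
    assume "\<kappa> l = \<kappa> l'"
    moreover have "l' \<in> \<kappa> l'" using that by (simp add: \<kappa>_def)
    ultimately have "l' \<in> \<kappa> l" by simp
    then show "par (a l) (a l')" by (simp add: \<kappa>_def)
  next
    assume p: "par (a l) (a l')"
    have nz: "a l \<noteq> (\<lambda>_. 0)" "a l' \<noteq> (\<lambda>_. 0)" using a that by auto
    show "\<kappa> l = \<kappa> l'"
      using par_trans[OF p _ nz(2)] par_trans[OF par_sym[OF p] _ nz(1)] unfolding \<kappa>_def by blast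
  qed
  obtain Q where Q: "partition_on L Q"
    "\<And>l l'. l \<in> L \<Longrightarrow> l' \<in> L \<Longrightarrow> blk Q l = blk Q l' \<longleftrightarrow> \<kappa> l = \<kappa> l'"
    using kernel_partition[of \<kappa>] by blast
  define r where "r = (\<lambda>l. SOME m. m \<in> blk Q l)"
  have r: "r l \<in> L" "par (a (r l)) (a l)" if l: "l \<in> L" for l
  proof -
    have m: "r l \<in> blk Q l" unfolding r_def using blk_in(2)[OF Q(1) l] by (rule someI)
    then show rL: "r l \<in> L" using block_lines[OF Q(1) blk_in(1)[OF Q(1) l]] by blast
    have "blk Q (r l) = blk Q l" using blk_eq[OF Q(1) blk_in(1)[OF Q(1) l] m] .
    then show "par (a (r l)) (a l)" using Q(2)[OF rL l] \<kappa>[OF rL l] by simp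
  qed
  have "normals Q (\<lambda>l. a (r l)) \<gamma>"
    unfolding normals_def
  proof (intro conjI ballI)
    fix l assume l: "l \<in> L"
    show "a (r l) \<noteq> (\<lambda>_. 0)" using a r(1)[OF l] by blast
    show "dotp (a (r l)) (\<gamma> e) = 0" if "e \<in> l" for e
      using par_dotp[OF par_sym[OF r(2)[OF l]]] a[OF l] that by blast
    fix l' assume l': "l' \<in> L"
    show "if blk Q l = blk Q l' then a (r l) = a (r l') else \<not> par (a (r l)) (a (r l'))"
    proof (cases "blk Q l = blk Q l'")
      case True
      then show ?thesis by (simp add: r_def)
    next
      case False
      have "par (a l) (a l')" if p: "par (a (r l)) (a (r l'))"
      proof -
        have "par (a l) (a (r l'))"
          using par_trans[OF par_sym[OF r(2)[OF l]] p] a r(1)[OF l] by blast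
        then show ?thesis using par_trans[OF _ r(2)[OF l']] a r(1)[OF l'] by blast
      qed
      then show ?thesis using False Q(2)[OF l l'] \<kappa>[OF l l'] by auto
    qed
  qed
  then show ?thesis using Q(1) by (auto simp: X_def)
qed

section \<open>Enlarging strata by moving a line or splitting a block\<close>

definition crossing :: "'d set set set \<Rightarrow> 'd set" where
  "crossing Q = {e. \<exists>l\<in>L. \<exists>l'\<in>L. e \<in> l \<and> e \<in> l' \<and> blk Q l \<noteq> blk Q l'}"

text \<open>The hyperplane of \<open>B\<close> contains the points of \<open>l\<close>, so
  \<open>l\<close> may use it in place of its own. The number of blocks may stay the same under this
  move, so progress is measured by the points on lines of different blocks.\<close>

lemma absorb_line:
  assumes Q: "partition_on L Q" and B: "B \<in> Q" and l: "l \<in> L" "l \<subseteq> \<Union>B" "l \<notin> B"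
  shows "\<exists>Q'. partition_on L Q' \<and> X Q \<subseteq> X Q' \<and> card (crossing Q') < card (crossing Q)"
proof -
  define \<kappa> where "\<kappa> = (\<lambda>m. if m = l then B else blk Q m)"
  obtain Q' where Q': "partition_on L Q'"
    "\<And>m m'. m \<in> L \<Longrightarrow> m' \<in> L \<Longrightarrow> blk Q' m = blk Q' m' \<longleftrightarrow> \<kappa> m = \<kappa> m'"
    using kernel_partition[of \<kappa>] by blast
  have \<kappa>Q: "\<kappa> m \<in> Q" "m \<subseteq> \<Union>(\<kappa> m)" if "m \<in> L" for m
    using blk_in[OF Q that] B l(2) by (auto simp: \<kappa>_def)
  have "\<gamma> \<in> X Q'" if "\<gamma> \<in> X Q" for \<gamma>
  proof -
    obtain a where a: "normals Q a \<gamma>" using \<open>\<gamma> \<in> X Q\<close> by (auto simp: X_def)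
    define r where "r = (\<lambda>B. SOME m :: 'd set. m \<in> B)"
    have r: "r C \<in> C" if "C \<in> Q" for C
      unfolding r_def using block_nonempty[OF Q that] by (rule someI_ex)
    have "normals Q' (\<lambda>m. a (r (\<kappa> m))) \<gamma>"
      unfolding normals_def
    proof (intro conjI ballI)
      fix m assume m: "m \<in> L"
      note rm = r[OF \<kappa>Q(1)[OF m]] and rL = block_lines[OF Q \<kappa>Q(1)[OF m] r[OF \<kappa>Q(1)[OF m]]]
      show "a (r (\<kappa> m)) \<noteq> (\<lambda>_. 0)" using normalsD(1)[OF a rL] .
      show "dotp (a (r (\<kappa> m))) (\<gamma> e) = 0" if "e \<in> m" for e
        using normals_block[OF Q a \<kappa>Q(1)[OF m] rm] \<kappa>Q(2)[OF m] that by blast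
      fix m' assume m': "m' \<in> L"
      note rm' = r[OF \<kappa>Q(1)[OF m']] and rL' = block_lines[OF Q \<kappa>Q(1)[OF m'] r[OF \<kappa>Q(1)[OF m']]]
      have "blk Q (r (\<kappa> m)) = \<kappa> m" "blk Q (r (\<kappa> m')) = \<kappa> m'"
        using blk_eq[OF Q \<kappa>Q(1)[OF m] rm] blk_eq[OF Q \<kappa>Q(1)[OF m'] rm'] by auto
      then show "if blk Q' m = blk Q' m' then a (r (\<kappa> m)) = a (r (\<kappa> m'))
          else \<not> par (a (r (\<kappa> m))) (a (r (\<kappa> m')))"
        using normalsD(4)[OF a rL rL'] Q'(2)[OF m m'] by auto
    qed
    then show ?thesis by (auto simp: X_def)
  qed
  moreover have "crossing Q' \<subset> crossing Q"
  proof -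
    \<comment> \<open>Each point of \<open>l\<close> is also on a line of \<open>B\<close>, so by
      tameness every line through it now belongs to \<open>B\<close>, and the point stops being a
      crossing.\<close>
    have through: "\<kappa> m = B" if e: "e \<in> l" "e \<in> m" "m \<in> L" for e m
    proof (cases "m = l")
      case False
      obtain k where k: "k \<in> B" "e \<in> k" using e l(2) by blast
      have "k \<in> L" "k \<noteq> l" using block_lines[OF Q B k(1)] k(1) l(3) by auto
      then have "m = k" using line_tame[of l k m e] e k l(1) False by auto
      then show ?thesis using False blk_eq[OF Q B k(1)] by (simp add: \<kappa>_def)
    qed (simp add: \<kappa>_def)
    have "e \<in> crossing Q \<and> e \<notin> l" if "e \<in> crossing Q'" for e
    proof -
      obtain m m' where m: "m \<in> L" "m' \<in> L" "e \<in> m" "e \<in> m'" "blk Q' m \<noteq> blk Q' m'"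
        using \<open>e \<in> crossing Q'\<close> by (auto simp: crossing_def)
      then have ne: "\<kappa> m \<noteq> \<kappa> m'" using Q'(2) by blast
      then have "e \<notin> l" using through[of e m] through[of e m'] m by auto
      moreover from this have "m \<noteq> l" "m' \<noteq> l" using m by auto
      then have "blk Q m \<noteq> blk Q m'" using ne by (simp add: \<kappa>_def)
      ultimately show ?thesis using m unfolding crossing_def by blast
    qed
    moreover obtain x where x: "x \<in> l" using line_nonempty[OF l(1)] by auto
    moreover have "x \<in> crossing Q"
    proof -
      obtain k where k: "k \<in> B" "x \<in> k" using x l(2) by blast
      have "blk Q k = B" "blk Q l \<noteq> B" using blk_eq[OF Q B k(1)] blk_in(2)[OF Q l(1)] l(3) by auto
      then show ?thesis using k x l(1) block_lines[OF Q B k(1)] unfolding crossing_def by blast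
    qed
    ultimately show ?thesis by blast
  qed
  then have "card (crossing Q') < card (crossing Q)" by (intro psubset_card_mono) auto
  ultimately show ?thesis using Q'(1) by blast
qed

lemma zariski_closed_block_dependent:
  "zariski_closed {\<gamma> :: 'd \<Rightarrow> 'n \<Rightarrow> complex. \<forall>S. S \<subseteq> E \<longrightarrow> card S = CARD('n) \<longrightarrow> lin_dep_fam \<gamma> S}"
proof -
  have "{\<gamma> :: 'd \<Rightarrow> 'n \<Rightarrow> complex. \<forall>S. S \<subseteq> E \<longrightarrow> card S = CARD('n) \<longrightarrow> lin_dep_fam \<gamma> S}
    = circuit_variety (\<lambda>S. S \<subseteq> E \<and> card S = CARD('n))" by (auto simp: circuit_variety_def)
  then show ?thesis by (simp add: zariski_closed_circuit_variety)
qed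

lemma MQ_dep_block:
  assumes "B \<in> Q" "S \<subseteq> \<Union>B" "card S = CARD('n)"
  shows "MQ_dep M Q S"
proof -
  have "S \<inter> \<Union>B = S" using assms(2) by auto
  then show ?thesis using assms unfolding MQ_dep_iff by (metis order_refl)
qed

text \<open>The closure may lose the distinctness of hyperplanes, but a hyperplane through each
  block survives, since it amounts to dependence of \<open>CARD('n)\<close>-subsets.\<close>

lemma Y_block_normal:
  assumes "partition_on L Q" "B \<in> Q" "\<gamma> \<in> Y Q"
  obtains d where "d \<noteq> (\<lambda>_. 0)" "\<And>e. e \<in> \<Union>B \<Longrightarrow> dotp d (\<gamma> e) = 0"
proof -
  have "Y Q \<subseteq> {\<gamma>. \<forall>S. S \<subseteq> \<Union>B \<longrightarrow> card S = CARD('n) \<longrightarrow> lin_dep_fam \<gamma> S}"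
    using X_dependent[OF assms(1)] MQ_dep_block[OF assms(2)]
    by (intro Y_subset[OF _ zariski_closed_block_dependent]) auto
  then have "\<And>S. S \<subseteq> \<Union>B \<Longrightarrow> card S = CARD('n) \<Longrightarrow> lin_dep_fam \<gamma> S" using assms(3) by auto
  then show thesis using subsets_dependent_imp_normal[of "\<Union>B" \<gamma>] that by blast
qed

text \<open>Lift the points of the block off the common hyperplane and scale the lift by \<open>t\<close>: the
  normals \<open>a + t (b l - a)\<close> of the lifted lines are polynomial in \<open>t\<close> and are split for
  \<open>t \<noteq> 0\<close>. A point that also lies on a line outside the block is
  instead moved along the intersection of the two hyperplanes.\<close>

lemma liftable_block_splits_at_point:
  assumes Q: "partition_on L Q" and B: "B \<in> Q"
    and lift: "liftable TYPE('n) (\<Union>B) (upper_paving_dep (mrank M) B)"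
    and \<gamma>: "\<gamma> \<in> X Q"
    and T: "\<And>l. l \<in> B \<Longrightarrow> T l \<subseteq> l \<and> card (T l) = CARD('n) - 1 \<and> \<not> lin_dep_fam \<gamma> (T l)"
  shows "\<exists>Q'. partition_on L Q' \<and> \<gamma> \<in> Y Q' \<and> \<not> Y Q' \<subseteq> Y Q"
proof -
  obtain a where a: "normals Q a \<gamma>" using \<gamma> by (auto simp: X_def)
  obtain l0 where l0: "l0 \<in> B" using block_nonempty[OF Q B] by blast
  have BL: "l \<in> L" "blk Q l = B" if "l \<in> B" for l
    using that block_lines[OF Q B] blk_eq[OF Q B] by auto
  have notB: "blk Q l \<noteq> B" if "l \<in> L" "l \<notin> B" for l using blk_in(2)[OF Q that(1)] that(2) by auto
  define aB where "aB = a l0"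
  have aB: "a l = aB" if "l \<in> B" for l
    unfolding aB_def using normalsD(3)[OF a BL(1)[OF that] BL(1)[OF l0]] BL(2)[OF that] BL(2)[OF l0]
    by simp
  have aB0: "aB \<noteq> (\<lambda>_. 0)" unfolding aB_def using normalsD(1)[OF a BL(1)[OF l0]] .
  have aB\<gamma>: "dotp aB (\<gamma> e) = 0" if "e \<in> \<Union>B" for e
    unfolding aB_def using normals_block[OF Q a B l0 that] .
  have unique: "par aB d" if "l \<in> B" "\<And>e. e \<in> l \<Longrightarrow> dotp d (\<gamma> e) = 0" for l d
  proof (rule normal_unique[of \<gamma> "T l"])
    show "\<not> lin_dep_fam \<gamma> (T l)" "card (T l) = CARD('n) - 1" using T[OF that(1)] by auto
    show "dotp aB (\<gamma> s) = 0" "dotp d (\<gamma> s) = 0" if "s \<in> T l" for s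
      using T[OF \<open>l \<in> B\<close>] \<open>s \<in> T l\<close> \<open>l \<in> B\<close> aB\<gamma>[of s] \<open>\<And>e. e \<in> l \<Longrightarrow> dotp d (\<gamma> e) = 0\<close> by blast+
  qed
  obtain q where q: "dotp aB q = 1" using nonzero_dual[OF aB0] .
  define H where "H = {x. dotp aB x = 0}"
  have hyp: "lin_hyperplane H" unfolding lin_hyperplane_def H_def dotp_def using aB0 by auto
  \<comment> \<open>Liftability concerns families spanning the hyperplane. Any functional vanishing
    on the block is proportional to \<open>aB\<close>, since one line already determines its
    hyperplane.\<close>
  have span: "fam_span (\<Union>B) \<gamma> = H"
  proof
    show "fam_span (\<Union>B) \<gamma> \<subseteq> H" using aB\<gamma> by (auto simp: fam_span_def H_def)
    show "H \<subseteq> fam_span (\<Union>B) \<gamma>"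
    proof
      fix x assume x: "x \<in> H"
      from span_or_separated[OF finite, where T = "\<Union>B" and x = x and \<gamma> = \<gamma>] show "x \<in> fam_span (\<Union>B) \<gamma>"
      proof (elim disjE exE conjE)
        fix f assume f: "\<forall>t\<in>\<Union>B. dotp f (\<gamma> t) = 0" "dotp f x \<noteq> 0"
        have "par aB f" using unique[OF l0] f(1) l0 by blast
        then show ?thesis using par_dotp[of aB f x] aB0 x f(2) by (simp add: H_def)
      qed (auto simp: fam_span_def)
    qed
  qed
  have "q \<notin> H" using q by (simp add: H_def)
  from lift[unfolded liftable_def, rule_format, OF hyp span this]
  obtain z where z: "\<forall>S. S \<subseteq> \<Union>B \<longrightarrow> upper_paving_dep (mrank M) B S \<longrightarrow>
        lin_dep_fam (\<lambda>e j. \<gamma> e j + z e * q j) S"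
    and nondeg: "\<not> (\<exists>H'. lin_hyperplane H' \<and> (\<forall>e\<in>\<Union>B. (\<lambda>j. \<gamma> e j + z e * q j) \<in> H'))"
    by (elim exE conjE)
  have "\<exists>b. dotp b q = 1 \<and> (\<forall>e\<in>l. dotp b (\<gamma> e) + z e = 0)" if l: "l \<in> B" for l
  proof -
    have "lin_dep_fam (\<lambda>e j. \<gamma> e j + z e * q j) S" if "S \<subseteq> l" "card S = CARD('n)" for S
    proof (rule z[rule_format])
      show "S \<subseteq> \<Union>B" using that l by auto
      show "upper_paving_dep (mrank M) B S"
        unfolding upper_paving_dep_def upper_paving_circuit_def rank using that l by blast
    qed
    then obtain b where b: "b \<noteq> (\<lambda>_. 0)" "\<And>e. e \<in> l \<Longrightarrow> dotp b (\<lambda>j. \<gamma> e j + z e * q j) = 0"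
      using subsets_dependent_imp_normal[of l "\<lambda>e j. \<gamma> e j + z e * q j"] by blast
    \<comment> \<open>A lifted hyperplane through \<open>q\<close> would also contain the unlifted
      line, hence be the kernel of \<open>aB\<close>, which misses \<open>q\<close>.\<close>
    have bq: "dotp b q \<noteq> 0"
    proof
      assume "dotp b q = 0"
      then have "par aB b" using unique[OF l, of b] b(2) by simp
      then show False using par_dotp[OF par_sym b(1) \<open>dotp b q = 0\<close>] q by simp
    qed
    show ?thesis
      by (intro exI[of _ "\<lambda>j. b j / dotp b q"]) (use bq b(2) in \<open>auto simp: field_simps\<close>)
  qed
  then obtain b where b: "\<And>l. l \<in> B \<Longrightarrow> dotp (b l) q = 1"
    "\<And>l e. l \<in> B \<Longrightarrow> e \<in> l \<Longrightarrow> dotp (b l) (\<gamma> e) + z e = 0" by metis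
  have "\<exists>l1\<in>B. \<exists>l2\<in>B. b l1 \<noteq> b l2"
  proof (rule ccontr)
    assume "\<not> ?thesis"
    then have eq: "b l = b l0" if "l \<in> B" for l using that l0 by blast
    let ?H = "{x. dotp (b l0) x = 0}"
    have "b l0 \<noteq> (\<lambda>_. 0)" using b(1)[OF l0] by auto
    then have "lin_hyperplane ?H" unfolding lin_hyperplane_def dotp_def by auto
    moreover have "(\<lambda>j. \<gamma> e j + z e * q j) \<in> ?H" if e: "e \<in> \<Union>B" for e
    proof -
      obtain l where "l \<in> B" "e \<in> l" using e by auto
      then show ?thesis using b(2)[of l e] b(1)[OF l0] eq by simp
    qed
    ultimately have "lin_hyperplane ?H \<and> (\<forall>e\<in>\<Union>B. (\<lambda>j. \<gamma> e j + z e * q j) \<in> ?H)" by simp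
    then have "\<exists>H'. lin_hyperplane H' \<and> (\<forall>e\<in>\<Union>B. (\<lambda>j. \<gamma> e j + z e * q j) \<in> H')"
      by (rule exI[of _ ?H])
    then show False using nondeg by (rule notE[rotated])
  qed
  then obtain l1 l2 where l12: "l1 \<in> B" "l2 \<in> B" "b l1 \<noteq> b l2" by blast
  \<comment> \<open>For a line of the block this is the old normal at \<open>t = 0\<close> and the
    normal of the lifted line at \<open>t = 1\<close>; its value at \<open>q\<close> is always
    1.\<close>
  define A where "A = (\<lambda>t l j. if l \<in> B then aB j + t * (b l j - aB j) else a l j)"
  have Avc: "vcurve (\<lambda>t. A t l)" for l
  proof (cases "l \<in> B")
    case True
    have "vcurve (\<lambda>t j. aB j + t * (b l j - aB j))" by (intro vcurve_intros polynomial_intros)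
    then show ?thesis using True by (simp add: A_def)
  qed (simp add: A_def vcurve_intros)
  have A0: "A 0 l = a l" for l using aB[of l] by (auto simp: A_def)
  have AB: "A t l = (\<lambda>j. aB j + t * (b l j - aB j))" if "l \<in> B" for t l using that by (auto simp: A_def)
  have AnB: "A t l = a l" if "l \<notin> B" for t l using that by (auto simp: A_def)
  \<comment> \<open>All blocks are kept except \<open>B\<close>, which is divided according to the
    lifted hyperplanes.\<close>
  define \<kappa> where "\<kappa> = (\<lambda>l. (blk Q l, if l \<in> B then b l else (\<lambda>_. 0)))"
  obtain Q' where Q': "partition_on L Q'"
    "\<And>l l'. l \<in> L \<Longrightarrow> l' \<in> L \<Longrightarrow> blk Q' l = blk Q' l' \<longleftrightarrow> \<kappa> l = \<kappa> l'"
    using kernel_partition[of \<kappa>] by blast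
  have "\<exists>c. vcurve c \<and> c 0 = \<gamma> e \<and> (\<forall>t. \<forall>l\<in>L. e \<in> l \<longrightarrow> dotp (A t l) (c t) = 0)" for e
  proof (cases "e \<in> \<Union>B")
    case False
    then have "dotp (A t l) (\<gamma> e) = 0" if "l \<in> L" "e \<in> l" for t l
      using that normalsD(2)[OF a that(1)] AnB[of l t] by auto
    then show ?thesis by (intro exI[of _ "\<lambda>_. \<gamma> e"]) (simp add: vcurve_intros)
  next
    case True
    then obtain k where k: "k \<in> B" "e \<in> k" by auto
    show ?thesis
    proof (cases "\<exists>l\<in>L. e \<in> l \<and> l \<notin> B")
      case False
      let ?c = "\<lambda>t j. \<gamma> e j + (t * z e) * q j"
      have "vcurve ?c" by (intro vcurve_intros polynomial_intros)
      moreover have "dotp (A t l) (?c t) = 0" if "l \<in> L" "e \<in> l" for t l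
      proof -
        have "l \<in> B" using False that by blast
        then have "dotp (A t l) (?c t) = t * (dotp (b l) (\<gamma> e) + z e)"
          using aB\<gamma>[OF True] q b(1)[of l] unfolding AB[OF \<open>l \<in> B\<close>] by (simp add: algebra_simps)
        then show ?thesis using b(2)[OF \<open>l \<in> B\<close> that(2)] by simp
      qed
      ultimately show ?thesis by (intro exI[of _ ?c]) auto
    next
      case True
      then obtain m where m: "m \<in> L" "e \<in> m" "m \<notin> B" by auto
      have km: "l = k \<or> l = m" if "l \<in> L" "e \<in> l" for l
        using line_tame[of k m l e] BL(1)[OF k(1)] k m that by auto
      have np: "\<not> par (a k) (a m)" "\<not> par (a m) (a k)"
        using normalsD(4)[OF a BL(1)[OF k(1)] m(1)] BL(2)[OF k(1)] notB[OF m(1,3)] par_sym by blast+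
      obtain c where "vcurve c" "c 0 = \<gamma> e" "\<And>t l. l \<in> L \<Longrightarrow> e \<in> l \<Longrightarrow> dotp (A t l) (c t) = 0"
      proof (rule orthogonal_curve[of e A 0 "\<gamma> e"])
        show "A 0 l \<noteq> (\<lambda>_. 0)" "e \<in> l \<Longrightarrow> dotp (A 0 l) (\<gamma> e) = 0" if "l \<in> L" for l
          using normalsD(1,2)[OF a that] unfolding A0 by auto
        show "(\<forall>t. A t l = A t l') \<or> \<not> par (A 0 l) (A 0 l')"
          if "l \<in> L" "e \<in> l" "l' \<in> L" "e \<in> l'" for l l'
          using km[OF that(1,2)] km[OF that(3,4)] np unfolding A0 by auto
      qed (use Avc in auto)
      then show ?thesis by blast
    qed
  qed
  then obtain c where c: "\<And>e. vcurve (c e)" "\<And>e. c e 0 = \<gamma> e"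
    "\<And>e t l. l \<in> L \<Longrightarrow> e \<in> l \<Longrightarrow> dotp (A t l) (c e t) = 0" by metis
  define C where "C = (\<lambda>t e. c e t)"
  have Cvc: "vcurve (\<lambda>t. C t e)" for e using c(1) by (simp add: C_def)
  have C0: "C 0 = \<gamma>" using c(2) by (auto simp: C_def)
  have finX: "finite {t. C t \<notin> X Q'}"
  proof (rule curve_in_X)
    show "\<exists>s. A s l \<noteq> (\<lambda>_. 0)" if "l \<in> L" for l
      using normalsD(1)[OF a that] A0 by metis
    show "A t l = A t l'" if l: "l \<in> L" "l' \<in> L" and eq: "blk Q' l = blk Q' l'" for l l' t
    proof -
      have k: "blk Q l = blk Q l'"
        "(if l \<in> B then b l else (\<lambda>_. 0)) = (if l' \<in> B then b l' else (\<lambda>_. 0))"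
        using Q'(2)[OF l] eq by (auto simp: \<kappa>_def)
      show ?thesis
      proof (cases "l \<in> B")
        case True
        then have "l' \<in> B" using k(1) BL(2)[OF True] notB[OF l(2)] by auto
        then show ?thesis using True k(2) by (simp add: AB)
      next
        case False
        then have "l' \<notin> B" using k(1) BL(2)[of l'] notB[OF l(1)] by auto
        then show ?thesis using False normalsD(3)[OF a l k(1)] by (simp add: AnB)
      qed
    qed
    show "\<exists>s. \<not> par (A s l) (A s l')" if l: "l \<in> L" "l' \<in> L" and ne: "blk Q' l \<noteq> blk Q' l'" for l l'
    proof (cases "blk Q l = blk Q l'")
      case False
      then show ?thesis using normalsD(4)[OF a l] A0 by metis
    next
      case True
      then have "(if l \<in> B then b l else (\<lambda>_. 0)) \<noteq> (if l' \<in> B then b l' else (\<lambda>_. 0))"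
        using Q'(2)[OF l] ne by (auto simp: \<kappa>_def)
      moreover have "l \<in> B \<longleftrightarrow> l' \<in> B" using True BL(2) notB[OF l(1)] notB[OF l(2)] by metis
      ultimately have lB: "l \<in> B" "l' \<in> B" "b l \<noteq> b l'" by (auto split: if_splits)
      have "A 1 l = b l" "A 1 l' = b l'" using lB by (simp_all add: AB)
      then have "\<not> par (A 1 l) (A 1 l')" using par_eq_of_dotp[of "b l" "b l'" q] b(1) lB by auto
      then show ?thesis by blast
    qed
  qed (use Avc c(3) in \<open>auto simp: C_def\<close>)
  have "\<gamma> \<in> Y Q'"
  proof -
    have "finite {t. C t \<notin> Y Q'}" by (rule rev_finite_subset[OF finX]) (use X_subset_Y in auto)
    then have "C 0 \<in> Y Q'" using curve_limit_in_closed[OF Y_closed, of C Q' 0] Cvc by blast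
    then show ?thesis by (simp add: C0)
  qed
  moreover have "\<not> Y Q' \<subseteq> Y Q"
  proof
    assume sub: "Y Q' \<subseteq> Y Q"
    have fin: "finite {t. C t \<in> {\<gamma>. lin_dep_fam \<gamma> (T l)}}" if "l \<in> B" for l
      by (rule curve_finite_in_closed[of _ _ 0]) (use zariski_closed_lin_dep Cvc C0 T[OF that] in auto)
    \<comment> \<open>At a parameter outside this set the lines \<open>l1\<close> and
      \<open>l2\<close> determine their hyperplanes. Membership in \<open>Y Q\<close> would force a
      common one, although \<open>b l1\<close> and \<open>b l2\<close> differ and \<open>t\<close>
      is nonzero.\<close>
    let ?bad = "{0} \<union> {t. C t \<notin> X Q'} \<union> {t. C t \<in> {\<gamma>. lin_dep_fam \<gamma> (T l1)}}
      \<union> {t. C t \<in> {\<gamma>. lin_dep_fam \<gamma> (T l2)}}"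
    have "finite ?bad" using finX fin[OF l12(1)] fin[OF l12(2)] by blast
    from ex_new_if_finite[OF infinite_UNIV_char_0[where 'a=complex] this]
    obtain t where "t \<notin> ?bad" by (elim exE)
    then have t: "t \<noteq> 0" "C t \<in> X Q'" "\<not> lin_dep_fam (C t) (T l1)" "\<not> lin_dep_fam (C t) (T l2)"
      by simp_all
    then have "C t \<in> Y Q" using sub X_subset_Y by blast
    then obtain d where d: "d \<noteq> (\<lambda>_. 0)" "\<And>e. e \<in> \<Union>B \<Longrightarrow> dotp d (C t e) = 0"
      using Y_block_normal[OF Q B] by blast
    have p: "par (A t l) d" if "l \<in> B" "\<not> lin_dep_fam (C t) (T l)" for l
    proof (rule normal_unique[of "C t" "T l"])
      show "dotp (A t l) (C t s) = 0" "dotp d (C t s) = 0" if "s \<in> T l" for s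
      proof -
        have "s \<in> l" using T[OF \<open>l \<in> B\<close>] \<open>s \<in> T l\<close> by blast
        then show "dotp (A t l) (C t s) = 0" "dotp d (C t s) = 0"
          using c(3)[OF BL(1)[OF \<open>l \<in> B\<close>]] d(2)[of s] \<open>l \<in> B\<close> by (auto simp: C_def)
      qed
    qed (use that T in auto)
    have "par (A t l1) (A t l2)"
      using par_trans[OF p[OF l12(1) t(3)] par_sym[OF p[OF l12(2) t(4)]] d(1)] .
    moreover have "dotp (A t l) q = 1" if "l \<in> B" for l using b(1)[OF that] q by (simp add: AB[OF that])
    ultimately have eq: "A t l1 = A t l2" using l12 par_eq_of_dotp by blast
    have "b l1 j = b l2 j" for j
      using fun_cong[OF eq, of j] t(1) l12(1,2) by (simp add: AB)
    then show False using l12(3) by auto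
  qed
  ultimately show ?thesis using Q'(1) by blast
qed

text \<open>The partition produced at a point depends on that point. There are finitely many
  partitions, so irreducibility of \<open>X Q\<close> makes one of them work for all points.\<close>

lemma liftable_block_splits:
  assumes Q: "partition_on L Q" "separated Q" and B: "B \<in> Q"
    and lift: "liftable TYPE('n) (\<Union>B) (upper_paving_dep (mrank M) B)"
  shows "\<exists>Q'. partition_on L Q' \<and> Y Q \<subseteq> Y Q' \<and> \<not> Y Q' \<subseteq> Y Q"
proof -
  have "\<exists>S\<subseteq>l. card S = CARD('n) - 1 \<and> \<not> MQ_dep M Q S" if "l \<in> B" for l
    using transversal_subset[OF Q B that] transversal_independent[OF B] by metis
  then obtain T where T: "\<And>l. l \<in> B \<Longrightarrow> T l \<subseteq> l \<and> card (T l) = CARD('n) - 1 \<and> \<not> MQ_dep M Q (T l)"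
    by metis
  let ?F = "{Q'. partition_on L Q' \<and> \<not> Y Q' \<subseteq> Y Q}"
  have irr: "zariski_irreducible (X Q)" using X_irreducible X_nonempty[OF Q] by blast
  have "X Q \<subseteq> (\<Union>Q'\<in>?F. Y Q')"
  proof (rule irreducible_dense[OF irr, of _ B "\<lambda>l. {\<gamma>. lin_dep_fam \<gamma> (T l)}"])
    show "zariski_closed (\<Union>Q'\<in>?F. Y Q')" by (intro zariski_closed_UN Y_closed) auto
    show "\<not> X Q \<subseteq> {\<gamma>. lin_dep_fam \<gamma> (T l)}" if "l \<in> B" for l
      using independent_realized_in_X[OF Q] T[OF that] by blast
    show "\<gamma> \<in> (\<Union>Q'\<in>?F. Y Q')" if "\<gamma> \<in> X Q" "\<And>l. l \<in> B \<Longrightarrow> \<gamma> \<notin> {\<gamma>. lin_dep_fam \<gamma> (T l)}" for \<gamma>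
    proof -
      have "\<exists>Q'. partition_on L Q' \<and> \<gamma> \<in> Y Q' \<and> \<not> Y Q' \<subseteq> Y Q"
      proof (rule liftable_block_splits_at_point[OF Q(1) B lift that(1)])
        show "T l \<subseteq> l \<and> card (T l) = CARD('n) - 1 \<and> \<not> lin_dep_fam \<gamma> (T l)" if "l \<in> B" for l
          using T[OF that] \<open>\<And>l. l \<in> B \<Longrightarrow> \<gamma> \<notin> {\<gamma>. lin_dep_fam \<gamma> (T l)}\<close>[OF that] by simp
      qed
      then show ?thesis by blast
    qed
  qed (auto simp: zariski_closed_lin_dep)
  then have "\<exists>Q'\<in>?F. X Q \<subseteq> Y Q'"
    by (intro zariski_irreducible_UN[OF irr]) (auto simp: Y_closed)
  then show ?thesis using Y_subset Y_closed by blast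
qed

lemma nice_partition_iff:
  "nice_partition TYPE('n) M Q \<longleftrightarrow> partition_on L Q \<and> separated Q \<and>
    (\<forall>B\<in>Q. card B \<ge> 2 \<longrightarrow> \<not> liftable TYPE('n) (\<Union>B) (upper_paving_dep (mrank M) B))"
  unfolding nice_partition_def separated_def dep_hyperplanes_def by blast

text \<open>Among the partitions with \<open>\<gamma> \<in> Y Q\<close>, maximise \<open>Y Q\<close> first and then minimise the
  number of points lying on lines of different blocks.\<close>

lemma nice_partition_exists:
  assumes "\<gamma> \<in> (circuit_variety (\<lambda>S. S \<notin> M) :: ('d \<Rightarrow> 'n \<Rightarrow> complex) set)"
  shows "\<exists>Q. nice_partition TYPE('n) M Q \<and> \<gamma> \<in> Y Q"
proof -
  let ?S = "{Q. partition_on L Q \<and> \<gamma> \<in> Y Q}"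
  have "?S \<noteq> {}" using circuit_variety_covered[OF assms] X_subset_Y by blast
  then obtain Z where Z: "Z \<in> Y ` ?S" "\<And>W. W \<in> Y ` ?S \<Longrightarrow> Z \<subseteq> W \<Longrightarrow> Z = W"
    using finite_has_maximal[of "Y ` ?S"] by auto
  then obtain Q0 where Q0: "Q0 \<in> ?S" "Y Q0 = Z" by auto
  define P where "P = (\<lambda>Q. Q \<in> ?S \<and> Y Q = Z)"
  obtain Q where "P Q" and least: "\<And>Q'. P Q' \<Longrightarrow> card (crossing Q) \<le> card (crossing Q')"
    using ex_has_least_nat[of P Q0 "\<lambda>Q. card (crossing Q)"] Q0 unfolding P_def by blast
  then have Q: "partition_on L Q" "\<gamma> \<in> Y Q" "Y Q = Z" by (auto simp: P_def)
  have max: "P Q'" if "partition_on L Q'" "Y Q \<subseteq> Y Q'" for Q'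
    using that Q Z(2)[of "Y Q'"] unfolding P_def by auto
  have "separated Q"
    unfolding separated_def
  proof (intro ballI impI, rule ccontr)
    fix B l assume Bl: "B \<in> Q" "l \<in> L" "l \<subseteq> \<Union>B" "l \<notin> B"
    obtain Q' where Q': "partition_on L Q'" "X Q \<subseteq> X Q'" "card (crossing Q') < card (crossing Q)"
      using absorb_line[OF Q(1) Bl] by blast
    have "Y Q \<subseteq> Y Q'" using Q'(2) X_subset_Y[of Q'] Y_closed by (intro Y_subset) auto
    then show False using least[OF max[OF Q'(1)]] Q'(3) by simp
  qed
  moreover have "\<not> liftable TYPE('n) (\<Union>B) (upper_paving_dep (mrank M) B)" if "B \<in> Q" for B
  proof
    assume "liftable TYPE('n) (\<Union>B) (upper_paving_dep (mrank M) B)"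
    then obtain Q' where "partition_on L Q'" "Y Q \<subseteq> Y Q'" "\<not> Y Q' \<subseteq> Y Q"
      using liftable_block_splits[OF Q(1) \<open>separated Q\<close> \<open>B \<in> Q\<close>] by blast
    then show False using max[of Q'] Q(3) by (auto simp: P_def)
  qed
  ultimately show ?thesis using Q nice_partition_iff by blast
qed

section \<open>Irredundancy\<close>

text \<open>A lifting in direction \<open>q\<close> gives each line a linear height function, and
  these agree at common points. Vanishing at \<open>q\<close> makes \<open>f l\<close> a functional
  on the hyperplane; the condition at \<open>l0\<close> removes liftings by one global functional.
  The hyperplane itself does not occur, so the condition also makes sense when the lines of
  \<open>B\<close> lie in different hyperplanes.\<close>

definition coherent :: "'d set set \<Rightarrow> ('n \<Rightarrow> complex) \<Rightarrow> ('d \<Rightarrow> 'n \<Rightarrow> complex) \<Rightarrow> 'd set \<Rightarrow>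
    ('d set \<Rightarrow> 'n \<Rightarrow> complex) \<Rightarrow> bool" where
  "coherent B q \<gamma> l0 f \<longleftrightarrow> f l0 = (\<lambda>_. 0) \<and> (\<forall>l\<in>B. dotp (f l) q = 0) \<and>
    (\<forall>l\<in>B. \<forall>l'\<in>B. \<forall>e\<in>l \<inter> l'. dotp (f l) (\<gamma> e) = dotp (f l') (\<gamma> e))"

definition rigid :: "'d set set \<Rightarrow> ('n \<Rightarrow> complex) \<Rightarrow> ('d \<Rightarrow> 'n \<Rightarrow> complex) \<Rightarrow> 'd set \<Rightarrow> bool" where
  "rigid B q \<gamma> l0 \<longleftrightarrow> (\<forall>f. coherent B q \<gamma> l0 f \<longrightarrow> (\<forall>l\<in>B. f l = (\<lambda>_. 0)))"

lemma coherentI: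
  "\<lbrakk>f l0 = (\<lambda>_. 0); \<And>l. l \<in> B \<Longrightarrow> dotp (f l) q = 0;
    \<And>l l' e. l \<in> B \<Longrightarrow> l' \<in> B \<Longrightarrow> e \<in> l \<inter> l' \<Longrightarrow> dotp (f l) (\<gamma> e) = dotp (f l') (\<gamma> e)\<rbrakk>
    \<Longrightarrow> coherent B q \<gamma> l0 f"
  unfolding coherent_def by blast

lemma coherentD:
  assumes "coherent B q \<gamma> l0 f"
  shows "f l0 = (\<lambda>_. 0)" "l \<in> B \<Longrightarrow> dotp (f l) q = 0"
    "l \<in> B \<Longrightarrow> l' \<in> B \<Longrightarrow> e \<in> l \<inter> l' \<Longrightarrow> dotp (f l) (\<gamma> e) = dotp (f l') (\<gamma> e)"
  using assms unfolding coherent_def by blast+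

text \<open>The entries of all \<open>f l\<close> are the unknowns of a homogeneous linear system;
  its coefficients are polynomial in the points, \<open>q\<close> being constant.\<close>

lemma zariski_closed_not_rigid: "zariski_closed {\<gamma>. \<not> rigid B q \<gamma> l0}"
proof -
  \<comment> \<open>The unknowns at \<open>l0\<close> are always included, and \<open>fix0\<close>
    forces them to vanish, so a nonzero solution is nonzero on some line of
    \<open>B\<close>.\<close>
  let ?S = "insert l0 B \<times> (UNIV :: 'n set)"
  define fix0 where "fix0 = (\<lambda>j (p :: 'd set \<times> 'n) (\<gamma> :: 'd \<Rightarrow> 'n \<Rightarrow> complex).
    if p = (l0, j) then 1 else (0 :: complex))"
  define atq where "atq = (\<lambda>l (p :: 'd set \<times> 'n) (\<gamma> :: 'd \<Rightarrow> 'n \<Rightarrow> complex).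
    if fst p = l then q (snd p) else 0)"
  define agree where "agree = (\<lambda>l l' e (p :: 'd set \<times> 'n) (\<gamma> :: 'd \<Rightarrow> 'n \<Rightarrow> complex).
    ((if fst p = l then 1 else 0) - (if fst p = l' then 1 else 0)) * \<gamma> e (snd p))"
  let ?R = "range fix0 \<union> atq ` B \<union> {agree l l' e | l l' e. l \<in> B \<and> l' \<in> B \<and> e \<in> l \<inter> l'}"
  have slice: "(\<Sum>p\<in>?S. c p * (if fst p = l then g (snd p) else 0)) = dotp (\<lambda>j. c (l, j)) g"
    if "l \<in> insert l0 B" for c l and g :: "'n \<Rightarrow> complex"
  proof -
    have "(\<Sum>p\<in>?S. c p * (if fst p = l then g (snd p) else 0))
      = (\<Sum>m\<in>insert l0 B. \<Sum>j\<in>UNIV. c (m, j) * (if m = l then g j else 0))"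
      by (simp add: sum.cartesian_product split_def)
    also have "\<dots> = (\<Sum>m\<in>insert l0 B. if m = l then dotp (\<lambda>j. c (l, j)) g else 0)"
      by (rule sum.cong) (auto simp: dotp_def)
    finally show ?thesis using that by simp
  qed
  have s0: "(\<Sum>p\<in>?S. c p * fix0 j p \<gamma>) = c (l0, j)" for c j \<gamma>
  proof -
    have "(\<Sum>p\<in>?S. c p * fix0 j p \<gamma>) = (\<Sum>p\<in>?S. if p = (l0, j) then c p else 0)"
      unfolding fix0_def by (rule sum.cong) auto
    then show ?thesis by simp
  qed
  have s1: "(\<Sum>p\<in>?S. c p * atq l p \<gamma>) = dotp (\<lambda>j. c (l, j)) q" if "l \<in> B" for c l \<gamma>
    unfolding atq_def using slice[of l c q] that by simp
  have s2: "(\<Sum>p\<in>?S. c p * agree l l' e p \<gamma>) = dotp (\<lambda>j. c (l, j)) (\<gamma> e) - dotp (\<lambda>j. c (l', j)) (\<gamma> e)"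
    if "l \<in> B" "l' \<in> B" for c l l' e \<gamma>
  proof -
    have "(\<Sum>p\<in>?S. c p * agree l l' e p \<gamma>)
      = (\<Sum>p\<in>?S. c p * (if fst p = l then \<gamma> e (snd p) else 0))
        - (\<Sum>p\<in>?S. c p * (if fst p = l' then \<gamma> e (snd p) else 0))"
      unfolding sum_subtractf[symmetric] agree_def by (rule sum.cong) auto
    then show ?thesis using slice that by simp
  qed
  let ?K = "{\<gamma>. \<exists>c. (\<exists>p\<in>?S. c p \<noteq> 0) \<and> (\<forall>\<rho>\<in>?R. (\<Sum>p\<in>?S. c p * \<rho> p \<gamma>) = 0)}"
  have "zariski_closed ?K"
  proof (rule zariski_closed_nontrivial_kernel)
    have pf_indicator: "(\<lambda>\<gamma>. k * \<gamma> i j) \<in> polyfun" for k :: complex and i :: 'd and j :: 'n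
      by (intro pf_mult pf_const pf_coord)
    show "\<rho> p \<in> polyfun" if "\<rho> \<in> ?R" for \<rho> p
      using that pf_indicator by (auto simp: fix0_def atq_def agree_def intro: pf_const)
  qed simp
  moreover have "{\<gamma>. \<not> rigid B q \<gamma> l0} = ?K"
  proof (intro equalityI subsetI)
    fix \<gamma> :: "'d \<Rightarrow> 'n \<Rightarrow> complex" assume "\<gamma> \<in> {\<gamma>. \<not> rigid B q \<gamma> l0}"
    then obtain f l where coh: "coherent B q \<gamma> l0 f" and l: "l \<in> B" "f l \<noteq> (\<lambda>_. 0)"
      unfolding rigid_def by blast
    note f = coherentD[OF coh]
    obtain j where "f l j \<noteq> 0" using l(2) by auto
    then have nz: "\<exists>p\<in>?S. case_prod f p \<noteq> 0" using l(1) by force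
    have "(\<Sum>p\<in>?S. case_prod f p * \<rho> p \<gamma>) = 0" if \<rho>R: "\<rho> \<in> ?R" for \<rho>
    proof -
      consider j where "\<rho> = fix0 j" | m where "m \<in> B" "\<rho> = atq m"
        | m m' e where "m \<in> B" "m' \<in> B" "e \<in> m \<inter> m'" "\<rho> = agree m m' e" using \<rho>R by blast
      then show ?thesis
      proof cases
        case 1
        then show ?thesis using s0 f(1) by simp
      next
        case 2
        then show ?thesis using s1 f(2) by simp
      next
        case 3
        then show ?thesis using s2[OF 3(1,2), of "case_prod f" e \<gamma>] f(3)[OF 3(1-3)] by simp
      qed
    qed
    then show "\<gamma> \<in> ?K" by (intro CollectI exI[of _ "case_prod f"] conjI ballI nz)
  next
    fix \<gamma> assume "\<gamma> \<in> ?K"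
    then obtain c where ex: "\<exists>p\<in>?S. c p \<noteq> 0" and ker: "\<forall>\<rho>\<in>?R. (\<Sum>p\<in>?S. c p * \<rho> p \<gamma>) = 0"
      by (elim CollectE exE conjE)
    note c = ker[THEN bspec]
    obtain p where p: "p \<in> ?S" "c p \<noteq> 0" using ex by blast
    define f where "f = (\<lambda>l j. c (l, j))"
    have f0: "f l0 = (\<lambda>_. 0)"
    proof
      fix j
      show "f l0 j = 0" using c[of "fix0 j"] s0[of c j \<gamma>] by (simp add: f_def)
    qed
    have "dotp (f l) q = 0" if "l \<in> B" for l
      using c[of "atq l"] s1[OF that, of c \<gamma>] that by (simp add: f_def)
    moreover have "dotp (f l) (\<gamma> e) = dotp (f l') (\<gamma> e)" if "l \<in> B" "l' \<in> B" "e \<in> l \<inter> l'" for l l' e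
    proof -
      have "agree l l' e \<in> ?R" using that by blast
      from c[OF this] s2[OF that(1,2), of c e \<gamma>] show ?thesis by (simp add: f_def)
    qed
    ultimately have "coherent B q \<gamma> l0 f" using f0 by (intro coherentI)
    moreover have "\<exists>l\<in>B. f l \<noteq> (\<lambda>_. 0)"
    proof -
      obtain l j where lj: "p = (l, j)" "l \<in> insert l0 B" using p(1) by auto
      then have "f l \<noteq> (\<lambda>_. 0)" using p(2) by (auto simp: f_def fun_eq_iff)
      then show ?thesis using lj(2) f0 by auto
    qed
    ultimately show "\<gamma> \<in> {\<gamma>. \<not> rigid B q \<gamma> l0}" unfolding rigid_def by blast
  qed
  ultimately show ?thesis by simp
qed

section \<open>A rigid family from a non-liftable block\<close>

lemma independent_in_hyperplane:
  fixes a :: "'n \<Rightarrow> complex" and T :: "'d set"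
  assumes "a \<noteq> (\<lambda>_. 0)" "card T = CARD('n) - 1"
  obtains \<gamma> where "\<And>e. dotp a (\<gamma> e) = 0" "\<not> lin_dep_fam \<gamma> T"
proof -
  obtain k where k: "a k \<noteq> 0" using assms(1) by auto
  have "card T \<le> card (UNIV - {k})" using assms(2) by simp
  then obtain \<sigma> where \<sigma>: "\<sigma> ` T \<subseteq> UNIV - {k}" "inj_on \<sigma> T"
    using card_le_inj[of T "UNIV - {k}"] by auto
  \<comment> \<open>Part of the standard basis of the hyperplane: a unit vector corrected in the
    coordinate \<open>k\<close> so that \<open>a\<close> vanishes on it.\<close>
  define \<gamma> where "\<gamma> = (\<lambda>e. if e \<in> T
    then (\<lambda>j. (if j = \<sigma> e then 1 else 0) - (a (\<sigma> e) / a k) * (if j = k then 1 else 0)) else (\<lambda>_. 0))"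
  have "dotp a (\<gamma> e) = 0" for e
    unfolding \<gamma>_def using k
    by (cases "e \<in> T") (simp_all only: if_True if_False dotp_linear dotp_unit, simp_all)
  moreover have "\<not> lin_dep_fam \<gamma> T"
  proof
    assume "lin_dep_fam \<gamma> T"
    then obtain c i where c: "i \<in> T" "c i \<noteq> 0" "\<And>j. (\<Sum>s\<in>T. c s * \<gamma> s j) = 0"
      by (auto simp: lin_dep_fam_def)
    have "\<sigma> i \<noteq> k" using \<sigma>(1) c(1) by auto
    then have "(\<Sum>s\<in>T. c s * \<gamma> s (\<sigma> i)) = (\<Sum>s\<in>T. if s = i then c i else 0)"
      using \<sigma>(2) c(1) by (intro sum.cong) (auto simp: \<gamma>_def dest: inj_onD)
    then show False using c by simp
  qed
  ultimately show thesis by (rule that)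
qed

text \<open>The families in a hyperplane form a linear space, irreducible because segments stay
  inside, so the finitely many sets \<open>T l\<close> can be made independent together.\<close>

lemma generic_in_hyperplane:
  fixes a :: "'n \<Rightarrow> complex" and B :: "'d set set" and T :: "'d set \<Rightarrow> 'd set"
  assumes "a \<noteq> (\<lambda>_. 0)" "\<And>l. l \<in> B \<Longrightarrow> card (T l) = CARD('n) - 1"
  obtains \<eta> :: "'d \<Rightarrow> 'n \<Rightarrow> complex" where "\<And>e. dotp a (\<eta> e) = 0" "\<And>l. l \<in> B \<Longrightarrow> \<not> lin_dep_fam \<eta> (T l)"
proof -
  let ?H = "{\<gamma> :: 'd \<Rightarrow> 'n \<Rightarrow> complex. \<forall>e. dotp a (\<gamma> e) = 0}"
  have "(\<lambda>_ _. 0) \<in> ?H" by simp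
  then have ne: "?H \<noteq> {}" by (metis empty_iff)
  have irr: "zariski_irreducible ?H"
  proof (rule curve_connected_irreducible[OF ne])
    fix \<gamma> \<delta> assume "\<gamma> \<in> ?H" "\<delta> \<in> ?H"
    moreover have "vcurve (\<lambda>t j. (1 - t) * \<gamma> e j + t * \<delta> e j)" for e
      by (intro vcurve_intros polynomial_intros)
    ultimately show "\<exists>c. (\<forall>e. vcurve (\<lambda>t. c t e)) \<and> c 0 = \<gamma> \<and> c 1 = \<delta> \<and> finite {t. c t \<notin> ?H}"
      by (intro exI[of _ "\<lambda>t e j. (1 - t) * \<gamma> e j + t * \<delta> e j"]) auto
  qed
  have "\<exists>\<eta>\<in>?H. \<forall>l\<in>B. \<not> lin_dep_fam \<eta> (T l)"
  proof (rule ccontr)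
    assume no: "\<not> ?thesis"
    have "?H \<subseteq> {}"
    proof (rule irreducible_dense[OF irr, of _ B "\<lambda>l. {\<gamma>. lin_dep_fam \<gamma> (T l)}"])
      show "\<not> ?H \<subseteq> {\<gamma>. lin_dep_fam \<gamma> (T l)}" if l: "l \<in> B" for l
      proof -
        obtain \<gamma> where "\<And>e. dotp a (\<gamma> e) = 0" "\<not> lin_dep_fam \<gamma> (T l)"
          using independent_in_hyperplane[OF assms(1) assms(2)[OF l]] by blast
        then show ?thesis by blast
      qed
      show "\<eta> \<in> {}" if "\<eta> \<in> ?H" "\<And>l. l \<in> B \<Longrightarrow> \<eta> \<notin> {\<gamma>. lin_dep_fam \<gamma> (T l)}" for \<eta>
        using no that by blast
    qed (auto simp: zariski_closed_empty zariski_closed_lin_dep)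
    then show False using ne by blast
  qed
  then show thesis using that by blast
qed

text \<open>A family of functionals that agree at the common points of the lines is a lifting;
  subtracting a trivial one makes it vanish on \<open>S0\<close>.\<close>

lemma not_rigid_lifting:
  assumes l0: "l0 \<in> B" and q: "dotp a q = 1"
    and \<gamma>: "\<And>e. e \<in> \<Union>B \<Longrightarrow> dotp a (\<gamma> e) = 0"
    and T: "\<And>l. l \<in> B \<Longrightarrow> T l \<subseteq> l \<and> card (T l) = CARD('n) - 1 \<and> \<not> lin_dep_fam \<gamma> (T l)"
    and S0: "S0 \<subseteq> \<Union>B" "\<not> lin_dep_fam \<gamma> S0"
    and flex: "\<not> rigid B q \<gamma> l0"
  shows "\<exists>y :: complex^'d. norm y = 1 \<and> (\<forall>e. e \<notin> \<Union>B \<longrightarrow> y $ e = 0) \<and> (\<forall>e\<in>S0. y $ e = 0) \<and>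
    (\<forall>S. upper_paving_dep (mrank M) B S \<longrightarrow> lin_dep_fam (\<lambda>e j. \<gamma> e j + y $ e * q j) S)"
proof -
  obtain f l1 where coh: "coherent B q \<gamma> l0 f" and l1: "l1 \<in> B" "f l1 \<noteq> (\<lambda>_. 0)"
    using flex unfolding rigid_def by blast
  note f = coherentD[OF coh]
  \<comment> \<open>Coherence makes the choice of a line through \<open>e\<close>
    immaterial.\<close>
  define z where "z = (\<lambda>e. dotp (f (SOME l. l \<in> B \<and> e \<in> l)) (\<gamma> e))"
  have z: "z e = dotp (f l) (\<gamma> e)" if "l \<in> B" "e \<in> l" for l e
  proof -
    have "(SOME l. l \<in> B \<and> e \<in> l) \<in> B \<and> e \<in> (SOME l. l \<in> B \<and> e \<in> l)"
      by (rule someI[of _ l]) (use that in simp)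
    then show ?thesis unfolding z_def using f(3) that by blast
  qed
  obtain g0 where g0: "\<forall>s\<in>S0. dotp g0 (\<gamma> s) = z s" using independent_interpolation[OF S0(2)] .
  \<comment> \<open>Subtracting a multiple of \<open>a\<close> makes \<open>g\<close> vanish at
    \<open>q\<close> without changing it on the block, where \<open>a\<close> is zero.\<close>
  define g where "g = (\<lambda>j. g0 j - dotp g0 q * a j)"
  have gq: "dotp g q = 0" using q by (simp add: g_def)
  have gS: "dotp g (\<gamma> s) = z s" if "s \<in> S0" for s
    using g0 \<gamma>[of s] S0(1) that by (auto simp: g_def)
  define y0 where "y0 = (\<chi> e. if e \<in> \<Union>B then z e - dotp g (\<gamma> e) else 0)"
  have y0: "y0 $ e = dotp (f l) (\<gamma> e) - dotp g (\<gamma> e)" if "l \<in> B" "e \<in> l" for l e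
    using that z[OF that] by (auto simp: y0_def)
  \<comment> \<open>If all heights vanished, each \<open>f l - g\<close> would vanish on its line
    and be a multiple of \<open>a\<close>, hence zero by its value at \<open>q\<close>. Then every
    \<open>f l\<close> would equal \<open>f l0\<close>, against the choice of
    \<open>l1\<close>.\<close>
  have "y0 \<noteq> 0"
  proof
    assume zero: "y0 = 0"
    have fg: "f l = g" if l: "l \<in> B" for l
    proof -
      have "par a (\<lambda>j. f l j - g j)"
      proof (rule normal_unique[of \<gamma> "T l"])
        show "dotp a (\<gamma> s) = 0" "dotp (\<lambda>j. f l j - g j) (\<gamma> s) = 0" if "s \<in> T l" for s
        proof -
          have "s \<in> l" using T[OF l] that by blast
          then show "dotp a (\<gamma> s) = 0" "dotp (\<lambda>j. f l j - g j) (\<gamma> s) = 0"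
            using \<gamma>[of s] l y0[OF l] zero by auto
        qed
      qed (use T[OF l] in auto)
      moreover have "a \<noteq> (\<lambda>_. 0)" using q by auto
      ultimately obtain k where k: "(\<lambda>j. f l j - g j) = (\<lambda>j. k * a j)" using par_scale by blast
      have "dotp (\<lambda>j. f l j - g j) q = k" unfolding k using q by simp
      then have "k = 0" using f(2)[OF l] gq by simp
      then have "f l j - g j = 0" for j using fun_cong[OF k, of j] by simp
      then show ?thesis by auto
    qed
    have "f l1 = f l0" using fg[OF l1(1)] fg[OF l0] by simp
    then show False using f(1) l1(2) by simp
  qed
  \<comment> \<open>Unit norm will keep a limit of such liftings nonzero.\<close>
  define s where "s = complex_of_real (1 / norm y0)"
  define y where "y = (\<chi> e. s * y0 $ e)"
  have "y $ e = ((1 / norm y0) *\<^sub>R y0) $ e" for e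
    unfolding vector_scaleR_component y_def s_def by (simp add: scaleR_conv_of_real[where 'a=complex])
  then have "y = (1 / norm y0) *\<^sub>R y0" by (simp only: vec_eq_iff) simp
  then have "norm y = 1" using \<open>y0 \<noteq> 0\<close> by simp
  moreover have "y $ e = 0" if "e \<notin> \<Union>B" for e using that by (auto simp: y_def y0_def)
  moreover have "y $ e = 0" if "e \<in> S0" for e using gS[OF that] by (simp add: y_def y0_def)
  moreover have "lin_dep_fam (\<lambda>e j. \<gamma> e j + y $ e * q j) S" if S: "upper_paving_dep (mrank M) B S" for S
  proof -
    obtain C where C: "C \<subseteq> S" "upper_paving_circuit (CARD('n)) B C"
      using S unfolding upper_paving_dep_def rank by blast
    then consider l where "l \<in> B" "C \<subseteq> l" "card C = CARD('n)" | "card C = CARD('n) + 1"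
      unfolding upper_paving_circuit_def by blast
    then have "lin_dep_fam (\<lambda>e j. \<gamma> e j + y $ e * q j) C"
    proof cases
      case 1
      \<comment> \<open>A normal of the lifted line: its value at \<open>\<gamma> e\<close> is the
        height \<open>y $ e\<close> and at \<open>q\<close> it is -1, so the two contributions
        cancel.\<close>
      let ?b = "\<lambda>j. s * (f l j - g j) - a j"
      have "dotp ?b q = -1" using f(2)[OF 1(1)] gq q by simp
      then have "?b \<noteq> (\<lambda>_. 0)" by force
      then show ?thesis
      proof (rule lin_dep_fam_in_hyperplane)
        show "dotp ?b (\<lambda>j. \<gamma> e j + y $ e * q j) = 0" if "e \<in> C" for e
        proof -
          have el: "e \<in> l" "e \<in> \<Union>B" using that 1 by auto
          have "dotp ?b (\<gamma> e) = y $ e" using y0[OF 1(1) el(1)] \<gamma>[OF el(2)] by (simp add: y_def)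
          then show ?thesis using \<open>dotp ?b q = -1\<close> by (simp only: dotp_linear) simp
        qed
      qed (use 1 in simp)
    next
      case 2
      then show ?thesis by (intro lin_dep_fam_large) simp
    qed
    then show ?thesis using lin_dep_fam_mono C(1) by blast
  qed
  ultimately show ?thesis by blast
qed

text \<open>The family witnessing non-liftability may be degenerate on some lines. Perturb it inside
  the hyperplane: if all perturbations were flexible, their normalised liftings would
  accumulate at a non-trivial lifting of the original family.\<close>

lemma not_liftable_imp_rigid:
  assumes BL: "B \<subseteq> L" and l0: "l0 \<in> B"
    and nonlift: "\<not> liftable TYPE('n) (\<Union>B) (upper_paving_dep (mrank M) B)"
  obtains a q \<gamma> where "dotp a q = 1" "\<And>e. e \<in> \<Union>B \<Longrightarrow> dotp a (\<gamma> e) = 0" "rigid B q \<gamma> l0"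
proof -
  obtain \<gamma>0 :: "'d \<Rightarrow> 'n \<Rightarrow> complex" and H q where H: "lin_hyperplane H" "fam_span (\<Union>B) \<gamma>0 = H" "q \<notin> H"
    and nolift: "\<And>z. (\<forall>S. S \<subseteq> \<Union>B \<longrightarrow> upper_paving_dep (mrank M) B S \<longrightarrow>
        lin_dep_fam (\<lambda>e j. \<gamma>0 e j + z e * q j) S) \<Longrightarrow>
      \<exists>H'. lin_hyperplane H' \<and> (\<forall>e\<in>\<Union>B. (\<lambda>j. \<gamma>0 e j + z e * q j) \<in> H')"
    using nonlift unfolding liftable_def by blast
  obtain a0 where a0: "H = {x. dotp a0 x = 0}"
    using H(1) unfolding lin_hyperplane_def dotp_def by blast
  have a0q: "dotp a0 q \<noteq> 0" using H(3) a0 by simp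
  define a where "a = (\<lambda>j. a0 j / dotp a0 q)"
  have q: "dotp a q = 1" using a0q by (simp add: a_def)
  have Ha: "H = {x. dotp a x = 0}" using a0q by (simp add: a0 a_def)
  have anz: "a \<noteq> (\<lambda>_. 0)" using q by auto
  have \<gamma>0: "dotp a (\<gamma>0 e) = 0" if "e \<in> \<Union>B" for e
  proof -
    have "(\<Sum>e'\<in>\<Union>B. (if e' = e then 1 else 0) * \<gamma>0 e' j) = (\<Sum>e'\<in>\<Union>B. if e' = e then \<gamma>0 e' j else 0)" for j
      by (rule sum.cong) auto
    also have "\<dots> j = \<gamma>0 e j" for j using that by (subst sum.delta) auto
    finally have "\<gamma>0 e = (\<lambda>j. \<Sum>e'\<in>\<Union>B. (if e' = e then 1 else 0) * \<gamma>0 e' j)" by auto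
    then have "\<gamma>0 e \<in> fam_span (\<Union>B) \<gamma>0"
      unfolding fam_span_def by (intro CollectI exI[of _ "\<lambda>e'. if e' = e then 1 else 0"])
    then show ?thesis using H(2) Ha by blast
  qed
  \<comment> \<open>These vectors span the hyperplane. The liftings are required to vanish on them,
    a normalisation that survives limits and is met by only the zero one among the degenerate
    liftings.\<close>
  obtain S0 where S0: "S0 \<subseteq> \<Union>B" "\<not> lin_dep_fam \<gamma>0 S0"
    "\<And>b e. (\<And>s. s \<in> S0 \<Longrightarrow> dotp b (\<gamma>0 s) = 0) \<Longrightarrow> e \<in> \<Union>B \<Longrightarrow> dotp b (\<gamma>0 e) = 0"
    using maximal_independent[of "\<Union>B" \<gamma>0] by blast
  have par_a: "par a b" if b: "\<And>s. s \<in> S0 \<Longrightarrow> dotp b (\<gamma>0 s) = 0" for b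
  proof (rule ccontr)
    assume "\<not> par a b"
    then obtain v where v: "dotp a v = 0" "dotp b v = 1" using not_par_dual by blast
    then have "v \<in> fam_span (\<Union>B) \<gamma>0" using H(2) Ha by simp
    then obtain c where "v = (\<lambda>j. \<Sum>e\<in>\<Union>B. c e * \<gamma>0 e j)" by (auto simp: fam_span_def)
    then have "dotp b v = 0" using S0(3)[OF b] by simp
    then show False using v(2) by simp
  qed
  have "\<exists>S\<subseteq>l. card S = CARD('n) - 1" if "l \<in> B" for l
  proof -
    have "CARD('n) - 1 \<le> card l" using line_card[of l] that BL by auto
    then show ?thesis by (meson obtain_subset_with_card_n)
  qed
  then obtain T where T: "\<And>l. l \<in> B \<Longrightarrow> T l \<subseteq> l \<and> card (T l) = CARD('n) - 1" by metis
  obtain \<eta> where \<eta>: "\<And>e. dotp a (\<eta> e) = 0" "\<And>l. l \<in> B \<Longrightarrow> \<not> lin_dep_fam \<eta> (T l)"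
    using generic_in_hyperplane[OF anz, of B T] T by blast
  \<comment> \<open>A segment from the given family to a generic one; all but finitely many of its
    members keep \<open>S0\<close> and every \<open>T l\<close> independent.\<close>
  define \<Gamma> where "\<Gamma> = (\<lambda>t e j. (1 - t) * \<gamma>0 e j + t * \<eta> e j)"
  have \<Gamma>vc: "vcurve (\<lambda>t. \<Gamma> t e)" for e
    unfolding \<Gamma>_def by (intro vcurve_intros polynomial_intros)
  have \<Gamma>01: "\<Gamma> 0 = \<gamma>0" "\<Gamma> 1 = \<eta>" by (auto simp: \<Gamma>_def)
  have \<Gamma>H: "dotp a (\<Gamma> t e) = 0" if "e \<in> \<Union>B" for t e
    using \<gamma>0[OF that] \<eta>(1) by (simp add: \<Gamma>_def)
  define bad where "bad = {t. \<Gamma> t \<in> {\<gamma>. lin_dep_fam \<gamma> S0}} \<union> (\<Union>l\<in>B. {t. \<Gamma> t \<in> {\<gamma>. lin_dep_fam \<gamma> (T l)}})"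
  have "finite {t. \<Gamma> t \<in> {\<gamma>. lin_dep_fam \<gamma> S0}}"
    by (rule curve_finite_in_closed[of _ _ 0]) (use zariski_closed_lin_dep \<Gamma>vc \<Gamma>01 S0 in auto)
  moreover have "finite {t. \<Gamma> t \<in> {\<gamma>. lin_dep_fam \<gamma> (T l)}}" if "l \<in> B" for l
    by (rule curve_finite_in_closed[of _ _ 1]) (use zariski_closed_lin_dep \<Gamma>vc \<Gamma>01 \<eta> that in auto)
  ultimately have bad: "finite bad" by (simp add: bad_def)
  show thesis
  proof (rule ccontr)
    assume nothesis: "\<not> thesis"
    have flex: "\<not> rigid B q (\<Gamma> t) l0" for t
    proof
      assume "rigid B q (\<Gamma> t) l0"
      have thesis by (rule that[of a q "\<Gamma> t"]) fact+
      with nothesis show False ..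
    qed
    \<comment> \<open>Nonzero parameters tending to 0, later shifted by \<open>K\<close> past the
      finite set \<open>bad\<close>.\<close>
    define u where "u = (\<lambda>k :: nat. complex_of_real (inverse (real (Suc k))))"
    have u: "inj u" by (auto simp: u_def inj_def)
    have "finite (u -` bad)" using bad u by (rule finite_vimageI)
    then obtain K where K: "\<And>k. u k \<in> bad \<Longrightarrow> k < K" by (auto simp: finite_nat_set_iff_bounded)
    define w where "w = (\<lambda>k. u (k + K))"
    have wbad: "w k \<notin> bad" for k using K[of "k + K"] by (auto simp: w_def)
    have "u \<longlonglongrightarrow> of_real 0" unfolding u_def by (intro tendsto_of_real LIMSEQ_inverse_real_of_nat)
    then have w0: "w \<longlonglongrightarrow> 0" unfolding w_def using LIMSEQ_ignore_initial_segment[of u] by simp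
    define P where "P = (\<lambda>k (y :: complex^'d). norm y = 1 \<and> (\<forall>e. e \<notin> \<Union>B \<longrightarrow> y $ e = 0) \<and>
      (\<forall>e\<in>S0. y $ e = 0) \<and> (\<forall>S. upper_paving_dep (mrank M) B S \<longrightarrow>
        lin_dep_fam (\<lambda>e j. \<Gamma> (w k) e j + y $ e * q j) S))"
    have "\<exists>y. P k y" for k
      unfolding P_def
    proof (rule not_rigid_lifting[OF l0 q \<Gamma>H _ S0(1) _ flex])
      show "\<not> lin_dep_fam (\<Gamma> (w k)) S0" using wbad[of k] by (simp add: bad_def)
      show "T l \<subseteq> l \<and> card (T l) = CARD('n) - 1 \<and> \<not> lin_dep_fam (\<Gamma> (w k)) (T l)" if "l \<in> B" for l
        using wbad[of k] T[OF that] that by (simp add: bad_def)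
    qed
    then obtain y where "\<And>k. P k (y k)" by metis
    then have y: "norm (y k) = 1" "e \<notin> \<Union>B \<Longrightarrow> y k $ e = 0" "e \<in> S0 \<Longrightarrow> y k $ e = 0"
      "upper_paving_dep (mrank M) B S \<Longrightarrow> lin_dep_fam (\<lambda>e j. \<Gamma> (w k) e j + y k $ e * q j) S" for k e S
      unfolding P_def by blast+
    have "\<And>k. y k \<in> sphere 0 1" using y(1) by simp
    then obtain x r where x: "x \<in> sphere 0 1" "strict_mono r" "(y \<circ> r) \<longlonglongrightarrow> x"
      using compact_sphere[of "0 :: complex^'d" 1] unfolding compact_def by metis
    have xe: "(\<lambda>k. y (r k) $ e) \<longlonglongrightarrow> x $ e" for e
      using tendsto_vec_nth[OF x(3), of e] by (simp add: o_def)
    have zero: "x $ e = 0" if "\<And>k. y k $ e = 0" for e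
      using xe[of e] that by (simp add: LIMSEQ_const_iff)
    have wr: "(\<lambda>k. w (r k)) \<longlonglongrightarrow> 0" using LIMSEQ_subseq_LIMSEQ[OF w0 x(2)] by (simp add: o_def)
    have lim\<Gamma>: "(\<lambda>k. \<Gamma> (w (r k)) e j) \<longlonglongrightarrow> \<gamma>0 e j" for e j
    proof -
      have "(\<lambda>k. (1 - w (r k)) * \<gamma>0 e j + w (r k) * \<eta> e j) \<longlonglongrightarrow> (1 - 0) * \<gamma>0 e j + 0 * \<eta> e j"
        by (intro tendsto_intros wr)
      then show ?thesis by (simp add: \<Gamma>_def)
    qed
    have "lin_dep_fam (\<lambda>e j. \<gamma>0 e j + x $ e * q j) S" if "upper_paving_dep (mrank M) B S" for S
    proof -
      have "(\<lambda>e j. \<gamma>0 e j + x $ e * q j) \<in> {\<gamma>. lin_dep_fam \<gamma> S}"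
      proof (rule zariski_closed_limit[OF zariski_closed_lin_dep])
        show "(\<lambda>e j. \<Gamma> (w (r k)) e j + y (r k) $ e * q j) \<in> {\<gamma>. lin_dep_fam \<gamma> S}" for k
          using y(4)[OF that] by simp
        show "(\<lambda>k. \<Gamma> (w (r k)) e j + y (r k) $ e * q j) \<longlonglongrightarrow> \<gamma>0 e j + x $ e * q j" for e j
          by (intro tendsto_intros lim\<Gamma> xe)
      qed
      then show ?thesis by simp
    qed
    then obtain H' where H': "lin_hyperplane H'" "\<forall>e\<in>\<Union>B. (\<lambda>j. \<gamma>0 e j + x $ e * q j) \<in> H'"
      using nolift[of "\<lambda>e. x $ e"] by blast
    from H'(1) obtain b i where bi: "b i \<noteq> 0" "H' = {x. dotp b x = 0}"
      unfolding lin_hyperplane_def dotp_def by (elim exE conjE)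
    then have b: "b \<noteq> (\<lambda>_. 0)" "H' = {x. dotp b x = 0}" by auto
    have be: "dotp b (\<gamma>0 e) + x $ e * dotp b q = 0" if "e \<in> \<Union>B" for e
      using H'(2) that b(2) by auto
    \<comment> \<open>The limit lifting vanishes on \<open>S0\<close>, so its hyperplane contains
      the spanning vectors and is the original one. Then the lifting is zero everywhere, although
      its norm is 1.\<close>
    have pab: "par a b"
    proof (rule par_a)
      show "dotp b (\<gamma>0 s) = 0" if "s \<in> S0" for s
      proof -
        have "s \<in> \<Union>B" using S0(1) that by blast
        then show ?thesis using be[of s] zero[of s] y(3)[OF that] by simp
      qed
    qed
    have "dotp b q \<noteq> 0"
      using par_dotp[OF par_sym[OF pab] b(1), of q] q by auto
    moreover have "dotp b (\<gamma>0 e) = 0" if "e \<in> \<Union>B" for e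
      using par_dotp[OF pab anz] \<gamma>0[OF that] by blast
    ultimately have "x $ e = 0" for e
      using be[of e] zero[of e] y(2) by (cases "e \<in> \<Union>B") auto
    then have "x = 0" by (simp add: vec_eq_iff)
    then show False using x(1) by simp
  qed
qed

section \<open>Comparing two nice partitions\<close>

lemma X_transversal_generic:
  assumes Q: "partition_on L Q" "separated Q"
  obtains \<gamma> T where "\<gamma> \<in> X Q"
    "\<And>l. l \<in> L \<Longrightarrow> T l \<subseteq> l \<and> card (T l) = CARD('n) - 1 \<and> \<not> lin_dep_fam \<gamma> (T l)"
proof -
  have "\<exists>S\<subseteq>l. card S = CARD('n) - 1 \<and> \<not> MQ_dep M Q S" if "l \<in> L" for l
    using transversal_subset[OF Q blk_in[OF Q(1) that]]
      transversal_independent[OF blk_in(1)[OF Q(1) that]]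
    by metis
  then obtain T where T: "\<And>l. l \<in> L \<Longrightarrow> T l \<subseteq> l \<and> card (T l) = CARD('n) - 1 \<and> \<not> MQ_dep M Q (T l)"
    by metis
  have ne: "X Q \<noteq> {}" using X_nonempty[OF Q] .
  have "\<exists>\<gamma>\<in>X Q. \<forall>l\<in>L. \<not> lin_dep_fam \<gamma> (T l)"
  proof (rule ccontr)
    assume no: "\<not> ?thesis"
    have "X Q \<subseteq> {}"
    proof (rule irreducible_dense[OF X_irreducible[OF ne], of _ L "\<lambda>l. {\<gamma>. lin_dep_fam \<gamma> (T l)}"])
      show "\<not> X Q \<subseteq> {\<gamma>. lin_dep_fam \<gamma> (T l)}" if "l \<in> L" for l
        using independent_realized_in_X[OF Q] T[OF that] by blast
      show "\<gamma> \<in> {}" if "\<gamma> \<in> X Q" "\<And>l. l \<in> L \<Longrightarrow> \<gamma> \<notin> {\<gamma>. lin_dep_fam \<gamma> (T l)}" for \<gamma>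
        using no that by blast
    qed (auto simp: zariski_closed_empty zariski_closed_lin_dep)
    then show False using ne by blast
  qed
  then show thesis using that T by blast
qed

text \<open>At a generic point of \<open>X Q1\<close> every line determines its hyperplane. As a
  member of \<open>Y Q2\<close> this point has one hyperplane for a whole block of
  \<open>Q2\<close>, so the lines of that block have parallel normals.\<close>

lemma Y_subset_refines:
  assumes Q1: "partition_on L Q1" "separated Q1" and Q2: "partition_on L Q2"
    and sub: "Y Q1 \<subseteq> Y Q2" and l: "l \<in> L" "l' \<in> L" "blk Q2 l = blk Q2 l'"
  shows "blk Q1 l = blk Q1 l'"
proof (rule ccontr)
  assume ne: "blk Q1 l \<noteq> blk Q1 l'"
  obtain \<gamma> T where \<gamma>: "\<gamma> \<in> X Q1"
    and T: "\<And>l. l \<in> L \<Longrightarrow> T l \<subseteq> l \<and> card (T l) = CARD('n) - 1 \<and> \<not> lin_dep_fam \<gamma> (T l)"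
    using X_transversal_generic[OF Q1] by blast
  obtain a where a: "normals Q1 a \<gamma>" using \<gamma> by (auto simp: X_def)
  have "\<gamma> \<in> Y Q2" using \<gamma> sub X_subset_Y by blast
  then obtain d where d: "d \<noteq> (\<lambda>_. 0)" "\<And>e. e \<in> \<Union>(blk Q2 l) \<Longrightarrow> dotp d (\<gamma> e) = 0"
    using Y_block_normal[OF Q2 blk_in(1)[OF Q2 l(1)]] by blast
  have p: "par (a m) d" if m: "m \<in> L" "blk Q2 m = blk Q2 l" for m
  proof (rule normal_unique[of \<gamma> "T m"])
    have "T m \<subseteq> m" "m \<subseteq> \<Union>(blk Q2 l)" using T[OF m(1)] blk_in(2)[OF Q2 m(1)] m(2) by auto
    then show "dotp (a m) (\<gamma> s) = 0" "dotp d (\<gamma> s) = 0" if "s \<in> T m" for s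
      using normalsD(2)[OF a m(1)] d(2) that by blast+
  qed (use T[OF m(1)] in auto)
  have "par (a l) (a l')"
    using par_trans[OF p[OF l(1) refl] par_sym[OF p[OF l(2) l(3)[symmetric]]] d(1)] .
  then show False using normalsD(4)[OF a l(1,2) ne] by blast
qed

text \<open>Each normal vanishes on its own line, so normals scaled to value 1 at \<open>q\<close>
  agree, with value zero, at common points. Their differences from the one of \<open>l0\<close> are
  coherent, and nonzero at \<open>l1\<close> since the two hyperplanes differ.\<close>

lemma normals_flexible:
  assumes Q: "partition_on L Q" and a: "normals Q a \<delta>" and B: "B \<subseteq> L"
    and l: "l0 \<in> B" "l1 \<in> B" "blk Q l0 \<noteq> blk Q l1"
  shows "\<not> rigid B q \<delta> l0"
proof
  assume rig: "rigid B q \<delta> l0"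
  have ne: "l1 \<noteq> l0" using l(3) by auto
  have \<delta>: "dotp (a l) (\<delta> e) = 0" if "l \<in> B" "e \<in> l" for l e
    using normalsD(2)[OF a] that B by blast
  have nz: "a l \<noteq> (\<lambda>_. 0)" if "l \<in> B" for l using normalsD(1)[OF a] that B by blast
  have trivial: "g l = g l0"
    if "\<And>l. l \<in> B \<Longrightarrow> dotp (g l) q = dotp (g l0) q"
      "\<And>l e. l \<in> B \<Longrightarrow> e \<in> l \<Longrightarrow> dotp (g l) (\<delta> e) = 0" "l \<in> B" for g l
  proof -
    have "coherent B q \<delta> l0 (\<lambda>l j. g l j - g l0 j)"
    proof (rule coherentI)
      show "dotp (\<lambda>j. g m j - g l0 j) q = 0" if "m \<in> B" for m
        using \<open>\<And>l. l \<in> B \<Longrightarrow> dotp (g l) q = dotp (g l0) q\<close>[OF that] by simp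
      show "dotp (\<lambda>j. g m j - g l0 j) (\<delta> e) = dotp (\<lambda>j. g m' j - g l0 j) (\<delta> e)"
        if "m \<in> B" "m' \<in> B" "e \<in> m \<inter> m'" for m m' e
        using \<open>\<And>l e. l \<in> B \<Longrightarrow> e \<in> l \<Longrightarrow> dotp (g l) (\<delta> e) = 0\<close> that by simp
    qed simp
    then have "(\<lambda>j. g l j - g l0 j) = (\<lambda>_. 0)" using rig \<open>l \<in> B\<close> unfolding rigid_def by blast
    then show ?thesis by (simp add: fun_eq_iff)
  qed
  show False
  proof (cases "\<exists>m\<in>B. dotp (a m) q = 0")
    case True
    then obtain m where m: "m \<in> B" "dotp (a m) q = 0" by blast
    \<comment> \<open>A normal vanishing at \<open>q\<close> cannot be scaled. Taken on the line
      \<open>m\<close> alone, with zero on all others, it already contradicts rigidity.\<close>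
    define g where "g = (\<lambda>l. if l = m then a m else (\<lambda>_. 0))"
    have "g l = g l0" if "l \<in> B" for l
      by (rule trivial) (use m \<delta> that in \<open>auto simp: g_def\<close>)
    from this[OF m(1)] this[OF l(2)] show False
      using nz[OF m(1)] ne by (auto simp: g_def split: if_splits)
  next
    case False
    define g where "g = (\<lambda>l j. a l j / dotp (a l) q)"
    have gq: "dotp (g l) q = 1" if "l \<in> B" for l using False that by (simp add: g_def)
    have "g l1 = g l0"
      by (rule trivial) (use gq \<delta> l in \<open>auto simp: g_def\<close>)
    then have "a l1 j / dotp (a l1) q = a l0 j / dotp (a l0) q" for j by (metis g_def)
    then have "a l1 = (\<lambda>j. (dotp (a l1) q / dotp (a l0) q) * a l0 j)"
      using False l by (auto simp: field_simps)
    then have "par (a l0) (a l1)" unfolding par_def by (metis mult.left_commute mult.commute)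
    then show False using normalsD(4)[OF a _ _ l(3)] l B by blast
  qed
qed

text \<open>Rigidity depends only on the points lying on two lines of \<open>B\<close>, and by
  tameness these are on no line of another block. All remaining points are put at zero, which
  satisfies every incidence.\<close>

lemma rigid_realized_in_X:
  assumes Q: "partition_on L Q" and B: "B \<in> Q" and l: "l0 \<in> B" "l1 \<in> B" "l0 \<noteq> l1"
    and a: "dotp a q = 1" "\<And>e. e \<in> \<Union>B \<Longrightarrow> dotp a (\<gamma> e) = 0" "rigid B q \<gamma> l0"
  shows "\<exists>\<delta>\<in>X Q. rigid B q \<delta> l0"
proof -
  have anz: "a \<noteq> (\<lambda>_. 0)" using a(1) by auto
  have n2: "CARD('n) \<ge> 2"
    using two_lines_rank[of l0 l1] block_lines[OF Q B] l by blast
  obtain i where i: "a i \<noteq> 0" using anz by auto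
  obtain k where k: "k \<noteq> i"
  proof (rule ccontr)
    assume "\<not> thesis"
    then have "(UNIV :: 'n set) \<subseteq> {i}" using that by blast
    then have "CARD('n) \<le> card {i}" by (intro card_mono) auto
    then show False using n2 by simp
  qed
  define b where "b = (\<lambda>j. if j = k then 1 else (0 :: complex))"
  have np: "\<not> par a b" using i k unfolding par_def b_def by (metis mult_cancel_left1 mult_zero_right)
  obtain \<phi> :: "'d set set \<Rightarrow> nat" where \<phi>: "inj \<phi>"
    using finite_imp_inj_to_nat_seg[of "UNIV :: 'd set set set"] by auto
  \<comment> \<open>The shift by \<open>\<phi> B\<close> gives \<open>B\<close> the normal
    \<open>a\<close> itself; every other block receives another member of the pencil.\<close>
  define \<tau> where "\<tau> = (\<lambda>C. of_nat (\<phi> C) - of_nat (\<phi> B) :: complex)"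
  have \<tau>: "\<tau> C = \<tau> D \<longleftrightarrow> C = D" for C D using \<phi> by (auto simp: \<tau>_def inj_eq)
  define h where "h = (\<lambda>C j. a j + \<tau> C * b j)"
  have hnz: "h C \<noteq> (\<lambda>_. 0)" for C
  proof
    assume "h C = (\<lambda>_. 0)"
    then have "par (h C) (\<lambda>j. a j + (\<tau> C + 1) * b j)" by (simp add: par_def)
    then show False using not_par_add_scaled[OF np, of "\<tau> C" "\<tau> C + 1"] by (simp add: h_def)
  qed
  define \<delta> where "\<delta> = (\<lambda>e. if \<exists>l\<in>B. \<exists>l'\<in>B. l \<noteq> l' \<and> e \<in> l \<and> e \<in> l' then \<gamma> e else (\<lambda>_. 0))"
  have "normals Q (\<lambda>l. h (blk Q l)) \<delta>"
    unfolding normals_def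
  proof (intro conjI ballI)
    fix l assume lL: "l \<in> L"
    show "h (blk Q l) \<noteq> (\<lambda>_. 0)" by (rule hnz)
    show "dotp (h (blk Q l)) (\<delta> e) = 0" if e: "e \<in> l" for e
    proof (cases "\<exists>l\<in>B. \<exists>l'\<in>B. l \<noteq> l' \<and> e \<in> l \<and> e \<in> l'")
      case True
      then obtain m m' where m: "m \<in> B" "m' \<in> B" "m \<noteq> m'" "e \<in> m" "e \<in> m'" by blast
      then have "l \<in> B"
        using line_tame[of m m' l e] block_lines[OF Q B m(1)] block_lines[OF Q B m(2)] lL e by auto
      then have "h (blk Q l) = a" using blk_eq[OF Q B] by (simp add: h_def \<tau>_def)
      then show ?thesis using a(2)[of e] \<open>l \<in> B\<close> e by (auto simp: \<delta>_def)
    next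
      case False
      then have "\<delta> e = (\<lambda>_. 0)" unfolding \<delta>_def by (rule if_not_P)
      then show ?thesis by simp
    qed
    fix l' assume "l' \<in> L"
    show "if blk Q l = blk Q l' then h (blk Q l) = h (blk Q l') else \<not> par (h (blk Q l)) (h (blk Q l'))"
      using not_par_add_scaled[OF np, of "\<tau> (blk Q l)" "\<tau> (blk Q l')"] \<tau> by (simp add: h_def)
  qed
  moreover have "rigid B q \<delta> l0"
    unfolding rigid_def
  proof (intro allI impI ballI)
    fix f assume "coherent B q \<delta> l0 f"
    note f = coherentD[OF this]
    have "dotp (f m) (\<gamma> e) = dotp (f m') (\<gamma> e)" if m: "m \<in> B" "m' \<in> B" "e \<in> m \<inter> m'" for m m' e
    proof (cases "m = m'")
      case False
      then have "\<delta> e = \<gamma> e" unfolding \<delta>_def using m by (intro if_P) blast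
      then show ?thesis using f(3)[OF m] by simp
    qed simp
    then have "coherent B q \<gamma> l0 f" using f(1,2) by (intro coherentI)
    then show "f l = (\<lambda>_. 0)" if "l \<in> B" for l using a(3) that unfolding rigid_def by blast
  qed
  ultimately show ?thesis by (auto simp: X_def)
qed

lemma nice_irredundant:
  assumes n1: "nice_partition TYPE('n) M Q1" and n2: "nice_partition TYPE('n) M Q2"
    and sub: "Y Q1 \<subseteq> Y Q2"
  shows "Q1 = Q2"
proof (rule ccontr)
  assume ne: "Q1 \<noteq> Q2"
  have Q1: "partition_on L Q1" "separated Q1" and Q2: "partition_on L Q2" "separated Q2"
    using n1 n2 nice_partition_iff by auto
  have image: "Q = blk Q ` L" if Q: "partition_on L Q" for Q
  proof
    show "Q \<subseteq> blk Q ` L"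
    proof
      fix B assume B: "B \<in> Q"
      obtain l where l: "l \<in> B" using block_nonempty[OF Q B] by blast
      then show "B \<in> blk Q ` L" using blk_eq[OF Q B l] block_lines[OF Q B l] by blast
    qed
    show "blk Q ` L \<subseteq> Q" using blk_in(1)[OF Q] by blast
  qed
  have blk_set: "blk Q l = {l' \<in> L. blk Q l' = blk Q l}" if "partition_on L Q" "l \<in> L" for Q l
    using blk_in[OF that(1)] blk_eq[OF that(1)] block_lines[OF that(1)] that(2) by blast
  \<comment> \<open>One direction of refinement is known, so distinct partitions leave two lines in
    one block of \<open>Q1\<close> but in different blocks of \<open>Q2\<close>.\<close>
  have "\<exists>l0\<in>L. \<exists>l1\<in>L. blk Q1 l0 = blk Q1 l1 \<and> blk Q2 l0 \<noteq> blk Q2 l1"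
  proof (rule ccontr)
    assume "\<not> ?thesis"
    then have same: "blk Q1 l' = blk Q1 l \<longleftrightarrow> blk Q2 l' = blk Q2 l" if "l \<in> L" "l' \<in> L" for l l'
      using Y_subset_refines[OF Q1 Q2(1) sub] that by blast
    have "blk Q1 l = blk Q2 l" if l: "l \<in> L" for l
    proof -
      have "{l' \<in> L. blk Q1 l' = blk Q1 l} = {l' \<in> L. blk Q2 l' = blk Q2 l}" using same[OF l] by auto
      from trans[OF trans[OF blk_set[OF Q1(1) l] this] blk_set[OF Q2(1) l, symmetric]]
      show ?thesis .
    qed
    then show False using image[OF Q1(1)] image[OF Q2(1)] ne by (metis image_cong)
  qed
  then obtain l0 l1 where l: "l0 \<in> L" "l1 \<in> L" "blk Q1 l0 = blk Q1 l1" "blk Q2 l0 \<noteq> blk Q2 l1" by blast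
  define B where "B = blk Q1 l0"
  have B: "B \<in> Q1" "l0 \<in> B" "l1 \<in> B" "l0 \<noteq> l1"
    using blk_in[OF Q1(1) l(1)] blk_in[OF Q1(1) l(2)] l by (auto simp: B_def)
  have BL: "B \<subseteq> L" using block_lines[OF Q1(1) B(1)] by blast
  have "card {l0, l1} \<le> card B" using B by (intro card_mono) auto
  then have "\<not> liftable TYPE('n) (\<Union>B) (upper_paving_dep (mrank M) B)"
    using n1 B unfolding nice_partition_iff by simp
  then obtain a q \<gamma> where a: "dotp a q = 1" "\<And>e. e \<in> \<Union>B \<Longrightarrow> dotp a (\<gamma> e) = 0"
    and rig: "rigid B q \<gamma> l0"
    using not_liftable_imp_rigid[OF BL B(2)] by blast
  have "\<exists>\<delta>\<in>X Q1. rigid B q \<delta> l0"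
    by (rule rigid_realized_in_X[OF Q1(1) B a(1) _ rig]) (rule a(2))
  then obtain \<delta> where \<delta>: "\<delta> \<in> X Q1" "rigid B q \<delta> l0" by blast
  \<comment> \<open>Failure of rigidity is closed and so passes to \<open>Y Q2\<close>, whereas
    \<open>\<delta>\<close> is a rigid member of \<open>X Q1\<close>.\<close>
  have "X Q2 \<subseteq> {\<gamma>. \<not> rigid B q \<gamma> l0}"
    using normals_flexible[OF Q2(1) _ BL B(2,3) l(4)] by (auto simp: X_def)
  then have "Y Q2 \<subseteq> {\<gamma>. \<not> rigid B q \<gamma> l0}" by (intro Y_subset zariski_closed_not_rigid)
  then show False using \<delta> sub X_subset_Y by blast
qed

lemma nice_variety_eq_Y:
  assumes "nice_partition TYPE('n) M Q"
  shows "matroid_variety (MQ_dep M Q) = Y Q"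
  using assms variety_eq_closure unfolding nice_partition_iff Y_def by blast

lemma circuit_variety_decomposition:
  "(circuit_variety (\<lambda>S. S \<notin> M) :: ('d \<Rightarrow> 'n \<Rightarrow> complex) set)
     = (\<Union>Q\<in>{Q. nice_partition TYPE('n) M Q}. matroid_variety (MQ_dep M Q))"
proof
  show "circuit_variety (\<lambda>S. S \<notin> M)
    \<subseteq> (\<Union>Q\<in>{Q. nice_partition TYPE('n) M Q}. matroid_variety (MQ_dep M Q) :: ('d \<Rightarrow> 'n \<Rightarrow> complex) set)"
  proof
    fix \<gamma> :: "'d \<Rightarrow> 'n \<Rightarrow> complex" assume "\<gamma> \<in> circuit_variety (\<lambda>S. S \<notin> M)"
    then obtain Q where Q: "nice_partition TYPE('n) M Q" "\<gamma> \<in> Y Q" using nice_partition_exists by blast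
    then show "\<gamma> \<in> (\<Union>Q\<in>{Q. nice_partition TYPE('n) M Q}. matroid_variety (MQ_dep M Q))"
      using nice_variety_eq_Y[OF Q(1)] by auto
  qed
  have "matroid_variety (MQ_dep M Q) \<subseteq> (circuit_variety (\<lambda>S. S \<notin> M) :: ('d \<Rightarrow> 'n \<Rightarrow> complex) set)"
    if "nice_partition TYPE('n) M Q" for Q
    using that variety_subset_circuit_variety unfolding nice_partition_iff by blast
  then show "(\<Union>Q\<in>{Q. nice_partition TYPE('n) M Q}. matroid_variety (MQ_dep M Q))
    \<subseteq> (circuit_variety (\<lambda>S. S \<notin> M) :: ('d \<Rightarrow> 'n \<Rightarrow> complex) set)" by auto
qed

lemma nice_variety_irreducible:
  assumes "nice_partition TYPE('n) M Q"
  shows "zariski_irreducible (matroid_variety (MQ_dep M Q) :: ('d \<Rightarrow> 'n \<Rightarrow> complex) set)"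
proof -
  have "X Q \<noteq> {}" using assms X_nonempty unfolding nice_partition_iff by blast
  then show ?thesis
    unfolding nice_variety_eq_Y[OF assms] Y_def by (intro zariski_irreducible_closure X_irreducible)
qed

end

theorem theorem4p6:
  fixes M :: "'d::finite set set"
  assumes "matroid M" and "paving M" and "tame M" and "mrank M = card (UNIV :: 'n::finite set)"
  shows "(circuit_variety (\<lambda>S. S \<notin> M) :: ('d \<Rightarrow> 'n \<Rightarrow> complex) set)
           = (\<Union>Q\<in>{Q. nice_partition TYPE('n) M Q}. matroid_variety (MQ_dep M Q))
     \<and> (\<forall>Q. nice_partition TYPE('n) M Q \<longrightarrow>
           zariski_irreducible (matroid_variety (MQ_dep M Q) :: ('d \<Rightarrow> 'n \<Rightarrow> complex) set))
     \<and> (\<forall>Q1 Q2. nice_partition TYPE('n) M Q1 \<longrightarrow> nice_partition TYPE('n) M Q2 \<longrightarrow> Q1 \<noteq> Q2 \<longrightarrow>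
           \<not> (matroid_variety (MQ_dep M Q1) :: ('d \<Rightarrow> 'n \<Rightarrow> complex) set)
               \<subseteq> matroid_variety (MQ_dep M Q2))"
proof -
  interpret tame_paving M "TYPE('n)" by unfold_locales (use assms in auto)
  show ?thesis
  proof (intro conjI allI impI)
    fix Q1 Q2
    assume "nice_partition TYPE('n) M Q1" "nice_partition TYPE('n) M Q2" "Q1 \<noteq> Q2"
    then show "\<not> (matroid_variety (MQ_dep M Q1) :: ('d \<Rightarrow> 'n \<Rightarrow> complex) set)
        \<subseteq> matroid_variety (MQ_dep M Q2)"
      using nice_irredundant[of Q1 Q2] nice_variety_eq_Y[of Q1] nice_variety_eq_Y[of Q2] by metis
  qed (rule circuit_variety_decomposition nice_variety_irreducible; assumption)+
qed

end
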